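(* Let $\Bbbk$ be an algebraically closed field of characteristic $2$, let $\wp,q_{22}\in\Bbbk^\times$ and $a\in\Bbbk$ with $a\neq0$. Let $\mathfrak{L}_{\wp}(q_{22},a)$ be the braided vector space with basis $x_1,x_2,x_3$ defined in the context. Then $\dim\mathscr{B}(\mathfrak{L}_{\wp}(q_{22},a))<\infty$ if and only if $q_{22}=1$. Precisely, $$\dim\mathscr{B}(\mathfrak{L}_{\wp}(1,a))=\begin{cases}2^7 & \text{if } a=1,\\ 2^8 & \text{if } a\in\Bbbk\setminus\{0,1\}.\end{cases}$$
   Context: A braided vector space is a pair $(V,c)$ with $c\in GL(V\otimes V)$ satisfying the braid equation. The Nichols algebra $\mathscr{B}(V)$ is the unique graded connected braided Hopf algebra quotient $\bigoplus_{n\ge0}\mathscr{B}^n(V)$ of the tensor algebra $T(V)$ whose degree-one part is $V$ and coincides with the space of primitive elements; as an algebra it depends only on the braiding $c$. Put $q_{11}=1$, $q_{12}=\wp$, $q_{21}=\wp^{-1}$ (so $q_{12}q_{21}=1$). The braided vector space $\mathfrak{L}_{\wp}(q_{22},a)$ has basis $x_1,x_2,x_3$ and braiding, for $i\in\{1,2\}$: $c(x_i\otimes x_1)=x_1\otimes x_i$, $c(x_i\otimes x_2)=(x_2+x_1)\otimes x_i$, $c(x_i\otimes x_3)=q_{12}\,x_3\otimes x_i$, and $c(x_3\otimes x_1)=q_{21}\,x_1\otimes x_3$, $c(x_3\otimes x_2)=q_{21}(x_2+a x_1)\otimes x_3$, $c(x_3\otimes x_3)=q_{22}\,x_3\otimes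 x_3$. *)

theory Defs
  imports
    "HOL-Computational_Algebra.Computational_Algebra"
    "HOL-Library.Poly_Mapping"
    "HOL-Library.Extended_Nat"
begin

section \<open>Free vector spaces\<close>

text \<open>
  The type \<^typ>\<open>'b \<Rightarrow>\<^sub>0 'k\<close> is the vector space over \<^typ>\<open>'k\<close> with basis \<^typ>\<open>'b\<close>.
  A vector space \<open>V\<close> with basis \<open>x\<^sub>i\<close>, for \<open>i\<close> in \<^typ>\<open>'i\<close>, is \<^typ>\<open>'i \<Rightarrow>\<^sub>0 'k\<close>; its tensor algebra
  \<open>T(V)\<close> is \<^typ>\<open>'i list \<Rightarrow>\<^sub>0 'k\<close>, the empty word being the unit; and a tensor product of two such spaces
  has as basis the product of the two bases.
\<close>

definition fv_scale :: "'k::field \<Rightarrow> ('b \<Rightarrow>\<^sub>0 'k) \<Rightarrow> ('b \<Rightarrow>\<^sub>0 'k)"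
  where "fv_scale r p = Poly_Mapping.map ((*) r) p"

lemma lookup_fv_scale [simp]:
  "Poly_Mapping.lookup (fv_scale r p) b = r * Poly_Mapping.lookup p b"
  by (auto simp: fv_scale_def map.rep_eq when_def)

global_interpretation fv: vector_space "fv_scale :: 'k::field \<Rightarrow> ('b \<Rightarrow>\<^sub>0 'k) \<Rightarrow> ('b \<Rightarrow>\<^sub>0 'k)"
  by unfold_locales (auto intro!: poly_mapping_eqI simp: lookup_add algebra_simps)

definition basis_vec :: "'b \<Rightarrow> ('b \<Rightarrow>\<^sub>0 'k::field)"
  where "basis_vec b = Poly_Mapping.single b 1"

text \<open>The linear map with prescribed values on the basis vectors.\<close>

definition lin_ext :: "('a \<Rightarrow> ('b \<Rightarrow>\<^sub>0 'k::field)) \<Rightarrow> ('a \<Rightarrow>\<^sub>0 'k) \<Rightarrow> ('b \<Rightarrow>\<^sub>0 'k)"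
  where "lin_ext f p = (\<Sum>a\<in>Poly_Mapping.keys p. fv_scale (Poly_Mapping.lookup p a) (f a))"

definition tens :: "('a \<Rightarrow>\<^sub>0 'k::field) \<Rightarrow> ('b \<Rightarrow>\<^sub>0 'k) \<Rightarrow> ('a \<times> 'b \<Rightarrow>\<^sub>0 'k)"
  where "tens p q = lin_ext (\<lambda>a. lin_ext (\<lambda>b. basis_vec (a, b)) q) p"

lemma lin_ext_basis_vec [simp]: "lin_ext f (basis_vec a) = f a"
  by (simp add: lin_ext_def basis_vec_def)

lemma lin_ext_superset:
  assumes "finite A" "Poly_Mapping.keys p \<subseteq> A"
  shows "lin_ext f p = (\<Sum>a\<in>A. fv_scale (Poly_Mapping.lookup p a) (f a))"
  unfolding lin_ext_def
  by (rule sum.mono_neutral_left) (use assms in \<open>auto simp: in_keys_iff\<close>)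

lemma lin_ext_add [simp]: "lin_ext f (p + q) = lin_ext f p + lin_ext f q"
proof -
  let ?A = "Poly_Mapping.keys p \<union> Poly_Mapping.keys q"
  have "Poly_Mapping.keys (p + q) \<subseteq> ?A"
    by (rule Poly_Mapping.keys_add)
  then show ?thesis
    by (simp add: lin_ext_superset[of ?A] lookup_add fv.scale_left_distrib sum.distrib)
qed

lemma lin_ext_scale [simp]: "lin_ext f (fv_scale r p) = fv_scale r (lin_ext f p)"
proof -
  have "Poly_Mapping.keys (fv_scale r p) \<subseteq> Poly_Mapping.keys p"
    by (auto simp: in_keys_iff)
  then show ?thesis
    by (simp add: lin_ext_superset[of "Poly_Mapping.keys p"] fv.scale_sum_right)
qed

lemma lin_ext_diff [simp]: "lin_ext f (p - q) = lin_ext f p - lin_ext f q"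
  using lin_ext_add[of f "p - q" q] by (simp del: lin_ext_add)

lemma linear_lin_ext: "Vector_Spaces.linear fv_scale fv_scale (lin_ext f)"
  by unfold_locales simp_all

lemma tens_basis_vec [simp]: "tens (basis_vec a) (basis_vec b) = basis_vec (a, b)"
  by (simp add: tens_def)

lemma lin_ext_zero [simp]: "lin_ext f 0 = 0"
  by (simp add: lin_ext_def)

lemma tens_add_left [simp]: "tens (p + p') q = tens p q + tens p' q"
  by (simp add: tens_def)

lemma tens_scale_left [simp]: "tens (fv_scale r p) q = fv_scale r (tens p q)"
  by (simp add: tens_def)

section \<open>Braided vector spaces\<close>

text \<open>
  A braiding of \<open>V\<close> is given by its values on the basis of \<open>V \<otimes> V\<close>.
\<close>

type_synonym ('i, 'k) braiding = "'i \<times> 'i \<Rightarrow> ('i \<times> 'i \<Rightarrow>\<^sub>0 'k)"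

fun braid_12 :: "('i, 'k::field) braiding \<Rightarrow> 'i \<times> 'i \<times> 'i \<Rightarrow> ('i \<times> 'i \<times> 'i \<Rightarrow>\<^sub>0 'k)"
  where "braid_12 c (x, y, z) = lin_ext (\<lambda>(x', y'). basis_vec (x', y', z)) (c (x, y))"

fun braid_23 :: "('i, 'k::field) braiding \<Rightarrow> 'i \<times> 'i \<times> 'i \<Rightarrow> ('i \<times> 'i \<times> 'i \<Rightarrow>\<^sub>0 'k)"
  where "braid_23 c (x, y, z) = lin_ext (\<lambda>(y', z'). basis_vec (x, y', z')) (c (y, z))"

definition braided_vector_space :: "('i, 'k::field) braiding \<Rightarrow> bool"
  where "braided_vector_space c \<longleftrightarrow>
    bij (lin_ext c) \<and>
    lin_ext (braid_12 c) \<circ> lin_ext (braid_23 c) \<circ> lin_ext (braid_12 c) =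
    lin_ext (braid_23 c) \<circ> lin_ext (braid_12 c) \<circ> lin_ext (braid_23 c)"

section \<open>The tensor algebra as a braided Hopf algebra\<close>

type_synonym ('i, 'k) tensor_alg = "'i list \<Rightarrow>\<^sub>0 'k"

definition tone :: "('i, 'k::field) tensor_alg"
  where "tone = basis_vec []"

definition tmul :: "('i, 'k::field) tensor_alg \<Rightarrow> ('i, 'k) tensor_alg \<Rightarrow> ('i, 'k) tensor_alg"
  where "tmul p q = lin_ext (\<lambda>(u, w). basis_vec (u @ w)) (tens p q)"

definition tdeg :: "nat \<Rightarrow> ('i, 'k::field) tensor_alg set"
  where "tdeg n = {p. \<forall>w\<in>Poly_Mapping.keys p. length w = n}"

definition tcomp :: "nat \<Rightarrow> ('i, 'k::field) tensor_alg \<Rightarrow> ('i, 'k) tensor_alg"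
  where "tcomp n = lin_ext (\<lambda>w. if length w = n then basis_vec w else 0)"

definition tcounit :: "('i, 'k::field) tensor_alg \<Rightarrow> 'k"
  where "tcounit p = Poly_Mapping.lookup p []"

text \<open>
  The braiding \<open>T(V) \<otimes> T(V) \<rightarrow> T(V) \<otimes> T(V)\<close> induced by \<open>c\<close>, determined by
  \<open>c(1 \<otimes> p) = p \<otimes> 1\<close>, \<open>c(p \<otimes> 1) = 1 \<otimes> p\<close>,
  \<open>c (id \<otimes> m) = (m \<otimes> id) (id \<otimes> c) (c \<otimes> id)\<close> and
  \<open>c (m \<otimes> id) = (id \<otimes> m) (c \<otimes> id) (id \<otimes> c)\<close>.
  First the restriction to \<open>V \<otimes> T(V)\<close>, which takes values in \<open>T(V) \<otimes> V\<close>.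
\<close>

fun braid_letter :: "('i, 'k::field) braiding \<Rightarrow> 'i \<Rightarrow> 'i list \<Rightarrow> ('i list \<times> 'i \<Rightarrow>\<^sub>0 'k)"
  where
    "braid_letter c x [] = basis_vec ([], x)"
  | "braid_letter c x (y # w) =
      lin_ext (\<lambda>(y', x'). lin_ext (\<lambda>(w', x''). basis_vec (y' # w', x'')) (braid_letter c x' w))
        (c (x, y))"

fun tbraid :: "('i, 'k::field) braiding \<Rightarrow> 'i list \<times> 'i list \<Rightarrow> ('i list \<times> 'i list \<Rightarrow>\<^sub>0 'k)"
  where
    "tbraid c ([], w) = basis_vec (w, [])"
  | "tbraid c (x # u, w) =
      lin_ext (\<lambda>(w', u'). lin_ext (\<lambda>(w'', x'). basis_vec (w'', x' # u')) (braid_letter c x w'))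
        (tbraid c (u, w))"

text \<open>
  The algebra structure \<open>(m \<otimes> m) (id \<otimes> c \<otimes> id)\<close> on \<open>T(V) \<otimes> T(V)\<close>, and the comultiplication:
  the algebra map with \<open>x \<mapsto> x \<otimes> 1 + 1 \<otimes> x\<close> for \<open>x\<close> in \<open>V\<close>.
\<close>

definition tmul2 :: "('i, 'k::field) braiding \<Rightarrow>
    ('i list \<times> 'i list \<Rightarrow>\<^sub>0 'k) \<Rightarrow> ('i list \<times> 'i list \<Rightarrow>\<^sub>0 'k) \<Rightarrow> ('i list \<times> 'i list \<Rightarrow>\<^sub>0 'k)"
  where "tmul2 c P Q =
    lin_ext (\<lambda>((s, t), (u, w)). lin_ext (\<lambda>(u', t'). basis_vec (s @ u', t' @ w)) (tbraid c (t, u)))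
      (tens P Q)"

fun tcomul_word :: "('i, 'k::field) braiding \<Rightarrow> 'i list \<Rightarrow> ('i list \<times> 'i list \<Rightarrow>\<^sub>0 'k)"
  where
    "tcomul_word c [] = tens tone tone"
  | "tcomul_word c (x # w) =
      tmul2 c (tens (basis_vec [x]) tone + tens tone (basis_vec [x])) (tcomul_word c w)"

definition tcomul :: "('i, 'k::field) braiding \<Rightarrow>
    ('i, 'k) tensor_alg \<Rightarrow> ('i list \<times> 'i list \<Rightarrow>\<^sub>0 'k)"
  where "tcomul c = lin_ext (tcomul_word c)"

definition convolution :: "('i, 'k::field) braiding \<Rightarrow>
    (('i, 'k) tensor_alg \<Rightarrow> ('i, 'k) tensor_alg) \<Rightarrow> (('i, 'k) tensor_alg \<Rightarrow> ('i, 'k) tensor_alg) \<Rightarrow>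
    ('i, 'k) tensor_alg \<Rightarrow> ('i, 'k) tensor_alg"
  where "convolution c F G p =
    lin_ext (\<lambda>(u, w). tmul (F (basis_vec u)) (G (basis_vec w))) (tcomul c p)"

section \<open>Nichols algebras\<close>

text \<open>\<open>I \<otimes> T(V) + T(V) \<otimes> I\<close>, the kernel of \<open>T(V) \<otimes> T(V) \<rightarrow> T(V)/I \<otimes> T(V)/I\<close>.\<close>

definition tens_kernel :: "('i, 'k::field) tensor_alg set \<Rightarrow> ('i list \<times> 'i list \<Rightarrow>\<^sub>0 'k) set"
  where "tens_kernel I = fv.span ({tens p q | p q. p \<in> I} \<union> {tens p q | p q. q \<in> I})"

text \<open>
  The quotient \<open>T(V)/I\<close> is a braided Hopf algebra: multiplication, counit, comultiplication and the
  (invertible) braiding descend to the quotient, and the quotient has an antipode. Since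
  every linear endomorphism of \<open>T(V)/I\<close> lifts to \<open>T(V)\<close>, the antipode is given by a linear map \<open>S\<close>
  on \<open>T(V)\<close> that preserves \<open>I\<close> and satisfies the antipode axioms modulo \<open>I\<close>. All other axioms
  are inherited from \<open>T(V)\<close>.
\<close>

definition braided_hopf_ideal :: "('i, 'k::field) braiding \<Rightarrow> ('i, 'k) tensor_alg set \<Rightarrow> bool"
  where "braided_hopf_ideal c I \<longleftrightarrow>
    fv.subspace I \<and>
    (\<forall>p\<in>I. \<forall>q. tmul p q \<in> I \<and> tmul q p \<in> I) \<and>
    (\<forall>p\<in>I. tcounit p = 0) \<and>
    tcomul c ` I \<subseteq> tens_kernel I \<and>
    lin_ext (tbraid c) ` tens_kernel I = tens_kernel I \<and>
    (\<exists>S. Vector_Spaces.linear fv_scale fv_scale S \<and> S ` I \<subseteq> I \<and>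
      (\<forall>p. convolution c S id p - fv_scale (tcounit p) tone \<in> I \<and>
           convolution c id S p - fv_scale (tcounit p) tone \<in> I))"

text \<open>
  \<open>T(V)/I\<close> is graded and connected, its part of degree one is \<open>V\<close>, and its primitive elements are
  exactly those of degree one.
\<close>

definition nichols_relations :: "('i, 'k::field) braiding \<Rightarrow> ('i, 'k) tensor_alg set \<Rightarrow> bool"
  where "nichols_relations c I \<longleftrightarrow>
    braided_hopf_ideal c I \<and>
    (\<forall>p\<in>I. \<forall>n. tcomp n p \<in> I) \<and>
    I \<inter> tdeg 0 = {0} \<and>
    I \<inter> tdeg 1 = {0} \<and>
    (\<forall>p. tcomul c p - (tens p tone + tens tone p) \<in> tens_kernel I \<longleftrightarrow>
         (\<exists>v\<in>tdeg 1. p - v \<in> I))"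

text \<open>
  The Nichols algebra of \<open>(V, c)\<close> is \<open>T(V)/I\<close> for the following \<open>I\<close>, which is well defined for
  every braided vector space by the standard existence and uniqueness theorem.
\<close>

definition nichols_ideal :: "('i, 'k::field) braiding \<Rightarrow> ('i, 'k) tensor_alg set"
  where "nichols_ideal c = (THE I. nichols_relations c I)"

text \<open>
  The images of the elements of \<open>B\<close> in the quotient by the subspace \<open>U\<close> are pairwise distinct and
  form a basis of the quotient.
\<close>

definition quotient_basis :: "('b \<Rightarrow>\<^sub>0 'k::field) set \<Rightarrow> ('b \<Rightarrow>\<^sub>0 'k) set \<Rightarrow> bool"
  where "quotient_basis U B \<longleftrightarrow>
    fv.independent B \<and> fv.span B \<inter> U = {0} \<and> (\<forall>p. \<exists>b\<in>fv.span B. p - b \<in> U)"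

definition quotient_dim :: "('b \<Rightarrow>\<^sub>0 'k::field) set \<Rightarrow> enat"
  where "quotient_dim U =
    (if \<exists>B. finite B \<and> quotient_basis U B
     then enat (card (SOME B. finite B \<and> quotient_basis U B)) else \<infinity>)"

definition nichols_dim :: "('i, 'k::field) braiding \<Rightarrow> enat"
  where "nichols_dim c = quotient_dim (nichols_ideal c)"

section \<open>The braided vector space $\mathfrak{L}_{\wp}(q_{22}, a)$\<close>

datatype idx = X1 | X2 | X3

fun frakL :: "'k::field \<Rightarrow> 'k \<Rightarrow> 'k \<Rightarrow> (idx, 'k) braiding"
  where
    "frakL wp q22 a (X3, X1) = fv_scale (inverse wp) (tens (basis_vec X1) (basis_vec X3))"
  | "frakL wp q22 a (X3, X2) =
      fv_scale (inverse wp) (tens (basis_vec X2 + fv_scale a (basis_vec X1)) (basis_vec X3))"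
  | "frakL wp q22 a (X3, X3) = fv_scale q22 (tens (basis_vec X3) (basis_vec X3))"
  | "frakL wp q22 a (i, X1) = tens (basis_vec X1) (basis_vec i)"
  | "frakL wp q22 a (i, X2) = tens (basis_vec X2 + basis_vec X1) (basis_vec i)"
  | "frakL wp q22 a (i, X3) = fv_scale wp (tens (basis_vec X3) (basis_vec i))"

fun frakL_inv :: "'k::field \<Rightarrow> 'k \<Rightarrow> 'k \<Rightarrow> (idx, 'k) braiding"
  where
    "frakL_inv wp q22 a (X1, X3) = fv_scale wp (basis_vec (X3, X1))"
  | "frakL_inv wp q22 a (X2, X3) =
      fv_scale wp (basis_vec (X3, X2) + fv_scale (- a) (basis_vec (X3, X1)))"
  | "frakL_inv wp q22 a (X3, X3) = fv_scale (inverse q22) (basis_vec (X3, X3))"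
  | "frakL_inv wp q22 a (X1, i) = basis_vec (i, X1)"
  | "frakL_inv wp q22 a (X2, i) = basis_vec (i, X2) + fv_scale (- 1) (basis_vec (i, X1))"
  | "frakL_inv wp q22 a (X3, i) = fv_scale (inverse wp) (basis_vec (i, X3))"

lemma lin_ext_eqI:
  fixes F G :: "('a \<Rightarrow>\<^sub>0 'k::field) \<Rightarrow> ('b \<Rightarrow>\<^sub>0 'k)"
  assumes "\<And>b. F (basis_vec b) = G (basis_vec b)"
    and "Vector_Spaces.linear fv_scale fv_scale F" "Vector_Spaces.linear fv_scale fv_scale G"
  shows "F = G"
proof
  fix p :: "'a \<Rightarrow>\<^sub>0 'k"
  interpret F: Vector_Spaces.linear fv_scale fv_scale F by fact
  interpret G: Vector_Spaces.linear fv_scale fv_scale G by fact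
  have p: "p = (\<Sum>b\<in>Poly_Mapping.keys p. fv_scale (Poly_Mapping.lookup p b) (basis_vec b))"
    by (rule poly_mapping_eqI)
      (auto simp: lookup_sum basis_vec_def lookup_single when_def in_keys_iff
        sum.delta' if_distrib cong: if_cong)
  show "F p = G p"
    by (subst (1 2) p) (simp add: F.sum G.sum F.scale G.scale assms(1))
qed

lemma lin_ext_comp_linear:
  assumes "Vector_Spaces.linear fv_scale fv_scale F"
  shows "Vector_Spaces.linear fv_scale fv_scale (lin_ext f \<circ> F)"
  using assms linear_lin_ext by (rule Vector_Spaces.linear_compose)

lemma braided_vector_space_frakL:
  fixes wp q22 a :: "'k::field"
  assumes "wp \<noteq> 0" "q22 \<noteq> 0"
  shows "braided_vector_space (frakL wp q22 a)"
proof -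
  note simps = fv.scale_right_distrib fv.scale_left_distrib assms algebra_simps
  have 1: "lin_ext (frakL_inv wp q22 a) \<circ> lin_ext (frakL wp q22 a) = id"
  proof (rule lin_ext_eqI)
    fix b show "(lin_ext (frakL_inv wp q22 a) \<circ> lin_ext (frakL wp q22 a)) (basis_vec b) =
        id (basis_vec b)"
      by (cases "(wp, q22, a, b)" rule: frakL.cases) (auto simp: simps)
  qed (intro lin_ext_comp_linear linear_lin_ext fv.linear_id)+
  have 2: "lin_ext (frakL wp q22 a) \<circ> lin_ext (frakL_inv wp q22 a) = id"
  proof (rule lin_ext_eqI)
    fix b show "(lin_ext (frakL wp q22 a) \<circ> lin_ext (frakL_inv wp q22 a)) (basis_vec b) =
        id (basis_vec b)"
      by (cases "(wp, q22, a, b)" rule: frakL_inv.cases) (auto simp: simps)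
  qed (intro lin_ext_comp_linear linear_lin_ext fv.linear_id)+
  have "bij (lin_ext (frakL wp q22 a))"
    using 1 2 by (rule o_bij)
  moreover have
    "lin_ext (braid_12 (frakL wp q22 a)) \<circ> lin_ext (braid_23 (frakL wp q22 a)) \<circ>
       lin_ext (braid_12 (frakL wp q22 a)) =
     lin_ext (braid_23 (frakL wp q22 a)) \<circ> lin_ext (braid_12 (frakL wp q22 a)) \<circ>
       lin_ext (braid_23 (frakL wp q22 a))" (is "?L = ?R")
  proof (rule lin_ext_eqI)
    fix b :: "idx \<times> idx \<times> idx"
    obtain x y z where b: "b = (x, y, z)" by (cases b)
    show "?L (basis_vec b) = ?R (basis_vec b)"
      unfolding b by (cases x; cases y; cases z) (simp_all add: simps)
  qed (unfold comp_assoc, (intro lin_ext_comp_linear linear_lin_ext)+)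
  ultimately show ?thesis
    by (simp add: braided_vector_space_def)
qed

end

theory Submission
  imports Defs
begin

text \<open>
  The braiding has the form \<open>c(x \<otimes> y) = g\<^sub>x(y) \<otimes> x\<close> with commuting \<open>g\<^sub>x\<close>, so the relations of the Nichols
  algebra are the elements of the tensor algebra killed by the counit after all iterated skew
  derivations, and membership in this ideal can be tested one derivation at a time.

  Modulo these relations, \<open>x\<^sub>1, x\<^sub>2\<close> generate an algebra of dimension 16 with basis \<open>x\<^sub>2\<^sup>c f\<^sub>n\<close>, where \<open>c, n < 4\<close> and
  \<open>f\<^sub>n\<close> runs through \<open>1, x\<^sub>1, x\<^sub>2\<^sub>1, x\<^sub>2\<^sub>1 x\<^sub>1\<close> with \<open>x\<^sub>2\<^sub>1 = x\<^sub>2 x\<^sub>1 + x\<^sub>1 x\<^sub>2\<close>. The elements \<open>z\<^sub>n = (ad x\<^sub>2)\<^sup>n x\<^sub>3\<close> satisfy \<open>\<partial>\<^sub>3 z\<^sub>n = \<mu>\<^sub>n f\<^sub>n\<close> with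
  \<open>\<mu> = 1, a, a, a(1 + a), 0, \<dots>\<close>, and they generate the Nichols algebra of the diagonal braiding with
  matrix \<open>q\<^sub>2\<^sub>2 \<wp>\<^bsup>i - j\<^esup>\<close> on the \<open>z\<^sub>n\<close> with \<open>\<mu>\<^sub>n \<noteq> 0\<close>; the whole algebra is the product of the two parts. For \<open>q\<^sub>2\<^sub>2 = 1\<close>
  the \<open>z\<^sub>n\<close> braid-commute and square to zero, which gives \<open>16 \<cdot> 2\<^sup>3\<close> or \<open>16 \<cdot> 2\<^sup>4\<close>. For \<open>q\<^sub>2\<^sub>2 \<noteq> 1\<close> the three letters
  \<open>z\<^sub>0, z\<^sub>1, z\<^sub>2\<close> already generate an infinite-dimensional algebra: either the powers of \<open>z\<^sub>0\<close>, or an explicit string of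
  real root vectors, never vanish.
\<close>

text \<open>\<open>nichols_ideal\<close> is a definite description over braided Hopf ideals, so the
  radical of the derivations has to be shown both to satisfy the definition, antipode and invertible
  braiding included, and to be the only ideal that does. The comparison with the diagonal braiding
  is asymmetric. Substituting z n for the letter n sends relations to relations; conversely, a
  derivative in \<open>x3\<close> returns \<mu> j times the j-th derivative, which can be undone
  only for letters with \<mu> j \<noteq> 0. As a \<noteq> 0, the letters 0, 1, 2 always qualify, and
  whether 3 does depends on a. On these letters q_ii = q and q_ij q_ji = q^2. If q has order N, then
  q^2 = q^(-(N-2)): Cartan type with all off-diagonal entries -(N-2). Characteristic 2 excludes N =
  2, so with three letters this is never of finite type. For N = 3 it is affine of type A_2^(1), and
  the degree \<delta> of the commutator \<open>e\<close> used below is the null root.\<close>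

abbreviation (input) "keys \<equiv> Poly_Mapping.keys"
abbreviation (input) "lookup \<equiv> Poly_Mapping.lookup"

section \<open>The tensor algebra as a ring\<close>

text \<open>With words as an additive monoid under concatenation, convolution of finitely supported
  maps is the multiplication of the tensor algebra, which thus inherits the ring structure.\<close>

instantiation list :: (type) monoid_add
begin

definition zero_list :: "'a list"
  where "zero_list = []"

definition plus_list :: "'a list \<Rightarrow> 'a list \<Rightarrow> 'a list"
  where "plus_list = (@)"

instance
  by standard (auto simp: zero_list_def plus_list_def)

end

lemma fv_induct [case_names zero basis add]:
  assumes "P 0" "\<And>r b. P (fv_scale r (basis_vec b))" "\<And>p q. P p \<Longrightarrow> P q \<Longrightarrow> P (p + q)"
  shows "P (p :: 'b \<Rightarrow>\<^sub>0 'k::field)"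
proof -
  have p: "p = (\<Sum>b\<in>keys p. fv_scale (lookup p b) (basis_vec b))"
    by (rule poly_mapping_eqI)
      (auto simp: lookup_sum basis_vec_def lookup_single when_def in_keys_iff
        sum.delta' if_distrib cong: if_cong)
  have "P (\<Sum>b\<in>A. fv_scale (lookup p b) (basis_vec b))" if "finite A" for A
    using that by induction (auto intro: assms)
  then show ?thesis
    by (subst p) simp
qed

abbreviation lin :: "(('a \<Rightarrow>\<^sub>0 'k::field) \<Rightarrow> ('b \<Rightarrow>\<^sub>0 'k)) \<Rightarrow> bool"
  where "lin \<equiv> Vector_Spaces.linear fv_scale fv_scale"

lemma linI:
  assumes "\<And>p q. F (p + q) = F p + F q" "\<And>r p. F (fv_scale r p) = fv_scale r (F p)"
  shows "lin F"
  by unfold_locales (use assms in auto)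

lemma lin_add: "lin F \<Longrightarrow> F (p + q) = F p + F q"
  and lin_scale: "lin F \<Longrightarrow> F (fv_scale r p) = fv_scale r (F p)"
  and lin_0: "lin F \<Longrightarrow> F 0 = 0"
  and lin_diff: "lin F \<Longrightarrow> F (p - q) = F p - F q"
  and lin_minus: "lin F \<Longrightarrow> F (- p) = - F p"
  and lin_sum: "lin F \<Longrightarrow> F (sum h A) = (\<Sum>x\<in>A. F (h x))"
proof -
  assume "lin F"
  then interpret F: Vector_Spaces.linear fv_scale fv_scale F .
  show "F (p + q) = F p + F q" "F (fv_scale r p) = fv_scale r (F p)" "F 0 = 0"
    "F (p - q) = F p - F q" "F (- p) = - F p" "F (sum h A) = (\<Sum>x\<in>A. F (h x))"
    by (simp_all add: F.add F.scale F.diff F.neg F.sum)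
qed

lemma lin_eqI:
  assumes "lin F" "lin G" "\<And>b. F (basis_vec b) = G (basis_vec b)"
  shows "F p = G p"
  using lin_ext_eqI[of F G] assms by metis

lemma lin_comp: "lin F \<Longrightarrow> lin G \<Longrightarrow> lin (\<lambda>p. F (G p))"
  by (rule linI) (simp_all add: lin_add lin_scale)

lemma lin_plus: "lin F \<Longrightarrow> lin G \<Longrightarrow> lin (\<lambda>p. F p + G p)"
  and lin_sub: "lin F \<Longrightarrow> lin G \<Longrightarrow> lin (\<lambda>p. F p - G p)"
  and lin_scaled: "lin F \<Longrightarrow> lin (\<lambda>p. fv_scale r (F p))"
  and lin_id: "lin (\<lambda>p. p)"
  and lin_zero: "lin (\<lambda>p. 0)"
  by (auto intro!: linI simp: lin_add lin_scale algebra_simps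
      fv.scale_right_distrib fv.scale_right_diff_distrib)

lemma lin_lin_sum: "(\<And>x. x \<in> A \<Longrightarrow> lin (F x)) \<Longrightarrow> lin (\<lambda>p. \<Sum>x\<in>A. F x p)"
  by (auto intro!: linI simp: lin_add lin_scale sum.distrib fv.scale_sum_right)

lemma fv_scale_conv_mult:
  fixes p :: "'b::monoid_add \<Rightarrow>\<^sub>0 'k::field"
  shows "fv_scale r p = Poly_Mapping.single 0 r * p"
  by (simp add: fv_scale_def mult_map_scale_conv_mult)

lemma basis_vec_mult:
  fixes u w :: "'b::monoid_add"
  shows "basis_vec u * basis_vec w = (basis_vec (u + w) :: 'b \<Rightarrow>\<^sub>0 'k::field)"
  by (simp add: basis_vec_def mult_single)

lemma basis_vec_append:
  "basis_vec (u @ w) = (basis_vec u * basis_vec w :: ('i, 'k::field) tensor_alg)"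
  by (simp add: basis_vec_mult plus_list_def)

lemma basis_vec_Nil: "basis_vec [] = (1 :: ('i, 'k::field) tensor_alg)"
  by (simp add: basis_vec_def flip: zero_list_def)

lemma basis_vec_Cons:
  "basis_vec (i # w) = (basis_vec [i] * basis_vec w :: ('i, 'k::field) tensor_alg)"
  using basis_vec_append[of "[i]" w] by simp

lemma mult_scale_left [simp]:
  fixes p q :: "'b::monoid_add \<Rightarrow>\<^sub>0 'k::field"
  shows "fv_scale r p * q = fv_scale r (p * q)"
  by (simp add: fv_scale_conv_mult mult.assoc)

lemma mult_scale_right [simp]:
  fixes p q :: "'b::monoid_add \<Rightarrow>\<^sub>0 'k::field"
  shows "p * fv_scale r q = fv_scale r (p * q)"
proof -
  have "p * Poly_Mapping.single 0 r = Poly_Mapping.single 0 r * p"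
    by (induction p rule: fv_induct)
      (simp_all add: algebra_simps basis_vec_def mult_single fv_scale_def mult.commute)
  then show ?thesis
    by (metis fv_scale_conv_mult mult.assoc)
qed

lemma lin_mult_left: "lin F \<Longrightarrow> lin (\<lambda>p. q * F p)"
  and lin_mult_right: "lin F \<Longrightarrow> lin (\<lambda>p. F p * q)"
  for F :: "('a \<Rightarrow>\<^sub>0 'k::field) \<Rightarrow> ('b::monoid_add \<Rightarrow>\<^sub>0 'k)"
  by (auto intro!: linI simp: lin_add lin_scale algebra_simps)

lemma lin_ext_fun_add: "lin_ext (\<lambda>b. f b + g b) q = lin_ext f q + lin_ext g q"
  and lin_ext_fun_scale: "lin_ext (\<lambda>b. fv_scale r (f b)) q = fv_scale r (lin_ext f q)"
  by (simp_all add: lin_ext_def fv.scale_right_distrib sum.distrib fv.scale_sum_right mult.commute)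

lemma tens_conv: "tens p q = lin_ext (\<lambda>b. lin_ext (\<lambda>a. basis_vec (a, b)) p) q"
proof (rule lin_eqI[where F = "\<lambda>p. tens p q"])
  show "lin (\<lambda>p. tens p q)"
    by (rule linI) simp_all
  show "lin (\<lambda>p. lin_ext (\<lambda>b. lin_ext (\<lambda>a. basis_vec (a, b)) p) q)"
    by (intro linI; unfold lin_ext_add lin_ext_scale; rule lin_ext_fun_add lin_ext_fun_scale)
qed (simp add: tens_def)

lemma tens_add_right [simp]: "tens p (q + q') = tens p q + tens p q'"
  and tens_scale_right [simp]: "tens p (fv_scale r q) = fv_scale r (tens p q)"
  by (simp_all add: tens_conv)

lemma lin_tens_left: "lin F \<Longrightarrow> lin (\<lambda>p. tens (F p) q)"
  and lin_tens_right: "lin F \<Longrightarrow> lin (\<lambda>p. tens q (F p))"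
  by (auto intro!: linI simp: lin_add lin_scale)

lemma tens_zero_left [simp]: "tens 0 q = 0"
  and tens_zero_right [simp]: "tens p 0 = 0"
  using lin_tens_left[OF lin_id, of q] lin_tens_right[OF lin_id, of p] lin_0 by blast+

lemma tens_diff_left: "tens (p - p') q = tens p q - tens p' q"
  and tens_diff_right: "tens p (q - q') = tens p q - tens p q'"
  using lin_tens_left[OF lin_id, of q] lin_tens_right[OF lin_id, of p] lin_diff by blast+

lemmas lin_intros = lin_comp[OF linear_lin_ext] linear_lin_ext lin_plus lin_sub lin_scaled lin_id
  lin_zero lin_lin_sum lin_mult_left lin_mult_right lin_tens_left lin_tens_right

lemma tmul_eq: "tmul p q = p * q"
proof (rule lin_eqI[where F = "\<lambda>p. tmul p q"])
  fix u show "tmul (basis_vec u) q = basis_vec u * q"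
    by (rule lin_eqI[where F = "\<lambda>q. tmul _ q"])
      (auto simp: tmul_def basis_vec_append intro!: lin_intros)
qed (auto simp: tmul_def intro!: lin_intros)

lemma tone_eq: "tone = 1"
  by (simp add: tone_def basis_vec_Nil)

lemma tcounit_add [simp]: "tcounit (p + q) = tcounit p + tcounit q"
  and tcounit_diff [simp]: "tcounit (p - q) = tcounit p - tcounit q"
  and tcounit_scale [simp]: "tcounit (fv_scale r p) = r * tcounit p"
  and tcounit_zero [simp]: "tcounit 0 = 0"
  by (simp_all add: tcounit_def lookup_add lookup_minus)

lemma tcounit_one [simp]: "tcounit (1 :: ('i, 'k::field) tensor_alg) = 1"
  by (simp add: tcounit_def flip: basis_vec_Nil) (simp add: basis_vec_def)

lemma tcounit_basis: "tcounit (basis_vec w) = (if w = [] then 1 else 0)"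
  by (auto simp: tcounit_def basis_vec_def lookup_single when_def)

lemma tcounit_mult [simp]: "tcounit (p * q) = tcounit p * tcounit q"
proof (induction p rule: fv_induct)
  case (basis r u)
  show ?case
    by (induction q rule: fv_induct)
      (auto simp: algebra_simps tcounit_basis simp flip: basis_vec_append)
qed (simp_all add: algebra_simps)

lemma lookup_basis_vec: "lookup (basis_vec b) x = (if b = x then 1 else (0 :: 'k::field))"
  by (simp add: basis_vec_def lookup_single when_def)

lemma keys_basis_vec [simp]: "keys (basis_vec b :: 'b \<Rightarrow>\<^sub>0 'k::field) = {b}"
  by (simp add: basis_vec_def)

lemma keys_lin_ext: "u \<in> keys (lin_ext f p) \<Longrightarrow> \<exists>w\<in>keys p. u \<in> keys (f w)"
  unfolding lin_ext_def in_keys_iff lookup_sum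
  by (auto elim!: sum.not_neutral_contains_not_neutral)

lemma keys_tensor_mult:
  "u \<in> keys (p * q :: ('i, 'k::field) tensor_alg) \<Longrightarrow>
    \<exists>v\<in>keys p. \<exists>w\<in>keys q. u = v @ w"
  using keys_mult[of p q] unfolding plus_list_def by blast

lemma tensor_induct [case_names one letter scale zero add]:
  assumes "P 1" "\<And>x p. P p \<Longrightarrow> P (basis_vec [x] * p)" "\<And>r p. P p \<Longrightarrow> P (fv_scale r p)" "P 0"
    "\<And>p q. P p \<Longrightarrow> P q \<Longrightarrow> P (p + q)"
  shows "P (p :: ('i, 'k::field) tensor_alg)"
proof (induction p rule: fv_induct)
  case (basis r b)
  have "P (basis_vec b)"
  proof (induction b)
    case (Cons x w)
    then show ?case
      using assms(2) by (metis basis_vec_Cons)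
  qed (simp add: basis_vec_Nil assms(1))
  then show ?case
    using assms(3) by blast
qed (use assms in auto)

text \<open>Restricting the base case to letters in the support of v makes a hypothesis on
  \<open>keys v\<close>, such as a common degree of all its letters, available in the
  induction.\<close>

lemma vemb_mult_induct:
  assumes "\<And>l. l \<in> keys v \<Longrightarrow> P (basis_vec l)" "\<And>r v. P v \<Longrightarrow> P (fv_scale r v)" "P 0"
    "\<And>v w. P v \<Longrightarrow> P w \<Longrightarrow> P (v + w)"
  shows "P (v :: 'i \<Rightarrow>\<^sub>0 'k::field)"
proof -
  have "v = lin_ext basis_vec v"
    by (rule lin_eqI[where F = "\<lambda>v. v"]) (auto intro!: lin_intros)
  also have "\<dots> = (\<Sum>l\<in>keys v. fv_scale (lookup v l) (basis_vec l))"
    by (simp add: lin_ext_def)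
  finally have v: "v = \<dots>" .
  have "P (\<Sum>l\<in>A. fv_scale (lookup v l) (basis_vec l))" if "finite A" "A \<subseteq> keys v" for A
    using that by (induction A) (auto intro: assms)
  then show ?thesis
    by (subst v) simp
qed

section \<open>Bases of quotients\<close>

text \<open>Coefficients are indexed by A and not by vectors, so distinctness of the
  \<open>v x\<close> follows instead of being a separate condition.\<close>

definition indep_mod :: "('b \<Rightarrow>\<^sub>0 'k::field) set \<Rightarrow> ('a \<Rightarrow> ('b \<Rightarrow>\<^sub>0 'k)) \<Rightarrow> 'a set \<Rightarrow> bool"
  where "indep_mod U v A \<longleftrightarrow> (\<forall>c. (\<Sum>x\<in>A. fv_scale (c x) (v x)) \<in> U \<longrightarrow> (\<forall>x\<in>A. c x = 0))"

lemma indep_mod_0_inj_on: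
  assumes "finite A" "indep_mod {0} v A"
  shows "inj_on v A"
proof (rule inj_onI, rule ccontr)
  fix x y assume x: "x \<in> A" "y \<in> A" "v x = v y" "x \<noteq> y"
  let ?c = "\<lambda>z. if z = x then 1 else if z = y then -1 else 0"
  have "(\<Sum>z\<in>A. fv_scale (?c z) (v z)) = (\<Sum>z\<in>{x, y}. fv_scale (?c z) (v z))"
    by (rule sum.mono_neutral_right) (use assms x in auto)
  also have "\<dots> = 0"
    using x by simp
  finally have "(\<Sum>z\<in>A. fv_scale (?c z) (v z)) \<in> {0}"
    by simp
  with assms(2)[unfolded indep_mod_def, rule_format, OF _ x(1), of ?c] show False
    by simp
qed

lemma indep_mod_0_independent:
  assumes "finite A" "indep_mod {0} v A"
  shows "fv.independent (v ` A)"
proof (rule fv.independent_if_scalars_zero)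
  fix f y assume f: "(\<Sum>y\<in>v ` A. fv_scale (f y) y) = 0" and "y \<in> v ` A"
  then obtain x where x: "x \<in> A" "y = v x" by auto
  have "(\<Sum>x\<in>A. fv_scale (f (v x)) (v x)) = 0"
    using f indep_mod_0_inj_on[OF assms] by (simp add: sum.reindex)
  then show "f y = 0"
    using assms(2) x unfolding indep_mod_def by (metis singletonI)
qed (use assms in auto)

text \<open>Replacing each \<open>v x\<close> by a representative in the span of B preserves
  independence modulo U and turns it into independence inside a space spanned by
  \<open>card B\<close> vectors.\<close>

lemma indep_mod_card_le:
  assumes U: "fv.subspace U" and B: "quotient_basis U B" "finite B"
    and A: "finite A" "indep_mod U v A"
  shows "card A \<le> card B"
proof -
  have "\<forall>p. \<exists>b\<in>fv.span B. p - b \<in> U"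
    using B by (auto simp: quotient_basis_def)
  then obtain s where s: "\<And>p. s p \<in> fv.span B" "\<And>p. p - s p \<in> U"
    by metis
  have *: "indep_mod {0} (\<lambda>x. s (v x)) A"
    unfolding indep_mod_def
  proof (intro allI impI)
    fix c assume "(\<Sum>x\<in>A. fv_scale (c x) (s (v x))) \<in> {0}"
    moreover have "(\<Sum>x\<in>A. fv_scale (c x) (v x - s (v x))) \<in> U"
      by (intro fv.subspace_sum fv.subspace_scale U s)
    ultimately have "(\<Sum>x\<in>A. fv_scale (c x) (v x)) \<in> U"
      by (simp add: fv.scale_right_diff_distrib sum_subtractf)
    then show "\<forall>x\<in>A. c x = 0"
      using A by (simp add: indep_mod_def)
  qed
  have "card A = card ((\<lambda>x. s (v x)) ` A)"
    using indep_mod_0_inj_on[OF A(1) *] by (simp add: card_image)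
  also have "\<dots> \<le> card B"
    using fv.independent_span_bound[OF B(2) indep_mod_0_independent[OF A(1) *]] s by blast
  finally show ?thesis .
qed

lemma quotient_basis_indep_mod:
  assumes "quotient_basis U B" "finite B"
  shows "indep_mod U (\<lambda>b. b) B"
  unfolding indep_mod_def
proof (intro allI impI)
  fix c assume c: "(\<Sum>b\<in>B. fv_scale (c b) b) \<in> U"
  have "(\<Sum>b\<in>B. fv_scale (c b) b) \<in> fv.span B"
    by (intro fv.span_sum fv.span_scale fv.span_base)
  then have "(\<Sum>b\<in>B. fv_scale (c b) b) = 0"
    using c assms unfolding quotient_basis_def by blast
  then show "\<forall>b\<in>B. c b = 0"
    using assms fv.independentD[of B B c] unfolding quotient_basis_def by blast
qed

text \<open>\<open>quotient_dim\<close> takes the cardinality of an unspecified finite basis;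
  \<open>indep_mod_card_le\<close>, used in both directions, compares it with the given
  family.\<close>

lemma quotient_dim_eqI:
  fixes U :: "('b \<Rightarrow>\<^sub>0 'k::field) set"
  assumes U: "fv.subspace U" and A: "finite A" "indep_mod U v A"
    and span: "\<And>p. \<exists>b\<in>fv.span (v ` A). p - b \<in> U"
  shows "quotient_dim U = enat (card A)"
proof -
  have "(0 :: 'b \<Rightarrow>\<^sub>0 'k) \<in> U"
    by (rule fv.subspace_0[OF U])
  then have A0: "indep_mod {0} v A"
    using A by (auto simp: indep_mod_def)
  have "x \<in> {0}" if "x \<in> fv.span (v ` A)" "x \<in> U" for x
  proof -
    from that(1) obtain f where f: "x = (\<Sum>y\<in>v ` A. fv_scale (f y) y)"
      using A(1) by (auto simp: fv.span_finite)
    also have "\<dots> = (\<Sum>a\<in>A. fv_scale (f (v a)) (v a))"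
      using indep_mod_0_inj_on[OF A(1) A0] by (simp add: sum.reindex)
    finally have x: "x = (\<Sum>a\<in>A. fv_scale (f (v a)) (v a))" .
    then have "\<forall>a\<in>A. f (v a) = 0"
      using A(2)[unfolded indep_mod_def, rule_format, of "\<lambda>a. f (v a)"] that(2) by auto
    then show ?thesis
      using x by simp
  qed
  then have qb: "quotient_basis U (v ` A)"
    using span indep_mod_0_independent[OF A(1) A0] fv.span_zero fv.subspace_0[OF U]
    unfolding quotient_basis_def by blast
  let ?B = "SOME B. finite B \<and> quotient_basis U B"
  have ex: "\<exists>B. finite B \<and> quotient_basis U B"
    using qb A(1) by blast
  then have B: "finite ?B" "quotient_basis U ?B"
    using someI_ex[OF ex] by auto
  have "card A = card (v ` A)"
    using indep_mod_0_inj_on[OF A(1) A0] by (simp add: card_image)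
  then have "card ?B \<le> card A"
    using indep_mod_card_le[OF U qb _ B(1) quotient_basis_indep_mod[OF B(2,1)]] A(1) by simp
  moreover have "card A \<le> card ?B"
    using indep_mod_card_le[OF U B(2,1) A] .
  ultimately show ?thesis
    using ex by (simp add: quotient_dim_def)
qed

lemma quotient_dim_infinite:
  assumes U: "fv.subspace U" and v: "\<And>n. indep_mod U v {..<n::nat}"
  shows "quotient_dim U = \<infinity>"
proof -
  have False if "finite B" "quotient_basis U B" for B
    using indep_mod_card_le[OF U that(2,1) _ v[of "Suc (card B)"]] by simp
  then show ?thesis
    by (auto simp: quotient_dim_def)
qed

section \<open>Braidings of group type\<close>

definition vemb :: "('i \<Rightarrow>\<^sub>0 'k::field) \<Rightarrow> ('i, 'k) tensor_alg"
  where "vemb = lin_ext (\<lambda>i. basis_vec [i])"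

lemma lin_vemb: "lin vemb"
  by (simp add: vemb_def linear_lin_ext)

lemma vemb_basis [simp]: "vemb (basis_vec i) = basis_vec [i]"
  by (simp add: vemb_def)

lemmas vemb_lin [simp] = lin_add[OF lin_vemb] lin_scale[OF lin_vemb] lin_0[OF lin_vemb]

lemma tcounit_vemb [simp]: "tcounit (vemb v) = 0"
  by (induction v rule: fv_induct) (simp_all add: lin_add[OF lin_vemb] lin_scale[OF lin_vemb]
      lin_0[OF lin_vemb] tcounit_basis)

text \<open>\<open>g i j\<close> is the image of the basis vector \<open>x\<^sub>j\<close> under the group element acting by the degree of \<open>x\<^sub>i\<close>.\<close>

locale group_braiding =
  fixes g g' :: "'i \<Rightarrow> 'i \<Rightarrow> ('i \<Rightarrow>\<^sub>0 'k::field)"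
  assumes g_comm: "lin_ext (g i) (g j l) = lin_ext (g j) (g i l)"
    and g_g': "lin_ext (g i) (g' i j) = basis_vec j"
    and g'_g: "lin_ext (g' i) (g i j) = basis_vec j"
    and g_degree: "l \<in> keys (g i j) \<Longrightarrow> g l = g j"
    and g'_degree: "l \<in> keys (g' i j) \<Longrightarrow> g l = g j"
    and finite_occ: "finite {l. i \<in> keys (g j l)}"
    and finite_occ': "finite {l. i \<in> keys (g' j l)}"
begin

fun aut_word :: "'i \<Rightarrow> 'i list \<Rightarrow> ('i, 'k) tensor_alg"
  where
    "aut_word i [] = 1"
  | "aut_word i (j # w) = vemb (g i j) * aut_word i w"

fun aut_word' :: "'i \<Rightarrow> 'i list \<Rightarrow> ('i, 'k) tensor_alg"
  where
    "aut_word' i [] = 1"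
  | "aut_word' i (j # w) = vemb (g' i j) * aut_word' i w"

definition aut :: "'i \<Rightarrow> ('i, 'k) tensor_alg \<Rightarrow> ('i, 'k) tensor_alg"
  where "aut i = lin_ext (aut_word i)"

definition aut' :: "'i \<Rightarrow> ('i, 'k) tensor_alg \<Rightarrow> ('i, 'k) tensor_alg"
  where "aut' i = lin_ext (aut_word' i)"

text \<open>This is the coefficient of the letter i in the right factor of the coproduct (see
  \<open>slice_letter_tcomul\<close>). A leading i reaches that factor by crossing w, which applies
  \<open>aut_word i\<close>.\<close>

fun der_word :: "'i \<Rightarrow> 'i list \<Rightarrow> ('i, 'k) tensor_alg"
  where
    "der_word i [] = 0"
  | "der_word i (j # w) = basis_vec [j] * der_word i w + (if i = j then aut_word i w else 0)"

definition der :: "'i \<Rightarrow> ('i, 'k) tensor_alg \<Rightarrow> ('i, 'k) tensor_alg"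
  where "der i = lin_ext (der_word i)"

lemma lin_aut: "lin F \<Longrightarrow> lin (\<lambda>p. aut i (F p))"
  and lin_aut': "lin F \<Longrightarrow> lin (\<lambda>p. aut' i (F p))"
  and lin_der: "lin F \<Longrightarrow> lin (\<lambda>p. der i (F p))"
  by (auto simp: aut_def aut'_def der_def intro!: lin_intros)

lemma lin_aut0: "lin (aut i)" and lin_aut'0: "lin (aut' i)" and lin_der0: "lin (der i)"
  by (simp_all add: aut_def aut'_def der_def linear_lin_ext)

lemmas aut_lin [simp] = lin_add[OF lin_aut0] lin_scale[OF lin_aut0] lin_0[OF lin_aut0]
  lin_diff[OF lin_aut0] lin_minus[OF lin_aut0] lin_sum[OF lin_aut0]
lemmas aut'_lin [simp] = lin_add[OF lin_aut'0] lin_scale[OF lin_aut'0] lin_0[OF lin_aut'0]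
  lin_diff[OF lin_aut'0] lin_minus[OF lin_aut'0] lin_sum[OF lin_aut'0]
lemmas der_lin [simp] = lin_add[OF lin_der0] lin_scale[OF lin_der0] lin_0[OF lin_der0]
  lin_diff[OF lin_der0] lin_minus[OF lin_der0] lin_sum[OF lin_der0]

lemma aut_one [simp]: "aut i 1 = 1" and aut'_one [simp]: "aut' i 1 = 1" and der_one [simp]: "der i 1 = 0"
  by (simp_all add: aut_def aut'_def der_def flip: basis_vec_Nil)

lemma aut_basis: "aut i (basis_vec w) = aut_word i w"
  and aut'_basis: "aut' i (basis_vec w) = aut_word' i w"
  and der_basis: "der i (basis_vec w) = der_word i w"
  by (simp_all add: aut_def aut'_def der_def)

lemma aut_letter: "aut i (basis_vec [j]) = vemb (g i j)"
  and aut'_letter: "aut' i (basis_vec [j]) = vemb (g' i j)"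
  and der_letter: "der i (basis_vec [j]) = (if i = j then 1 else 0)"
  by (simp_all add: aut_basis aut'_basis der_basis)

lemma aut_word_append: "aut_word i (u @ w) = aut_word i u * aut_word i w"
  and aut'_word_append: "aut_word' i (u @ w) = aut_word' i u * aut_word' i w"
  by (induction u) (simp_all add: mult.assoc)

lemma aut_mult [simp]: "aut i (p * q) = aut i p * aut i q"
proof (rule lin_eqI[where F = "\<lambda>p. aut i (p * q)"])
  fix u show "aut i (basis_vec u * q) = aut i (basis_vec u) * aut i q"
    by (rule lin_eqI[where F = "\<lambda>q. aut i (_ * q)"])
      (auto simp: aut_basis aut_word_append simp flip: basis_vec_append intro!: lin_intros lin_aut lin_aut0)
qed (auto intro!: lin_intros lin_aut lin_aut0)

lemma aut'_mult [simp]: "aut' i (p * q) = aut' i p * aut' i q"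
proof (rule lin_eqI[where F = "\<lambda>p. aut' i (p * q)"])
  fix u show "aut' i (basis_vec u * q) = aut' i (basis_vec u) * aut' i q"
    by (rule lin_eqI[where F = "\<lambda>q. aut' i (_ * q)"])
      (auto simp: aut'_basis aut'_word_append simp flip: basis_vec_append intro!: lin_intros lin_aut' lin_aut'0)
qed (auto intro!: lin_intros lin_aut' lin_aut'0)

lemma der_letter_mult: "der i (basis_vec [j] * q) = basis_vec [j] * der i q + (if i = j then aut i q else 0)"
proof (rule lin_eqI[where F = "\<lambda>q. der i (_ * q)"])
  show "lin (\<lambda>p. basis_vec [j] * der i p + (if i = j then aut i p else 0))"
    by (cases "i = j") (auto intro!: lin_intros lin_der lin_der0 lin_aut0)
qed (auto simp: der_basis aut_basis simp flip: basis_vec_append intro!: lin_intros lin_der)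

lemma der_mult [simp]: "der i (p * q) = p * der i q + der i p * aut i q"
proof (rule lin_eqI[where F = "\<lambda>p. der i (p * q)"])
  fix u show "der i (basis_vec u * q) = basis_vec u * der i q + der i (basis_vec u) * aut i q"
  proof (induction u)
    case (Cons j u)
    have "der i (basis_vec (j # u) * q) = der i (basis_vec [j] * (basis_vec u * q))"
      by (subst basis_vec_Cons) (simp add: mult.assoc)
    also have "\<dots> = basis_vec [j] * der i (basis_vec u * q) + (if i = j then aut i (basis_vec u * q) else 0)"
      by (rule der_letter_mult)
    also have "\<dots> = basis_vec (j # u) * der i q + der i (basis_vec (j # u)) * aut i q"
      unfolding Cons by (subst (1 2) basis_vec_Cons[of j u]) (simp add: der_letter_mult algebra_simps)
    finally show ?case .
  qed (simp add: basis_vec_Nil)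
qed (auto intro!: lin_intros lin_der lin_der0)

lemma alg_hom_eqI:
  fixes F G :: "('j, 'k) tensor_alg \<Rightarrow> ('l, 'k) tensor_alg"
  assumes "lin F" "lin G" "F 1 = G 1"
    and "\<And>p q. F (p * q) = F p * F q" "\<And>p q. G (p * q) = G p * G q"
    and "\<And>j. F (basis_vec [j]) = G (basis_vec [j])"
  shows "F p = G p"
proof (rule lin_eqI[OF assms(1,2)])
  fix w show "F (basis_vec w) = G (basis_vec w)"
  proof (induction w)
    case (Cons j w)
    then show ?case
      by (subst (1 2) basis_vec_Cons) (simp only: assms)
  qed (simp add: basis_vec_Nil assms)
qed

lemma aut_vemb: "aut i (vemb v) = vemb (lin_ext (g i) v)"
  by (rule lin_eqI[where F = "\<lambda>v. aut i (vemb v)"])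
    (auto intro!: lin_aut lin_vemb lin_intros simp: vemb_def aut_letter)

lemma aut'_vemb: "aut' i (vemb v) = vemb (lin_ext (g' i) v)"
  by (rule lin_eqI[where F = "\<lambda>v. aut' i (vemb v)"])
    (auto intro!: lin_aut' lin_vemb lin_intros simp: vemb_def aut'_letter)

lemma aut_commute: "aut i (aut j p) = aut j (aut i p)"
  by (rule alg_hom_eqI) (auto intro!: lin_aut lin_aut0 simp: aut_letter aut_vemb g_comm)

lemma aut_aut' [simp]: "aut i (aut' i p) = p"
  by (rule alg_hom_eqI[where F = "\<lambda>p. aut i (aut' i p)" and G = "\<lambda>p. p"];
      (auto intro!: lin_aut lin_aut'0 lin_id simp: aut'_letter aut_vemb g_g'; simp add: vemb_def)?)

lemma aut'_aut [simp]: "aut' i (aut i p) = p"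
  by (rule alg_hom_eqI[where F = "\<lambda>p. aut' i (aut i p)" and G = "\<lambda>p. p"];
      (auto intro!: lin_aut' lin_aut0 lin_id simp: aut_letter aut'_vemb g'_g; simp add: vemb_def)?)

subsection \<open>The degree of a word\<close>

text \<open>The multiset of the operators \<open>g i\<close> determines the length of a word and the automorphism by which it braids.\<close>

definition deg :: "'i list \<Rightarrow> ('i \<Rightarrow> ('i \<Rightarrow>\<^sub>0 'k)) multiset"
  where "deg w = image_mset g (mset w)"

lemma deg_simps [simp]: "deg [] = {#}" "deg (i # w) = add_mset (g i) (deg w)" "deg (u @ w) = deg u + deg w"
  by (simp_all add: deg_def)

lemma deg_eq_length: "deg u = deg w \<Longrightarrow> length u = length w"
  by (metis deg_def size_image_mset size_mset)

lemma keys_aut_word: "u \<in> keys (aut_word i w) \<Longrightarrow> deg u = deg w"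
proof (induction w arbitrary: u)
  case (Cons j w)
  then obtain u1 u2 where u: "u = u1 @ u2" "u1 \<in> keys (vemb (g i j))"
    "u2 \<in> keys (aut_word i w)"
    by (auto dest: keys_tensor_mult)
  then obtain l where l: "l \<in> keys (g i j)" "u1 = [l]"
    by (auto simp: vemb_def dest!: keys_lin_ext)
  with u Cons.IH show ?case
    using g_degree[OF l(1)] by simp
qed (auto simp: basis_vec_Nil[symmetric])

lemma keys_der_word: "u \<in> keys (der_word i w) \<Longrightarrow> deg w = add_mset (g i) (deg u)"
proof (induction w arbitrary: u)
  case (Cons j w)
  consider "u \<in> keys (basis_vec [j] * der_word i w)"
    | "i = j" "u \<in> keys (aut_word i w)"
    using Cons.prems keys_add by (fastforce split: if_splits)
  then show ?case
  proof cases
    case 1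
    then obtain v where "u = j # v" "v \<in> keys (der_word i w)"
      by (auto dest: keys_tensor_mult)
    then show ?thesis
      using Cons.IH by (simp add: add_mset_commute)
  qed (simp add: keys_aut_word)
qed simp

subsection \<open>The radical of the pairing with iterated derivations\<close>

fun pr :: "'i list \<Rightarrow> ('i, 'k) tensor_alg \<Rightarrow> 'k"
  where
    "pr [] p = tcounit p"
  | "pr (i # w) p = pr w (der i p)"

definition nich :: "('i, 'k) tensor_alg set"
  where "nich = {p. \<forall>w. pr w p = 0}"

lemma pr_add [simp]: "pr w (p + q) = pr w p + pr w q"
  and pr_diff [simp]: "pr w (p - q) = pr w p - pr w q"
  and pr_scale [simp]: "pr w (fv_scale r p) = r * pr w p"
  and pr_0 [simp]: "pr w 0 = 0"
  by (induction w arbitrary: p q) simp_all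

text \<open>Each derivation removes one letter of its own degree (\<open>keys_der_word\<close>), so
  the pairing is graded by \<open>deg\<close>. This makes the radical stable under degree
  projections (\<open>nich_component\<close>).\<close>

lemma pr_basis_degree: "pr v (basis_vec w) \<noteq> 0 \<Longrightarrow> deg v = deg w"
proof (induction v arbitrary: w)
  case (Cons i v)
  have "pr v (lin_ext basis_vec p) \<noteq> 0 \<Longrightarrow> \<exists>u\<in>keys p. pr v (basis_vec u) \<noteq> 0" for p
  proof -
    have "pr v (sum h A) = (\<Sum>x\<in>A. pr v (h x))" for h :: "'i list \<Rightarrow> _" and A
      by (induction A rule: infinite_finite_induct) simp_all
    then show "pr v (lin_ext basis_vec p) \<noteq> 0 \<Longrightarrow> \<exists>u\<in>keys p. pr v (basis_vec u) \<noteq> 0"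
      unfolding lin_ext_def by (auto elim!: sum.not_neutral_contains_not_neutral)
  qed
  moreover have "lin_ext basis_vec p = p" for p :: "('i, 'k) tensor_alg"
    by (rule lin_eqI[where F = "lin_ext basis_vec" and G = "\<lambda>p. p"]) (auto intro!: lin_intros)
  ultimately obtain u where u: "u \<in> keys (der_word i w)" "pr v (basis_vec u) \<noteq> 0"
    using Cons.prems by (auto simp: der_basis)
  with Cons.IH[of u] keys_der_word[OF u(1)] show ?case
    by simp
qed (simp add: tcounit_basis split: if_splits)

lemma subspace_nich: "fv.subspace nich"
  by (auto simp: nich_def fv.subspace_def)

lemma nich_0 [simp]: "0 \<in> nich"
  and nich_add: "p \<in> nich \<Longrightarrow> q \<in> nich \<Longrightarrow> p + q \<in> nich"
  and nich_diff: "p \<in> nich \<Longrightarrow> q \<in> nich \<Longrightarrow> p - q \<in> nich"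
  and nich_scale: "p \<in> nich \<Longrightarrow> fv_scale r p \<in> nich"
  by (auto simp: nich_def)

lemma nich_sum: "(\<And>x. x \<in> A \<Longrightarrow> h x \<in> nich) \<Longrightarrow> sum h A \<in> nich"
  by (rule fv.subspace_sum[OF subspace_nich])

lemma nich_minus: "p \<in> nich \<Longrightarrow> - p \<in> nich"
  using nich_diff[of 0 p] by simp

lemma nichD: "p \<in> nich \<Longrightarrow> pr w p = 0"
  by (simp add: nich_def)

lemma nich_tcounit: "p \<in> nich \<Longrightarrow> tcounit p = 0"
  using nichD[of p "[]"] by simp

lemma nich_der: "p \<in> nich \<Longrightarrow> der i p \<in> nich"
proof -
  assume "p \<in> nich"
  then have "pr w (der i p) = 0" for w
    using nichD[of p "i # w"] by simp
  then show "der i p \<in> nich"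
    by (simp add: nich_def)
qed

lemma nichI: "tcounit p = 0 \<Longrightarrow> (\<And>i. der i p \<in> nich) \<Longrightarrow> p \<in> nich"
proof -
  assume *: "tcounit p = 0" "\<And>i. der i p \<in> nich"
  have "pr w p = 0" for w
    using * by (cases w) (auto simp: nich_def)
  then show "p \<in> nich"
    by (simp add: nich_def)
qed

text \<open>\<open>nich\<close> is the largest subspace of the kernel of the counit that is closed
  under all derivations, and the span of \<open>J \<union> nich\<close> is another such
  subspace.\<close>

lemma nich_coinduct:
  assumes "p \<in> J" "\<And>p. p \<in> J \<Longrightarrow> tcounit p = 0" "\<And>p i. p \<in> J \<Longrightarrow> der i p \<in> fv.span (J \<union> nich)"
  shows "p \<in> nich"
proof -
  have *: "x \<in> fv.span (J \<union> nich) \<Longrightarrow> tcounit x = 0" for x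
    by (induction rule: fv.span_induct_alt) (auto simp: assms nich_tcounit)
  have **: "x \<in> fv.span (J \<union> nich) \<Longrightarrow> der i x \<in> fv.span (J \<union> nich)" for x i
  proof (induction rule: fv.span_induct_alt)
    case (step c x y)
    have "der i x \<in> fv.span (J \<union> nich)"
      using step(1) assms(3) nich_der[of x i] fv.span_base by blast
    then show ?case
      using step by (simp add: fv.span_add fv.span_scale)
  qed (simp add: fv.span_zero)
  have "x \<in> fv.span (J \<union> nich) \<Longrightarrow> pr w x = 0" for w x
  proof (induction w arbitrary: x)
    case (Cons i w)
    then show ?case
      using ** by simp
  qed (simp add: *)
  moreover have "p \<in> fv.span (J \<union> nich)"
    using assms(1) by (simp add: fv.span_base)
  ultimately show ?thesis
    by (simp add: nich_def)
qed

lemma aut_cong: "g i = g j \<Longrightarrow> aut i = aut j"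
proof -
  assume *: "g i = g j"
  have "aut_word i w = aut_word j w" for w
    by (induction w) (simp_all add: *)
  then have "aut_word i = aut_word j"
    by (rule ext)
  then show ?thesis
    by (simp add: aut_def)
qed

lemma tcounit_aut [simp]: "tcounit (aut i p) = tcounit p"
proof (induction p rule: fv_induct)
  case (basis r w)
  show ?case
    by (cases w) (simp_all add: aut_basis tcounit_basis)
qed simp_all

text \<open>Chain rule: a letter l contributes with the coefficient of i in \<open>h l\<close>. The
  twists match because such an l has the degree of i, whence \<open>aut i = aut l\<close>.\<close>

lemma der_hom:
  assumes lin: "lin F" and one: "F 1 = 1" and mult: "\<And>p q. F (p * q) = F p * F q"
    and letter: "\<And>l. F (basis_vec [l]) = vemb (h l)" and comm: "\<And>i p. aut i (F p) = F (aut i p)"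
    and degree: "\<And>i l. i \<in> keys (h l) \<Longrightarrow> g i = g l"
    and fin: "\<And>i. finite {l. i \<in> keys (h l)}"
  shows "der i (F p) = (\<Sum>l | i \<in> keys (h l). fv_scale (lookup (h l) i) (F (der l p)))"
    (is "_ = ?R p")
proof (rule lin_eqI[where F = "\<lambda>p. der i (F p)"])
  have *: "der i (vemb v) = fv_scale (lookup v i) 1" for v
    by (rule lin_eqI[where F = "\<lambda>v. der i (vemb v)"])
      (auto intro!: lin_der lin_vemb linI simp: lookup_basis_vec der_letter lookup_add
        fv.scale_left_distrib simp flip: fv.scale_scale)
  fix w show "der i (F (basis_vec w)) = ?R (basis_vec w)"
  proof (induction w)
    case (Cons m w)
    let ?K = "{l. i \<in> keys (h l)}"
    let ?c = "\<lambda>l. lookup (h l) i"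
    have "der i (F (basis_vec (m # w))) =
        vemb (h m) * ?R (basis_vec w) + fv_scale (?c m) (aut i (F (basis_vec w)))"
      unfolding basis_vec_Cons[of m w] by (simp add: mult letter * Cons)
    also have "fv_scale (?c m) (aut i (F (basis_vec w))) = fv_scale (?c m) (F (aut m (basis_vec w)))"
    proof (cases "?c m = 0")
      case False
      then have "g i = g m"
        using degree by (simp add: in_keys_iff)
      then show ?thesis
        by (simp add: aut_cong[of i m] comm)
    qed simp
    also have "\<dots> = (\<Sum>l\<in>?K. if l = m then fv_scale (?c m) (F (aut m (basis_vec w))) else 0)"
      using fin[of i] by (auto simp: sum.delta' in_keys_iff)
    also have "vemb (h m) * ?R (basis_vec w) + \<dots> = ?R (basis_vec (m # w))"
      unfolding sum_distrib_left sum.distrib[symmetric] basis_vec_Cons[of m w]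
      by (rule sum.cong[OF refl])
        (auto simp: mult letter der_letter fv.scale_right_distrib lin_add[OF lin] lin_0[OF lin] one)
    finally show ?case .
  qed (simp add: basis_vec_Nil one lin_0[OF lin])
qed (auto intro!: lin_intros lin_der lin lin_comp[OF lin] lin_der0)

text \<open>Stated for a general degree-preserving F in order to cover both \<open>aut\<close> and
  its inverse \<open>aut'\<close>; by the chain rule the derivatives of \<open>F p\<close> stay in
  the span of the image of \<open>nich\<close>.\<close>

lemma nich_hom:
  assumes "lin F" "F 1 = 1" "\<And>p q. F (p * q) = F p * F q"
    and letter: "\<And>l. F (basis_vec [l]) = vemb (h l)" and "\<And>i p. aut i (F p) = F (aut i p)"
    and "\<And>i l. i \<in> keys (h l) \<Longrightarrow> g i = g l"
    and "\<And>i. finite {l. i \<in> keys (h l)}"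
    and "p \<in> nich"
  shows "F p \<in> nich"
proof (rule nich_coinduct[where J = "F ` nich"])
  fix p i assume "p \<in> F ` nich"
  then obtain q where q: "p = F q" "q \<in> nich"
    by auto
  have "F (der l q) \<in> fv.span (F ` nich \<union> nich)" for l
    using nich_der[OF q(2)] by (intro fv.span_base) auto
  then show "der i p \<in> fv.span (F ` nich \<union> nich)"
    unfolding q(1) by (subst der_hom[OF assms(1-7)]) (assumption | intro fv.span_sum fv.span_scale)+
next
  have "tcounit (F q) = tcounit q" for q
  proof (induction q rule: fv_induct)
    case (basis r w)
    have "tcounit (F (basis_vec w)) = tcounit (basis_vec w)"
    proof (cases w)
      case (Cons j v)
      show ?thesis
        unfolding Cons basis_vec_Cons[of j v] by (simp add: assms(3) letter tcounit_basis)
    qed (simp add: basis_vec_Nil assms(2))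
    then show ?case
      by (simp add: lin_scale[OF assms(1)])
  qed (simp_all add: lin_0[OF assms(1)] lin_add[OF assms(1)])
  then show "tcounit p = 0" if "p \<in> F ` nich" for p
    using that nich_tcounit by auto
qed (use assms in auto)

lemma nich_aut: "p \<in> nich \<Longrightarrow> aut j p \<in> nich"
  by (rule nich_hom[where h = "g j"])
    (simp_all add: lin_aut0 aut_letter aut_commute[of _ j] g_degree finite_occ)

lemma aut_aut'_commute: "aut i (aut' j p) = aut' j (aut i p)"
  by (metis aut_aut' aut'_aut aut_commute)

lemma nich_aut': "p \<in> nich \<Longrightarrow> aut' j p \<in> nich"
  by (rule nich_hom[where h = "g' j"])
    (simp_all add: lin_aut'0 aut'_letter aut_aut'_commute[of _ j] g'_degree finite_occ')

text \<open>Both parts are coinductions over the Leibniz rule. The rule twists the right factor, so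
  the second part relies on \<open>nich_aut\<close>.\<close>

lemma nich_mult: "p \<in> nich \<Longrightarrow> p * q \<in> nich" "p \<in> nich \<Longrightarrow> q * p \<in> nich"
proof -
  assume p: "p \<in> nich"
  show "p * q \<in> nich"
  proof (rule nich_coinduct[where J = "{p * q | p q. p \<in> nich}"])
    fix r i assume "r \<in> {p * q | p q. p \<in> nich}"
    then obtain p q where r: "r = p * q" "p \<in> nich" by auto
    show "der i r \<in> fv.span ({p * q | p q. p \<in> nich} \<union> nich)"
      unfolding r(1) der_mult using nich_der[OF r(2)] r(2)
      by (intro fv.span_add fv.span_base) blast+
    show "tcounit r = 0"
      unfolding r using r(2) by (simp add: nich_tcounit)
  qed (use p in blast)
  show "q * p \<in> nich"
  proof (rule nich_coinduct[where J = "{q * p | p q. p \<in> nich}"])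
    fix r i assume "r \<in> {q * p | p q. p \<in> nich}"
    then obtain p q where r: "r = q * p" "p \<in> nich" by auto
    show "der i r \<in> fv.span ({q * p | p q. p \<in> nich} \<union> nich)"
      unfolding r(1) der_mult using nich_der[OF r(2)] nich_aut[OF r(2)]
      by (intro fv.span_add fv.span_base) blast+
    show "tcounit r = 0"
      unfolding r using r(2) by (simp add: nich_tcounit)
  qed (use p in blast)
qed

definition component :: "('i list \<Rightarrow> bool) \<Rightarrow> ('i, 'k) tensor_alg \<Rightarrow> ('i, 'k) tensor_alg"
  where "component P = lin_ext (\<lambda>w. if P w then basis_vec w else 0)"

lemma lin_component: "lin (component P)"
  by (simp add: component_def linear_lin_ext)

lemma pr_component:
  assumes "\<And>u w. deg u = deg w \<Longrightarrow> P u = P w"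
  shows "pr w (component P p) = (if P w then pr w p else 0)"
proof (induction p rule: fv_induct)
  case (basis r u)
  then show ?case
    using assms(1)[of u w] pr_basis_degree[of w u] by (auto simp: component_def)
qed (simp_all add: component_def)

lemma lookup_component: "lookup (component P p) w = (if P w then lookup p w else 0)"
  by (induction p rule: fv_induct) (auto simp: component_def lookup_add lookup_basis_vec)

lemma nich_component:
  assumes "\<And>u w. deg u = deg w \<Longrightarrow> P u = P w" "p \<in> nich"
  shows "component P p \<in> nich"
proof -
  have "pr w (component P p) = 0" for w
  proof -
    have "pr w (component P p) = (if P w then pr w p else 0)"
      by (rule pr_component) (rule assms(1))
    then show ?thesis
      using nichD[OF assms(2)] by simp
  qed
  then show ?thesis
    by (simp add: nich_def)
qed

end

section \<open>Maps on tensor squares\<close>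

text \<open>In usual notation the next three maps are \<open>F \<otimes> G\<close>,
  \<open>id \<otimes> \<phi>\<close>, and \<open>F \<otimes> G\<close> followed by multiplication,
  the last one expressing convolution products.\<close>

definition tmap :: "(('a \<Rightarrow>\<^sub>0 'k::field) \<Rightarrow> ('c \<Rightarrow>\<^sub>0 'k)) \<Rightarrow> (('b \<Rightarrow>\<^sub>0 'k) \<Rightarrow> ('d \<Rightarrow>\<^sub>0 'k)) \<Rightarrow>
    ('a \<times> 'b \<Rightarrow>\<^sub>0 'k) \<Rightarrow> ('c \<times> 'd \<Rightarrow>\<^sub>0 'k)"
  where "tmap F G = lin_ext (\<lambda>(u, w). tens (F (basis_vec u)) (G (basis_vec w)))"

definition slice :: "(('b \<Rightarrow>\<^sub>0 'k::field) \<Rightarrow> 'k) \<Rightarrow> ('a \<times> 'b \<Rightarrow>\<^sub>0 'k) \<Rightarrow> ('a \<Rightarrow>\<^sub>0 'k)"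
  where "slice \<phi> = lin_ext (\<lambda>(u, w). fv_scale (\<phi> (basis_vec w)) (basis_vec u))"

definition mulmap :: "(('i, 'k::field) tensor_alg \<Rightarrow> ('i, 'k) tensor_alg) \<Rightarrow>
    (('i, 'k) tensor_alg \<Rightarrow> ('i, 'k) tensor_alg) \<Rightarrow> ('i list \<times> 'i list \<Rightarrow>\<^sub>0 'k) \<Rightarrow> ('i, 'k) tensor_alg"
  where "mulmap F G = lin_ext (\<lambda>(u, w). F (basis_vec u) * G (basis_vec w))"

definition functional :: "(('a \<Rightarrow>\<^sub>0 'k::field) \<Rightarrow> 'k) \<Rightarrow> bool"
  where "functional \<phi> \<longleftrightarrow> (\<forall>p q. \<phi> (p + q) = \<phi> p + \<phi> q) \<and> (\<forall>r p. \<phi> (fv_scale r p) = r * \<phi> p)"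

lemma functional_simps:
  assumes "functional \<phi>"
  shows "\<phi> (p + q) = \<phi> p + \<phi> q" "\<phi> (fv_scale r p) = r * \<phi> p" "\<phi> 0 = 0"
    "\<phi> (sum h A) = (\<Sum>x\<in>A. \<phi> (h x))"
proof -
  show *: "\<phi> (p + q) = \<phi> p + \<phi> q" "\<phi> (fv_scale r p) = r * \<phi> p" for p q r
    using assms by (auto simp: functional_def)
  show 0: "\<phi> 0 = 0"
    using *(2)[of 0 0] by simp
  show "\<phi> (sum h A) = (\<Sum>x\<in>A. \<phi> (h x))"
    by (induction A rule: infinite_finite_induct) (simp_all add: * 0)
qed

lemma lin_tmap [simp]: "lin (tmap F G)"
  by (simp add: tmap_def linear_lin_ext)

lemma lin_slice [simp]: "lin (slice \<phi>)"
  by (simp add: slice_def linear_lin_ext)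

lemma lin_mulmap [simp]: "lin (mulmap F G)"
  by (simp add: mulmap_def linear_lin_ext)

lemmas tmap_lin [simp] = lin_add[OF lin_tmap] lin_scale[OF lin_tmap] lin_0[OF lin_tmap] lin_diff[OF lin_tmap]
lemmas slice_lin [simp] = lin_add[OF lin_slice] lin_scale[OF lin_slice] lin_0[OF lin_slice] lin_diff[OF lin_slice]
lemmas mulmap_lin [simp] = lin_add[OF lin_mulmap] lin_scale[OF lin_mulmap] lin_0[OF lin_mulmap] lin_diff[OF lin_mulmap]

lemma lin_times [simp]: "lin ((*) p)" "lin (\<lambda>q. q * p)" "lin (\<lambda>q. q)" "lin (tens x)"
  for p :: "'b::monoid_add \<Rightarrow>\<^sub>0 'k::field"
  by (auto intro!: linI simp: algebra_simps)

lemma tmap_tens: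
  assumes F: "lin F" and G: "lin G"
  shows "tmap F G (tens p q) = tens (F p) (G q)"
proof (rule lin_eqI[where F = "\<lambda>p. tmap F G (tens p q)"])
  fix u show "tmap F G (tens (basis_vec u) q) = tens (F (basis_vec u)) (G q)"
    by (rule lin_eqI[where F = "\<lambda>q. tmap F G (tens _ q)"])
      (auto intro!: lin_comp[OF lin_tmap] lin_intros G simp: tmap_def)
qed (auto intro!: lin_comp[OF lin_tmap] lin_intros F)

lemma mulmap_tens:
  assumes F: "lin F" and G: "lin G"
  shows "mulmap F G (tens p q) = F p * G q"
proof (rule lin_eqI[where F = "\<lambda>p. mulmap F G (tens p q)"])
  fix u show "mulmap F G (tens (basis_vec u) q) = F (basis_vec u) * G q"
    by (rule lin_eqI[where F = "\<lambda>q. mulmap F G (tens _ q)"])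
      (auto intro!: lin_comp[OF lin_mulmap] lin_intros G simp: mulmap_def)
qed (auto intro!: lin_comp[OF lin_mulmap] lin_intros F)

lemma slice_tens:
  assumes "functional \<phi>"
  shows "slice \<phi> (tens p q) = fv_scale (\<phi> q) p"
proof (rule lin_eqI[where F = "\<lambda>p. slice \<phi> (tens p q)"])
  fix u show "slice \<phi> (tens (basis_vec u) q) = fv_scale (\<phi> q) (basis_vec u)"
    by (rule lin_eqI[where F = "\<lambda>q. slice \<phi> (tens _ q)"])
      (auto intro!: lin_comp[OF lin_slice] lin_intros linI
        simp: slice_def functional_simps[OF assms] fv.scale_left_distrib)
qed (auto intro!: lin_comp[OF lin_slice] lin_intros)

lemma lin_eq2I:
  assumes "lin F" "lin G" "\<And>p q. F (tens p q) = G (tens p q)"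
  shows "F P = G P"
  by (rule lin_eqI[OF assms(1,2)]) (metis assms(3) surj_pair tens_basis_vec)

lemma tmap_tmap:
  "lin F \<Longrightarrow> lin G \<Longrightarrow> lin F' \<Longrightarrow> lin G' \<Longrightarrow> tmap F G (tmap F' G' P) = tmap (\<lambda>p. F (F' p)) (\<lambda>q. G (G' q)) P"
  by (rule lin_eq2I[where F = "\<lambda>P. tmap F G (tmap F' G' P)"])
    (auto intro!: lin_comp[OF lin_tmap] simp: tmap_tens lin_comp)

lemma mulmap_tmap:
  "lin F \<Longrightarrow> lin G \<Longrightarrow> lin F' \<Longrightarrow> lin G' \<Longrightarrow> mulmap F G (tmap F' G' P) = mulmap (\<lambda>p. F (F' p)) (\<lambda>q. G (G' q)) P"
  by (rule lin_eq2I[where F = "\<lambda>P. mulmap F G (tmap F' G' P)"])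
    (auto intro!: lin_comp[OF lin_mulmap] simp: tmap_tens mulmap_tens lin_comp)

lemma functional_comp: "functional \<phi> \<Longrightarrow> lin G \<Longrightarrow> functional (\<lambda>q. \<phi> (G q))"
  by (simp add: functional_def lin_add lin_scale)

lemma slice_tmap:
  "lin F \<Longrightarrow> lin G \<Longrightarrow> functional \<phi> \<Longrightarrow> slice \<phi> (tmap F G P) = F (slice (\<lambda>q. \<phi> (G q)) P)"
  by (rule lin_eq2I[where F = "\<lambda>P. slice \<phi> (tmap F G P)"])
    (auto intro!: lin_comp[OF lin_slice] lin_comp[where F = F]
      simp: tmap_tens slice_tens functional_comp lin_scale)

lemma tmap_sum_left: "tmap (\<lambda>p. F p + F' p) G P = tmap F G P + tmap F' G P"
  and tmap_sum_right: "tmap F (\<lambda>p. G p + G' p) P = tmap F G P + tmap F G' P"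
  and tmap_scale_left: "tmap (\<lambda>p. fv_scale r (F p)) G P = fv_scale r (tmap F G P)"
  and tmap_scale_right: "tmap F (\<lambda>p. fv_scale r (G p)) P = fv_scale r (tmap F G P)"
  by (simp_all add: tmap_def case_prod_unfold lin_ext_fun_add lin_ext_fun_scale)

lemma tmap_zero_left: "tmap (\<lambda>p. 0) G P = 0"
  and tmap_zero_right: "tmap F (\<lambda>p. 0) P = 0"
  by (simp_all add: tmap_def lin_ext_def case_prod_unfold)

lemma times_fun_add: "(*) (p + q) = (\<lambda>x. p * x + q * x)" "(*) (fv_scale r p) = (\<lambda>x. fv_scale r (p * x))"
    "(*) 0 = (\<lambda>x. 0 :: ('i, 'k::field) tensor_alg)"
  for p q :: "('i, 'k::field) tensor_alg"
  by (simp_all add: fun_eq_iff distrib_right)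

lemma keys_tens: "(u, w) \<in> keys (tens p q :: 'a \<times> 'b \<Rightarrow>\<^sub>0 'k::field) \<Longrightarrow> u \<in> keys p \<and> w \<in> keys q"
  by (auto simp: tens_def dest!: keys_lin_ext)

lemma keys_tmap:
  assumes "(u, v) \<in> keys (tmap F G P :: 'a \<times> 'b \<Rightarrow>\<^sub>0 'k::field)"
  shows "\<exists>u' v'. (u', v') \<in> keys P \<and> u \<in> keys (F (basis_vec u')) \<and>
    v \<in> keys (G (basis_vec v'))"
proof -
  obtain b where "b \<in> keys P"
    "(u, v) \<in> keys (case b of (u, w) \<Rightarrow> tens (F (basis_vec u)) (G (basis_vec w)))"
    using keys_lin_ext[OF assms[unfolded tmap_def]] by blast
  then show ?thesis
    by (cases b) (auto dest: keys_tens)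
qed

lemma tens_kernel_subspace: "fv.subspace (tens_kernel U)"
  by (simp add: tens_kernel_def)

lemma tens_kernel_left: "p \<in> U \<Longrightarrow> tens p q \<in> tens_kernel U"
  and tens_kernel_right: "q \<in> U \<Longrightarrow> tens p q \<in> tens_kernel U"
  unfolding tens_kernel_def by (blast intro: fv.span_base)+

lemma tens_kernel_mapI:
  assumes "lin F" "fv.subspace W" "\<And>p q. p \<in> U \<Longrightarrow> F (tens p q) \<in> W" "\<And>p q. q \<in> U \<Longrightarrow> F (tens p q) \<in> W"
    and "P \<in> tens_kernel U"
  shows "F P \<in> W"
  using assms(5) unfolding tens_kernel_def
proof (induction rule: fv.span_induct_alt)
  case base
  then show ?case using lin_0[OF assms(1)] fv.subspace_0[OF assms(2)] by simp
next
  case (step c x y)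
  then have "F x \<in> W" using assms(3,4) by auto
  then show ?case
    using step(2) by (simp add: lin_add[OF assms(1)] lin_scale[OF assms(1)]
        fv.subspace_add[OF assms(2)] fv.subspace_scale[OF assms(2)])
qed

text \<open>The map is the identity minus a projection onto U. Its kernel is exactly U, so it
  replaces the quotient map by an endomorphism of the same space.\<close>

lemma projection_along:
  fixes U :: "('b \<Rightarrow>\<^sub>0 'k::field) set"
  assumes "fv.subspace U"
  obtains \<pi> :: "('b \<Rightarrow>\<^sub>0 'k) \<Rightarrow> ('b \<Rightarrow>\<^sub>0 'k)"
  where "lin \<pi>" "\<And>p. p - \<pi> p \<in> U" "\<And>p. p \<in> U \<Longrightarrow> \<pi> p = 0"
proof -
  interpret vector_space_pair "fv_scale :: 'k \<Rightarrow> ('b \<Rightarrow>\<^sub>0 'k) \<Rightarrow> _" "fv_scale :: 'k \<Rightarrow> ('b \<Rightarrow>\<^sub>0 'k) \<Rightarrow> _" ..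
  obtain B where B: "B \<subseteq> U" "fv.independent B" "U \<subseteq> fv.span B"
    using fv.maximal_independent_subset[of U] by blast
  obtain F where F: "lin F" "\<forall>x\<in>B. F x = x" "range F = fv.span ((\<lambda>x. x) ` B)"
    using linear_independent_extend_subspace[OF B(2), of "\<lambda>x. x"] by blast
  have "F p \<in> U" for p
    using F(3) fv.span_minimal[OF B(1) assms] by auto
  moreover have "F p = p" if "p \<in> U" for p
    by (rule linear_eq_on[OF F(1) _ subsetD[OF B(3) that]]) (use F(2) in \<open>auto intro: lin_intros\<close>)
  ultimately show ?thesis
    by (intro that[of "\<lambda>p. p - F p"]) (auto intro!: lin_intros F(1))
qed

context group_braiding
begin

lemma functional_pr [simp]: "functional (pr w)" "functional (\<lambda>p. pr w p)"
  by (simp_all add: functional_def)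

text \<open>Let \<pi> be a projection with kernel \<open>nich\<close>. P differs from its image
  under \<open>\<pi> \<otimes> \<pi>\<close> by an element of the tensor kernel, and that image
  vanishes because the functionals \<open>pr v\<close> separate the points of the range of \<pi>, in
  each factor in turn.\<close>

lemma tens_kernel_nichI:
  assumes "\<And>v w. pr w (slice (pr v) P) = 0"
  shows "P \<in> tens_kernel nich"
proof -
  obtain \<pi> where \<pi>: "lin \<pi>" "\<And>p. p - \<pi> p \<in> nich" "\<And>p. p \<in> nich \<Longrightarrow> \<pi> p = (0 :: ('i, 'k) tensor_alg)"
    using projection_along[OF subspace_nich] by metis
  have pr\<pi>: "pr w (\<pi> p) = pr w p" for w p
    using nichD[OF \<pi>(2)[of p], of w] by simp
  have \<pi>\<pi>: "\<pi> (\<pi> p) = \<pi> p" for p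
    using \<pi>(3)[OF \<pi>(2)[of p]] by (simp add: lin_diff[OF \<pi>(1)])
  define Q where "Q = tmap \<pi> \<pi> P"
  have "Q' - tmap \<pi> \<pi> Q' \<in> tens_kernel nich" for Q'
  proof (induction Q' rule: fv_induct)
    case (basis r b)
    obtain u w where b: "b = (u, w)" by fastforce
    have "tens (basis_vec u) (basis_vec w) - tmap \<pi> \<pi> (tens (basis_vec u) (basis_vec w)) =
      tens (basis_vec u - \<pi> (basis_vec u)) (basis_vec w) + tens (\<pi> (basis_vec u)) (basis_vec w - \<pi> (basis_vec w))"
      by (simp only: tmap_tens[OF \<pi>(1,1)] tens_diff_left tens_diff_right) simp
    also have "\<dots> \<in> tens_kernel nich"
      by (intro fv.subspace_add[OF tens_kernel_subspace] tens_kernel_left tens_kernel_right \<pi>)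
    finally have "fv_scale r (basis_vec b - tmap \<pi> \<pi> (basis_vec b)) \<in> tens_kernel nich"
      unfolding b by (intro fv.subspace_scale[OF tens_kernel_subspace]) simp
    then show ?case
      by (simp add: fv.scale_right_diff_distrib)
  next
    case (add p q)
    then show ?case
      using fv.subspace_add[OF tens_kernel_subspace add] by (simp add: algebra_simps)
  qed (simp add: fv.subspace_0[OF tens_kernel_subspace])
  moreover have "Q = 0"
  proof -
    have *: "slice (pr v) Q = 0" for v
    proof -
      have "slice (pr v) Q = \<pi> (slice (pr v) P)"
        by (simp add: Q_def slice_tmap \<pi>(1) pr\<pi>)
      moreover have "\<pi> (slice (pr v) P) \<in> nich"
        using assms by (simp add: nich_def pr\<pi>)
      ultimately show ?thesis
        using \<pi>(3) \<pi>\<pi> by metis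
    qed
    \<comment> \<open>Contraction of the left factor with the coordinate functional at the word
      u.\<close>
    define ls :: "'i list \<Rightarrow> ('i list \<times> 'i list \<Rightarrow>\<^sub>0 'k) \<Rightarrow> ('i, 'k) tensor_alg"
      where "ls u = lin_ext (\<lambda>(u', w). if u' = u then basis_vec w else 0)"
      for u :: "'i list"
    have lin_ls: "lin (ls u)" for u
      by (simp add: ls_def linear_lin_ext)
    have ls_tens: "ls u (tens p q) = fv_scale (lookup p u) q" for u p q
    proof (rule lin_eqI[where F = "\<lambda>p. ls u (tens p q)"])
      fix u' show "ls u (tens (basis_vec u') q) = fv_scale (lookup (basis_vec u') u) q"
        by (rule lin_eqI[where F = "\<lambda>q. ls u (tens _ q)"])
          (auto intro!: lin_comp[OF lin_ls] lin_intros simp: ls_def lookup_basis_vec)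
    qed (auto intro!: lin_comp[OF lin_ls] lin_intros linI simp: lookup_add fv.scale_left_distrib)
    have "ls u Q = 0" for u
    proof -
      have "pr v (ls u Q') = lookup (slice (pr v) Q') u" for v Q'
      proof (induction Q' rule: fv_induct)
        case (basis r b)
        obtain u' w where b: "b = (u', w)" by fastforce
        have "pr v (ls u (tens (basis_vec u') (basis_vec w))) =
          lookup (slice (pr v) (tens (basis_vec u') (basis_vec w))) u"
          by (simp only: ls_tens slice_tens functional_pr lookup_fv_scale pr_scale mult.commute)
        then show ?case
          by (simp add: b lin_scale[OF lin_ls])
      qed (simp_all add: lin_0[OF lin_ls] lin_add[OF lin_ls] lookup_add)
      then have "ls u Q \<in> nich"
        by (simp add: nich_def *)
      moreover have "ls u (tmap \<pi> \<pi> Q') = \<pi> (ls u (tmap \<pi> (\<lambda>q. q) Q'))" for Q'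
        by (rule lin_eq2I[where F = "\<lambda>Q'. ls u (tmap \<pi> \<pi> Q')"])
          (auto intro!: lin_comp[OF lin_ls] lin_comp[OF \<pi>(1)] simp: tmap_tens \<pi>(1) ls_tens lin_scale[OF \<pi>(1)])
      then have "\<pi> (ls u Q) = ls u Q"
        by (simp add: Q_def \<pi>\<pi>)
      ultimately show ?thesis
        using \<pi>(3) by metis
    qed
    moreover have "lookup Q' (u, w) = lookup (ls u Q') w" for Q' u w
      by (induction Q' rule: fv_induct)
        (auto simp: lin_0[OF lin_ls] lin_add[OF lin_ls] lin_scale[OF lin_ls] lookup_add lookup_basis_vec
          ls_def split: prod.splits)
    ultimately have "lookup Q (u, w) = 0" for u w
      by (metis lookup_zero)
    then show "Q = 0"
      by (intro poly_mapping_eqI) (metis lookup_zero surj_pair)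
  qed
  ultimately show ?thesis
    using Q_def by (metis diff_zero)
qed

end

section \<open>The coproduct of the tensor algebra and the skew derivations\<close>

locale group_braided = group_braiding g g' for g g' :: "'i \<Rightarrow> 'i \<Rightarrow> ('i \<Rightarrow>\<^sub>0 'k::field)" +
  fixes c :: "('i, 'k) braiding"
  assumes braiding: "c (i, j) = tens (g i j) (basis_vec i)"
begin

lemmas lin_aut_der [simp] = lin_aut0 lin_aut'0 lin_der0

lemma lin_aut_left [simp]: "lin F \<Longrightarrow> lin (\<lambda>p. aut i (F p))"
  and lin_der_left [simp]: "lin F \<Longrightarrow> lin (\<lambda>p. der i (F p))"
  and lin_times_left [simp]: "lin F \<Longrightarrow> lin (\<lambda>p. r * F p)"
  for F :: "('a \<Rightarrow>\<^sub>0 'k) \<Rightarrow> ('i, 'k) tensor_alg"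
  by (simp_all add: lin_aut lin_der lin_mult_left)

lemma braid_letter_eq: "braid_letter c x w = tens (aut_word x w) (basis_vec x)"
proof (induction w arbitrary: x)
  case (Cons y w)
  let ?f = "\<lambda>(y', x'). lin_ext (\<lambda>(w', x''). basis_vec (y' # w', x'')) (braid_letter c x' w)"
  have 1: "lin_ext (\<lambda>(w', x''). basis_vec (y' # w', x'')) (tens p (basis_vec x)) =
      tens (basis_vec [y'] * p) (basis_vec x)" for y' p
    by (rule lin_eqI[where F = "\<lambda>p. lin_ext (\<lambda>(w', x''). basis_vec (y' # w', x'')) (tens p _)"])
      (auto intro!: lin_intros simp flip: basis_vec_append)
  have "lin_ext ?f (tens v (basis_vec x)) = tens (vemb v * aut_word x w) (basis_vec x)" for v
    by (rule lin_eqI[where F = "\<lambda>v. lin_ext ?f (tens v _)"])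
      (auto intro!: lin_intros lin_vemb simp: Cons 1)
  then show ?case
    by (simp add: braiding)
qed (simp add: basis_vec_Nil[symmetric])

definition auts :: "'i list \<Rightarrow> ('i, 'k) tensor_alg \<Rightarrow> ('i, 'k) tensor_alg"
  where "auts u = foldr aut u"

lemma auts_simps [simp]: "auts [] = (\<lambda>p. p)" "auts (x # u) = (\<lambda>p. aut x (auts u p))"
  by (simp_all add: auts_def fun_eq_iff)

lemma lin_auts [simp]: "lin (auts u)"
  by (induction u) simp_all

lemma tbraid_eq: "tbraid c (u, w) = tens (auts u (basis_vec w)) (basis_vec u)"
proof (induction u)
  case (Cons x u)
  let ?f = "\<lambda>(w', u'). lin_ext (\<lambda>(w'', x'). basis_vec (w'', x' # u')) (braid_letter c x w')"
  have 1: "lin_ext (\<lambda>(w'', x'). basis_vec (w'', x' # u)) (tens p (basis_vec x)) = tens p (basis_vec (x # u))" for p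
    by (rule lin_eqI[where F = "\<lambda>p. lin_ext (\<lambda>(w'', x'). basis_vec (w'', x' # u)) (tens p _)"])
      (auto intro!: lin_intros)
  have "lin_ext ?f (tens p (basis_vec u)) = tens (aut x p) (basis_vec (x # u))" for p
    by (rule lin_eqI[where F = "\<lambda>p. lin_ext ?f (tens p _)"])
      (auto intro!: lin_intros simp: braid_letter_eq 1 aut_basis)
  then show ?case
    using Cons by simp
qed simp

text \<open>The operators commute, so a letter of w with the degree of the first letter of u can be
  moved to the front.\<close>

lemma auts_cong: "deg u = deg w \<Longrightarrow> auts u = auts w"
proof (induction u arbitrary: w)
  case (Cons x u)
  from Cons.prems have "g x \<in># deg w"
    by (metis deg_simps(2) union_single_eq_member)
  then obtain y where y: "y \<in> set w" "g y = g x"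
    by (auto simp: deg_def)
  then obtain w1 w2 where w: "w = w1 @ y # w2"
    by (meson split_list)
  have "auts (w1 @ y # w2) p = aut y (auts (w1 @ w2) p)" for p
    by (induction w1) (auto simp: aut_commute)
  moreover have "auts u = auts (w1 @ w2)"
    using Cons.prems y(2) w by (intro Cons.IH) simp
  ultimately show ?case
    using aut_cong[of x y] y(2) by (simp add: fun_eq_iff w)
qed (simp add: deg_def)

text \<open>The factor \<open>x \<otimes> 1\<close> only meets the left side, whereas
  \<open>1 \<otimes> x\<close> has to cross it and thereby applies \<open>aut x\<close>.\<close>

lemma tmul2_left: "tmul2 c (tens (basis_vec [x]) tone) P = tmap ((*) (basis_vec [x])) (\<lambda>q. q) P"
  and tmul2_right: "tmul2 c (tens tone (basis_vec [x])) P = tmap (aut x) ((*) (basis_vec [x])) P"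
proof -
  have lin: "lin (\<lambda>P. tmul2 c Q P)" for Q
    by (auto simp: tmul2_def intro!: lin_intros)
  have 1: "lin_ext (\<lambda>(u', t'). basis_vec (s @ u', t' @ w)) (tens p q) =
      tens (basis_vec s * p) (q * basis_vec w)" for s w and p q :: "('i, 'k) tensor_alg"
  proof (rule lin_eqI[where F = "\<lambda>p. lin_ext (\<lambda>(u', t'). basis_vec (s @ u', t' @ w)) (tens p q)"])
    fix u show "lin_ext (\<lambda>(u', t'). basis_vec (s @ u', t' @ w)) (tens (basis_vec u) q) =
      tens (basis_vec s * basis_vec u) (q * basis_vec w)"
      by (rule lin_eqI[where F = "\<lambda>q. lin_ext (\<lambda>(u', t'). basis_vec (s @ u', t' @ w)) (tens _ q)"])
        (auto intro!: lin_intros simp flip: basis_vec_append)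
  qed (auto intro!: lin_intros)
  have 2: "tmul2 c (basis_vec (s, t)) (basis_vec (u, w)) =
      tens (basis_vec s * auts t (basis_vec u)) (basis_vec t * basis_vec w)" for s t u w
    by (simp add: tmul2_def tbraid_eq 1)
  show "tmul2 c (tens (basis_vec [x]) tone) P = tmap ((*) (basis_vec [x])) (\<lambda>q. q) P"
  proof (rule lin_eqI[OF lin lin_tmap])
    fix b show "tmul2 c (tens (basis_vec [x]) tone) (basis_vec b) = tmap ((*) (basis_vec [x])) (\<lambda>q. q) (basis_vec b)"
      by (cases b) (simp only: tone_def tens_basis_vec 2, simp add: tmap_def basis_vec_Nil)
  qed
  show "tmul2 c (tens tone (basis_vec [x])) P = tmap (aut x) ((*) (basis_vec [x])) P"
  proof (rule lin_eqI[OF lin lin_tmap])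
    fix b show "tmul2 c (tens tone (basis_vec [x])) (basis_vec b) = tmap (aut x) ((*) (basis_vec [x])) (basis_vec b)"
      by (cases b) (simp only: tone_def tens_basis_vec 2, simp add: tmap_def basis_vec_Nil)
  qed
qed

lemma tmul2_add_left: "tmul2 c (P + Q) R = tmul2 c P R + tmul2 c Q R"
  by (simp add: tmul2_def)

lemma lin_tcomul [simp]: "lin (tcomul c)"
  by (simp add: tcomul_def linear_lin_ext)

lemmas tcomul_lin [simp] = lin_add[OF lin_tcomul] lin_scale[OF lin_tcomul] lin_0[OF lin_tcomul]
  lin_diff[OF lin_tcomul]

lemma tcomul_one [simp]: "tcomul c 1 = tens 1 1"
  by (simp add: tcomul_def tone_def flip: basis_vec_Nil)

lemma tcomul_letter_mult: "tcomul c (basis_vec [x] * p) =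
    tmap ((*) (basis_vec [x])) (\<lambda>q. q) (tcomul c p) + tmap (aut x) ((*) (basis_vec [x])) (tcomul c p)"
proof (rule lin_eqI[where F = "\<lambda>p. tcomul c (_ * p)"])
  fix w
  have "tcomul c (basis_vec (x # w)) =
    tmul2 c (tens (basis_vec [x]) tone + tens tone (basis_vec [x])) (tcomul c (basis_vec w))"
    by (simp add: tcomul_def)
  then show "tcomul c (basis_vec [x] * basis_vec w) = tmap ((*) (basis_vec [x])) (\<lambda>q. q) (tcomul c (basis_vec w)) +
      tmap (aut x) ((*) (basis_vec [x])) (tcomul c (basis_vec w))"
    unfolding basis_vec_Cons[of x w] tmul2_add_left tmul2_left tmul2_right .
qed (auto intro!: lin_comp[OF lin_tcomul] lin_plus lin_comp[OF lin_tmap])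

text \<open>All letters of v act by the same automorphism, so the formula for one letter extends
  linearly. It is applied to \<open>v = g i x\<close> in \<open>tcomul_aut\<close>.\<close>

lemma tcomul_vemb_mult:
  assumes "\<And>l. l \<in> keys v \<Longrightarrow> g l = g x"
  shows "tcomul c (vemb v * p) =
    tmap ((*) (vemb v)) (\<lambda>q. q) (tcomul c p) + tmap (aut x) ((*) (vemb v)) (tcomul c p)"
proof (induction v rule: vemb_mult_induct)
  case (1 l)
  then show ?case
    using aut_cong[of l x] assms by (simp add: tcomul_letter_mult)
qed (simp_all add: times_fun_add distrib_right tmap_sum_left tmap_sum_right tmap_scale_left tmap_scale_right
    tmap_zero_left tmap_zero_right fv.scale_right_distrib algebra_simps)

lemma tcomul_aut: "tcomul c (aut i p) = tmap (aut i) (aut i) (tcomul c p)"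
proof (induction p rule: tensor_induct)
  case (letter x p)
  have "tcomul c (aut i (basis_vec [x] * p)) = tcomul c (vemb (g i x) * aut i p)"
    by (simp add: aut_letter)
  also have "\<dots> = tmap (aut i) (aut i) (tcomul c (basis_vec [x] * p))"
    by (subst tcomul_vemb_mult[where x = x])
      (auto simp: g_degree letter tcomul_letter_mult tmap_tmap aut_letter aut_commute[of x i])
  finally show ?case .
qed (simp_all add: tmap_tens)

text \<open>This is coassociativity, contracted in the last factor with the coordinate of the letter
  i.\<close>

lemma tcomul_der: "tmap (\<lambda>p. p) (der i) (tcomul c p) = tcomul c (der i p)"
proof (induction p rule: tensor_induct)
  case (letter x p)
  have "tmap (aut x) (\<lambda>q. der i (basis_vec [x] * q)) P =
    tmap (aut x) (\<lambda>q. basis_vec [x] * der i q) P + (if i = x then tmap (aut i) (aut i) P else 0)" for P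
    by (auto simp: der_letter_mult tmap_sum_right tmap_zero_right simp del: der_mult)
  moreover have "tmap (aut x) (\<lambda>q. basis_vec [x] * der i q) (tcomul c p) =
      tmap (aut x) ((*) (basis_vec [x])) (tcomul c (der i p))"
    by (simp add: letter[symmetric] tmap_tmap)
  moreover have "tmap ((*) (basis_vec [x])) (der i) (tcomul c p) =
      tmap ((*) (basis_vec [x])) (\<lambda>q. q) (tcomul c (der i p))"
    by (simp add: letter[symmetric] tmap_tmap)
  ultimately show ?case
    by (simp add: tcomul_letter_mult tmap_tmap der_letter_mult tcomul_aut del: der_mult)
qed (simp_all add: tmap_tens)

lemma tcomul_counit: "slice tcounit (tcomul c p) = p"
proof (induction p rule: tensor_induct)
  case (letter x p)
  have f: "functional (tcounit :: ('i, 'k) tensor_alg \<Rightarrow> 'k)" 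
    by (simp add: functional_def)
  have "slice (\<lambda>q. 0) P = 0" for P :: "'i list \<times> 'i list \<Rightarrow>\<^sub>0 'k"
    by (simp add: slice_def lin_ext_def case_prod_unfold)
  then show ?case
    using letter by (simp add: tcomul_letter_mult slice_tmap f tcounit_basis)
qed (simp_all add: slice_tens functional_def)

lemma pr_tcomul: "pr w (slice (pr v) (tcomul c p)) = pr (v @ w) p"
proof (induction v arbitrary: p)
  case Nil
  have "pr [] = (tcounit :: ('i, 'k) tensor_alg \<Rightarrow> 'k)"
    by (simp add: fun_eq_iff)
  then show ?case
    by (simp add: tcomul_counit)
next
  case (Cons i v)
  have "pr (i # v) = (\<lambda>q. pr v (der i q))"
    by (simp add: fun_eq_iff)
  then have eq: "slice (pr (i # v)) P = slice (pr v) (tmap (\<lambda>p. p) (der i) P)" for P :: "'i list \<times> 'i list \<Rightarrow>\<^sub>0 'k"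
    by (simp add: slice_tmap)
  show ?case
    unfolding eq tcomul_der Cons by simp
qed

lemma tcomul_nich: "p \<in> nich \<Longrightarrow> tcomul c p \<in> tens_kernel nich"
  by (rule tens_kernel_nichI) (simp add: pr_tcomul nichD)

subsection \<open>The antipode\<close>

text \<open>The derivation is indexed by a functional on V and not by a letter: passing x replaces f
  by f composed with \<open>g x\<close>, which need not be a multiple of a coordinate since
  \<open>g x\<close> is not diagonal.\<close>

fun lder_word :: "(('i \<Rightarrow>\<^sub>0 'k) \<Rightarrow> 'k) \<Rightarrow> 'i list \<Rightarrow> ('i, 'k) tensor_alg"
  where
    "lder_word f [] = 0"
  | "lder_word f (x # w) = fv_scale (f (basis_vec x)) (basis_vec w) +
      basis_vec [x] * lder_word (\<lambda>v. f (lin_ext (g x) v)) w"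

text \<open>The antipode exchanges the right skew derivations \<^const>\<open>der\<close> with left ones.\<close>

definition lder :: "(('i \<Rightarrow>\<^sub>0 'k) \<Rightarrow> 'k) \<Rightarrow> ('i, 'k) tensor_alg \<Rightarrow> ('i, 'k) tensor_alg"
  where "lder f = lin_ext (lder_word f)"

lemma lin_lder [simp]: "lin (lder f)"
  by (simp add: lder_def linear_lin_ext)

lemmas lder_lin [simp] = lin_add[OF lin_lder] lin_scale[OF lin_lder] lin_0[OF lin_lder]

lemma lder_one [simp]: "lder f 1 = 0"
  by (simp add: lder_def flip: basis_vec_Nil)

lemma lder_letter_mult:
  "lder f (basis_vec [x] * p) = fv_scale (f (basis_vec x)) p + basis_vec [x] * lder (\<lambda>v. f (lin_ext (g x) v)) p"
  by (rule lin_eqI[where F = "\<lambda>p. lder f (_ * p)"])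
    (auto intro!: lin_comp[OF lin_lder] lin_intros simp: lder_def simp flip: basis_vec_append)

lemma lder_vemb_mult:
  assumes "functional f" "\<And>l. l \<in> keys v \<Longrightarrow> g l = g x"
  shows "lder f (vemb v * p) = fv_scale (f v) p + vemb v * lder (\<lambda>v. f (lin_ext (g x) v)) p"
  by (induction v rule: vemb_mult_induct)
    (auto simp: lder_letter_mult assms functional_simps[OF assms(1)] algebra_simps fv.scale_left_distrib
      fv.scale_right_distrib)

lemma lin_ext_g_commute: "lin_ext (g i) (lin_ext (g j) v) = lin_ext (g j) (lin_ext (g i) v)"
  by (rule lin_eqI[where F = "\<lambda>v. lin_ext (g i) (lin_ext (g j) v)"]) (auto intro!: lin_intros simp: g_comm)

lemma functional_g: "functional f \<Longrightarrow> functional (\<lambda>v. f (lin_ext (g x) v))"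
  by (simp add: functional_def)

lemma lder_aut: "functional f \<Longrightarrow> lder f (aut j p) = aut j (lder (\<lambda>v. f (lin_ext (g j) v)) p)"
proof (induction p arbitrary: f rule: tensor_induct)
  case (letter x p)
  have "lder f (aut j (basis_vec [x] * p)) = lder f (vemb (g j x) * aut j p)"
    by (simp add: aut_letter)
  also have "\<dots> = fv_scale (f (g j x)) (aut j p) + vemb (g j x) * lder (\<lambda>v. f (lin_ext (g x) v)) (aut j p)"
    by (rule lder_vemb_mult) (use letter.prems g_degree in auto)
  also have "\<dots> = aut j (lder (\<lambda>v. f (lin_ext (g j) v)) (basis_vec [x] * p))"
    by (simp add: letter.IH[OF functional_g[OF letter.prems]] lder_letter_mult aut_letter lin_ext_g_commute[of x j])
  finally show ?case .
qed simp_all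

text \<open>The two derivations contract opposite ends of the coproduct. Their commuting is what
  makes the coinduction in \<open>nich_lder\<close> close.\<close>

lemma der_lder: "functional f \<Longrightarrow> der j (lder f p) = lder f (der j p)"
proof (induction p arbitrary: f rule: tensor_induct)
  case (letter x p)
  then show ?case
    using letter.IH[OF functional_g[OF letter.prems, of x]] lder_aut[OF letter.prems, of j p]
    by (auto simp: lder_letter_mult der_letter_mult simp del: der_mult)
qed simp_all

lemma pr_single: "pr [i] (basis_vec w) = (if w = [i] then 1 else 0)"
proof (cases w)
  case (Cons j v)
  have "pr [i] (basis_vec (j # v)) = (if i = j then tcounit (basis_vec v :: ('i, 'k) tensor_alg) else 0)"
    unfolding basis_vec_Cons[of j v] by (simp add: der_letter tcounit_basis)
  then show ?thesis
    by (simp add: Cons tcounit_basis)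
qed (simp add: basis_vec_Nil)

lemma lookup_single_letter: "lookup p [i] = pr [i] p"
proof (induction p rule: fv_induct)
  case (basis r b)
  show ?case
    using pr_single[of i b] by (auto simp: lookup_basis_vec)
qed (simp_all add: lookup_add)

lemma tcounit_lder:
  assumes f: "functional f" and "p \<in> nich"
  shows "tcounit (lder f p) = 0"
proof -
  \<comment> \<open>V extracts the part of degree one. A left derivation lowers the degree by one,
    so the counit of \<open>lder f p\<close> sees only that part.\<close>
  define V :: "('i, 'k) tensor_alg \<Rightarrow> ('i \<Rightarrow>\<^sub>0 'k)"
    where "V = lin_ext (\<lambda>w. if length w = 1 then basis_vec (hd w) else 0)"
  have *: "tcounit (lder f p) = f (V p)" for p
  proof (induction p rule: fv_induct)
    case (basis r w)
    have "tcounit (lder_word f w) = f (V (basis_vec w))"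
      by (cases w) (auto simp: V_def tcounit_basis functional_simps[OF f])
    then show ?case
      by (simp add: lder_def V_def functional_simps[OF f])
  qed (simp_all add: V_def functional_simps[OF f])
  have "lookup (V p) i = pr [i] p" for i p
  proof (induction p rule: fv_induct)
    case (basis r w)
    have "lookup (V (basis_vec w)) i = pr [i] (basis_vec w)"
      unfolding pr_single by (cases w) (auto simp: V_def lookup_basis_vec)
    then show ?case
      by (simp add: V_def)
  qed (simp_all add: V_def lookup_add)
  then have "V p = 0"
    using nichD[OF assms(2)] by (intro poly_mapping_eqI) (simp del: pr.simps)
  then show ?thesis
    by (simp add: * functional_simps[OF f])
qed

lemma nich_lder:
  assumes f: "functional f" and "p \<in> nich"
  shows "lder f p \<in> nich"
proof (rule nich_coinduct[where J = "lder f ` nich"])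
  fix q i assume "q \<in> lder f ` nich"
  then obtain p where p: "q = lder f p" "p \<in> nich" by auto
  show "tcounit q = 0"
    using tcounit_lder[OF f p(2)] p(1) by simp
  have "der i q \<in> lder f ` nich"
    using nich_der[OF p(2)] by (simp add: p(1) der_lder[OF f])
  then show "der i q \<in> fv.span (lder f ` nich \<union> nich)"
    by (intro fv.span_base) simp
qed (use assms in blast)

text \<open>The recursion combines \<open>S(x) = - x\<close> with braided antimultiplicativity, S m
  = m (S \<otimes> S) c, and the fact that S commutes with \<open>aut x\<close>.\<close>

fun antipode_word :: "'i list \<Rightarrow> ('i, 'k) tensor_alg"
  where
    "antipode_word [] = 1"
  | "antipode_word (x # w) = - (aut x (antipode_word w) * basis_vec [x])"

definition antipode :: "('i, 'k) tensor_alg \<Rightarrow> ('i, 'k) tensor_alg"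
  where "antipode = lin_ext antipode_word"

lemma lin_antipode [simp]: "lin antipode"
  by (simp add: antipode_def linear_lin_ext)

lemmas antipode_lin [simp] = lin_add[OF lin_antipode] lin_scale[OF lin_antipode] lin_0[OF lin_antipode]
  lin_minus[OF lin_antipode] lin_sum[OF lin_antipode]

lemma antipode_one [simp]: "antipode 1 = 1"
  by (simp add: antipode_def flip: basis_vec_Nil)

lemma antipode_basis: "antipode (basis_vec w) = antipode_word w"
  by (simp add: antipode_def)

lemma lin_uminus: "lin F \<Longrightarrow> lin (\<lambda>p. - F p)"
  using lin_scaled[of F "-1"] by simp

lemma lin_times_right: "lin F \<Longrightarrow> lin (\<lambda>p. F p * r)" for r :: "('i, 'k) tensor_alg"
  by (rule lin_mult_right)

lemma antipode_letter_mult: "antipode (basis_vec [x] * p) = - (aut x (antipode p) * basis_vec [x])"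
  by (rule lin_eqI[where F = "\<lambda>p. antipode (_ * p)"])
    (auto intro!: lin_comp[OF lin_antipode] lin_uminus lin_times_right lin_aut
      simp: antipode_basis simp flip: basis_vec_append)

lemma antipode_vemb_mult:
  assumes "\<And>l. l \<in> keys v \<Longrightarrow> g l = g x"
  shows "antipode (vemb v * p) = - (aut x (antipode p) * vemb v)"
proof (induction v rule: vemb_mult_induct)
  case (1 l)
  then show ?case
    using aut_cong[of l x] assms by (simp add: antipode_letter_mult)
qed (simp_all add: algebra_simps)

lemma antipode_aut: "antipode (aut i p) = aut i (antipode p)"
proof (induction p rule: tensor_induct)
  case (letter x p)
  have "antipode (aut i (basis_vec [x] * p)) = antipode (vemb (g i x) * aut i p)"
    by (simp add: aut_letter)
  also have "\<dots> = - (aut x (antipode (aut i p)) * vemb (g i x))"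
    by (rule antipode_vemb_mult) (simp add: g_degree)
  finally show ?case
    by (simp add: letter antipode_letter_mult aut_letter aut_commute[of x i])
qed simp_all

lemma lder_sum:
  "lder (\<lambda>v. \<Sum>l\<in>K. a l * \<phi> l v) p = (\<Sum>l\<in>K. fv_scale (a l) (lder (\<phi> l) p))"
proof (rule lin_eqI[OF lin_lder])
  fix w
  have "lder_word (\<lambda>v. \<Sum>l\<in>K. a l * \<phi> l v) w = (\<Sum>l\<in>K. fv_scale (a l) (lder_word (\<phi> l) w))" for \<phi>
    by (induction w arbitrary: \<phi>)
      (simp_all add: fv.scale_sum_left fv.scale_right_distrib sum.distrib sum_distrib_left)
  then show "lder (\<lambda>v. \<Sum>l\<in>K. a l * \<phi> l v) (basis_vec w) = (\<Sum>l\<in>K. fv_scale (a l) (lder (\<phi> l) (basis_vec w)))"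
    by (simp add: lder_def)
qed (intro lin_lin_sum lin_scaled lin_lder)

lemma der_antipode: "der i (antipode p) = - aut i (antipode (lder (\<lambda>v. lookup v i) p))"
proof (induction p arbitrary: i rule: tensor_induct)
  case (letter x p)
  let ?K = "{l. i \<in> keys (g x l)}"
  let ?f = "\<lambda>i v. lookup v i"
  let ?a = "\<lambda>l. lookup (g x l) i"
  have "der i (aut x (antipode p)) = (\<Sum>l\<in>?K. fv_scale (?a l) (aut x (der l (antipode p))))"
    by (rule der_hom) (simp_all add: aut_letter aut_commute[of _ x] g_degree finite_occ)
  also have "\<dots> = (\<Sum>l\<in>?K. - fv_scale (?a l) (aut x (aut i (antipode (lder (?f l) p)))))"
  proof (rule sum.cong[OF refl])
    fix l assume "l \<in> ?K"
    then have "g i = g l"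
      by (simp add: g_degree)
    then show "fv_scale (?a l) (aut x (der l (antipode p))) = - fv_scale (?a l) (aut x (aut i (antipode (lder (?f l) p))))"
      using aut_cong[of i l] by (simp add: letter)
  qed
  also have "\<dots> = - aut x (aut i (antipode (\<Sum>l\<in>?K. fv_scale (?a l) (lder (?f l) p))))"
    by (simp add: sum_negf)
  also have "(\<Sum>l\<in>?K. fv_scale (?a l) (lder (?f l) p)) = lder (\<lambda>v. \<Sum>l\<in>?K. ?a l * ?f l v) p"
    by (rule lder_sum[symmetric])
  \<comment> \<open>Coordinate i of \<open>g x\<close> applied to v, expanded in the coordinates of
    v. The sum of left derivations becomes a single one along the twisted functional, as in
    \<open>lder_letter_mult\<close>.\<close>
  also have "(\<lambda>v. \<Sum>l\<in>?K. ?a l * ?f l v) = (\<lambda>v. ?f i (lin_ext (g x) v))"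
  proof
    fix v
    have "?f i (lin_ext (g x) v) = (\<Sum>l\<in>keys v. ?f l v * ?a l)"
      by (simp add: lin_ext_def lookup_sum)
    also have "\<dots> = (\<Sum>l\<in>keys v \<union> ?K. ?f l v * ?a l)"
      by (rule sum.mono_neutral_left) (use finite_occ[of i x] in \<open>auto simp: in_keys_iff\<close>)
    also have "\<dots> = (\<Sum>l\<in>?K. ?f l v * ?a l)"
      by (rule sum.mono_neutral_right) (use finite_occ[of i x] in \<open>auto simp: in_keys_iff\<close>)
    finally show "(\<Sum>l\<in>?K. ?a l * ?f l v) = ?f i (lin_ext (g x) v)"
      by (simp add: mult.commute)
  qed
  finally have "der i (aut x (antipode p)) = - aut x (aut i (antipode (lder (\<lambda>v. ?f i (lin_ext (g x) v)) p)))" .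
  then show ?case
    by (simp add: antipode_letter_mult lder_letter_mult der_letter lookup_basis_vec aut_commute[of x i])
qed simp_all

lemma antipode_nich: "p \<in> nich \<Longrightarrow> antipode p \<in> nich"
proof (rule nich_coinduct[where J = "antipode ` nich"])
  fix q i assume "q \<in> antipode ` nich"
  then obtain p where p: "q = antipode p" "p \<in> nich" by auto
  have "tcounit (antipode p) = tcounit p" for p
  proof (induction p rule: tensor_induct)
    case (letter x p)
    then show ?case
      using tcounit_scale[of "-1" "aut x (antipode p) * basis_vec [x]"]
      by (simp add: antipode_letter_mult tcounit_basis)
  qed simp_all
  then show "tcounit q = 0"
    using nich_tcounit p by simp
  let ?r = "- aut i (lder (\<lambda>v. lookup v i) p)"
  have "?r \<in> nich"
    by (intro nich_minus nich_aut nich_lder p) (simp add: functional_def lookup_add)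
  moreover have "der i q = antipode ?r"
    by (simp add: p(1) der_antipode antipode_aut)
  ultimately show "der i q \<in> fv.span (antipode ` nich \<union> nich)"
    by (intro fv.span_base) blast
qed blast

lemma convolution_eq: "convolution c F G p = mulmap F G (tcomul c p)"
  by (simp add: convolution_def mulmap_def tmul_eq)

lemma mulmap_uminus_left: "mulmap (\<lambda>p. - F p) G P = - mulmap F G P"
  and mulmap_uminus_right: "mulmap F (\<lambda>p. - G p) P = - mulmap F G P"
  by (simp_all add: mulmap_def case_prod_unfold lin_ext_def sum_negf)

lemma mulmap_antipode_left: "mulmap antipode (\<lambda>q. q) (tcomul c p) = fv_scale (tcounit p) 1"
proof (induction p rule: tensor_induct)
  case (letter x p)
  have "mulmap (\<lambda>p. aut x (antipode p) * basis_vec [x]) (\<lambda>q. q) P =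
      mulmap (\<lambda>p. aut x (antipode p)) ((*) (basis_vec [x])) P" for P
    by (rule lin_eq2I) (auto simp: mulmap_tens lin_times_right mult.assoc)
  then show ?case
    by (simp add: tcomul_letter_mult mulmap_tmap antipode_letter_mult antipode_aut mulmap_uminus_left tcounit_basis)
qed (simp_all add: mulmap_tens fv.scale_left_distrib)

lemma mulmap_antipode_right: "mulmap (\<lambda>q. q) antipode (tcomul c p) = fv_scale (tcounit p) 1"
proof (induction p rule: tensor_induct)
  case (letter x p)
  have "mulmap ((*) (basis_vec [x])) antipode P = basis_vec [x] * mulmap (\<lambda>q. q) antipode P" for P
    by (rule lin_eq2I) (auto simp: mulmap_tens mult.assoc)
  moreover have "mulmap (aut x) (\<lambda>q. aut x (antipode q) * basis_vec [x]) P =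
      aut x (mulmap (\<lambda>q. q) antipode P) * basis_vec [x]" for P
    by (rule lin_eq2I) (auto simp: mulmap_tens lin_times_right mult.assoc)
  ultimately show ?case
    by (simp add: tcomul_letter_mult mulmap_tmap antipode_letter_mult mulmap_uminus_right tcounit_basis letter)
qed (simp_all add: mulmap_tens fv.scale_left_distrib)

subsection \<open>The braiding on the tensor algebra\<close>

fun auts' :: "'i list \<Rightarrow> ('i, 'k) tensor_alg \<Rightarrow> ('i, 'k) tensor_alg"
  where
    "auts' [] p = p"
  | "auts' (x # u) p = auts' u (aut' x p)"

lemma auts_auts' [simp]: "auts u (auts' u p) = p" "auts' u (auts u p) = p"
  by (induction u arbitrary: p) simp_all

lemma auts'_cong: "deg u = deg w \<Longrightarrow> auts' u p = auts' w p"
  by (metis auts_auts' auts_cong)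

lemma lin_auts' [simp]: "lin (auts' u)"
  by (rule linI) (metis auts_auts' lin_add[OF lin_auts] lin_scale[OF lin_auts])+

lemma nich_auts: "p \<in> nich \<Longrightarrow> auts u p \<in> nich"
  by (induction u) (simp_all add: nich_aut)

lemma nich_auts': "p \<in> nich \<Longrightarrow> auts' u p \<in> nich"
  by (induction u arbitrary: p) (simp_all add: nich_aut')

lemma degree_decomposition: "p = (\<Sum>D\<in>deg ` keys p. component (\<lambda>w. deg w = D) p)"
proof (rule poly_mapping_eqI)
  fix w
  show "lookup p w = lookup (\<Sum>D\<in>deg ` keys p. component (\<lambda>w. deg w = D) p) w"
    by (auto simp: lookup_component lookup_sum in_keys_iff)
qed

text \<open>Both the braiding and its inverse have the shape \<open>p \<otimes> q \<mapsto> h\<^sub>p(q) \<otimes> p\<close> for \<open>p\<close> homogeneous.\<close>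

lemma homogeneous_action:
  fixes F :: "('i, 'k) tensor_alg \<Rightarrow> ('i list \<times> 'i list \<Rightarrow>\<^sub>0 'k)"
    and H :: "'i list \<Rightarrow> ('i, 'k) tensor_alg \<Rightarrow> ('i list \<times> 'i list \<Rightarrow>\<^sub>0 'k)"
  assumes F: "lin F" "\<And>u. F (basis_vec u) = H u (basis_vec u)"
    and H: "\<And>u. lin (H u)" "\<And>u w. deg u = deg w \<Longrightarrow> H u = H w"
    and W: "fv.subspace W" "\<And>u p. p \<in> nich \<Longrightarrow> H u p \<in> W" and p: "p \<in> nich"
  shows "F p \<in> W"
proof -
  have "F (component (\<lambda>w. deg w = deg u) p) = H u (component (\<lambda>w. deg w = deg u) p)" for u p
  proof (rule lin_eqI[where F = "\<lambda>p. F (component _ p)"])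
    fix w show "F (component (\<lambda>w. deg w = deg u) (basis_vec w)) = H u (component (\<lambda>w. deg w = deg u) (basis_vec w))"
      using H(2)[of w u] by (auto simp: component_def F(2) lin_0[OF F(1)] lin_0[OF H(1)])
  qed (intro lin_comp[OF F(1)] lin_comp[OF H(1)] lin_component)+
  moreover have "component (\<lambda>w. deg w = D) p \<in> nich" for D
    by (rule nich_component) (use p in auto)
  ultimately have "F (component (\<lambda>w. deg w = D) p) \<in> W" if "D \<in> deg ` keys p" for D
    using that W(2) by auto
  then show ?thesis
    by (subst degree_decomposition[of p]) (auto simp: lin_sum[OF F(1)] intro!: fv.subspace_sum[OF W(1)])
qed

lemma tbraid_tens: "lin_ext (tbraid c) (tens (basis_vec u) q) = tens (auts u q) (basis_vec u)"
  by (rule lin_eqI[where F = "\<lambda>q. lin_ext (tbraid c) (tens _ q)"])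
    (auto intro!: lin_intros simp: tbraid_eq)

lemma tens_basis_induct:
  assumes "fv.subspace W" "\<And>u. F (tens (basis_vec u) q) \<in> W" "lin F"
  shows "F (tens p q) \<in> W"
  by (induction p rule: fv_induct)
    (use assms in \<open>auto simp: lin_0 lin_scale lin_add intro: fv.subspace_0 fv.subspace_scale fv.subspace_add\<close>)

lemma tbraid_tens_kernel: "lin_ext (tbraid c) ` tens_kernel nich = tens_kernel nich"
proof -
  let ?B = "lin_ext (tbraid c)"
  \<comment> \<open>The inverse braiding. Equality of the image with the kernel, and not mere
    inclusion, requires that this map preserves the kernel too.\<close>
  define B' :: "('i list \<times> 'i list \<Rightarrow>\<^sub>0 'k) \<Rightarrow> ('i list \<times> 'i list \<Rightarrow>\<^sub>0 'k)"
    where "B' = lin_ext (\<lambda>(w, u). tens (basis_vec u) (auts' u (basis_vec w)))"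
  have lin_B': "lin B'"
    by (simp add: B'_def linear_lin_ext)
  have B'_tens: "B' (tens q (basis_vec u)) = tens (basis_vec u) (auts' u q)" for q u
    by (rule lin_eqI[where F = "\<lambda>q. B' (tens q _)"])
      (auto intro!: lin_comp[OF lin_B'] lin_intros simp: B'_def)
  have 1: "?B P \<in> tens_kernel nich" if "P \<in> tens_kernel nich" for P
  proof (rule tens_kernel_mapI[OF linear_lin_ext tens_kernel_subspace _ _ that])
    show "?B (tens p q) \<in> tens_kernel nich" if "p \<in> nich" for p q
      by (rule homogeneous_action[where F = "\<lambda>p. ?B (tens p q)" and H = "\<lambda>u. tens (auts u q)", OF _ _ _ _ tens_kernel_subspace])
        (auto intro!: lin_intros tens_kernel_right that simp: tbraid_tens dest: auts_cong)
    show "?B (tens p q) \<in> tens_kernel nich" if "q \<in> nich" for p q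
      by (rule tens_basis_induct[OF tens_kernel_subspace _ linear_lin_ext])
        (simp add: tbraid_tens tens_kernel_left nich_auts that)
  qed
  have 2: "B' P \<in> tens_kernel nich" if "P \<in> tens_kernel nich" for P
  proof (rule tens_kernel_mapI[OF lin_B' tens_kernel_subspace _ _ that])
    show "B' (tens q p) \<in> tens_kernel nich" if "p \<in> nich" for p q
      by (rule homogeneous_action[where F = "\<lambda>p. B' (tens q p)" and H = "\<lambda>u p. tens p (auts' u q)", OF _ _ _ _ tens_kernel_subspace])
        (auto intro!: lin_comp[OF lin_B'] lin_intros tens_kernel_left that simp: B'_tens fun_eq_iff intro: arg_cong[OF auts'_cong])
    show "B' (tens p q) \<in> tens_kernel nich" if "p \<in> nich" for p q
    proof (induction q rule: fv_induct)
      case (basis r u)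
      have "B' (tens p (basis_vec u)) \<in> tens_kernel nich"
        by (simp add: B'_tens tens_kernel_right nich_auts' that)
      then show ?case
        by (simp add: lin_scale[OF lin_B'] fv.subspace_scale[OF tens_kernel_subspace])
    qed (simp_all add: lin_0[OF lin_B'] lin_add[OF lin_B'] fv.subspace_0[OF tens_kernel_subspace]
        fv.subspace_add[OF tens_kernel_subspace])
  qed
  have "?B (B' P) = P" for P
  proof (rule lin_eqI[where F = "\<lambda>P. ?B (B' P)"])
    fix b show "?B (B' (basis_vec b)) = basis_vec b"
      by (cases b) (simp add: B'_def tbraid_tens)
  qed (auto intro!: lin_intros lin_B')
  then show ?thesis
    using 1 2 by (metis image_eqI subsetI subset_antisym image_subsetI)
qed

subsection \<open>The ideal of relations of the Nichols algebra\<close>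

lemma braided_hopf_ideal_nich: "braided_hopf_ideal c nich"
  unfolding braided_hopf_ideal_def
proof (intro conjI exI[of _ antipode])
  show "\<forall>p. convolution c antipode id p - fv_scale (tcounit p) tone \<in> nich \<and>
      convolution c id antipode p - fv_scale (tcounit p) tone \<in> nich"
    by (simp add: convolution_eq id_def mulmap_antipode_left mulmap_antipode_right tone_eq)
qed (auto simp: subspace_nich tmul_eq nich_mult nich_tcounit tcomul_nich tbraid_tens_kernel antipode_nich)

lemma tcomp_eq: "tcomp n = component (\<lambda>w. length w = n)"
  by (simp add: tcomp_def component_def)

lemma pr_tcomp: "pr w (tcomp n p) = (if length w = n then pr w p else 0)"
  unfolding tcomp_eq by (rule pr_component) (auto dest: deg_eq_length)

lemma nich_tcomp: "p \<in> nich \<Longrightarrow> tcomp n p \<in> nich"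
  unfolding tcomp_eq by (rule nich_component) (auto dest: deg_eq_length)

lemma tcomp_tdeg: "tcomp n (p :: ('i, 'k) tensor_alg) \<in> tdeg n"
  by (auto simp: tdeg_def tcomp_eq in_keys_iff lookup_component split: if_splits)

lemma nich_tdeg_0: "nich \<inter> tdeg 0 = {0}"
proof -
  have "p = 0" if p: "p \<in> nich" "p \<in> tdeg 0" for p
  proof (rule poly_mapping_eqI)
    fix w show "lookup p w = lookup 0 w"
      using p(2) nich_tcounit[OF p(1)] by (cases "w = []") (auto simp: tdeg_def tcounit_def in_keys_iff)
  qed
  then show ?thesis
    by (auto simp: tdeg_def)
qed

lemma nich_tdeg_1: "nich \<inter> tdeg 1 = {0}"
proof -
  have "p = 0" if p: "p \<in> nich" "p \<in> tdeg 1" for p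
  proof (rule poly_mapping_eqI)
    fix w show "lookup p w = lookup 0 w"
    proof (cases "length w = 1")
      case True
      then obtain i where "w = [i]"
        by (auto simp: length_Suc_conv)
      then show ?thesis
        using nichD[OF p(1), of "[i]"] lookup_single_letter[of p i] by simp
    qed (use p(2) in \<open>auto simp: tdeg_def in_keys_iff\<close>)
  qed
  then show ?thesis
    by (auto simp: tdeg_def)
qed

lemma slice_tens_kernel:
  assumes "functional \<phi>" "\<And>q. q \<in> U \<Longrightarrow> \<phi> q = 0" "fv.subspace U" "P \<in> tens_kernel U"
  shows "slice \<phi> P \<in> U"
  by (rule tens_kernel_mapI[OF lin_slice assms(3) _ _ assms(4)])
    (simp_all add: slice_tens assms fv.subspace_scale[OF assms(3)] fv.subspace_0[OF assms(3)])

lemma pr_one: "pr w 1 = (if w = [] then 1 else 0)"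
proof (cases w)
  case (Cons i v)
  show ?thesis
    unfolding Cons by simp
qed simp

lemma tcomul_tdeg_1:
  assumes "v \<in> tdeg 1"
  shows "tcomul c v = tens v 1 + tens 1 v"
proof -
  have "v = tcomp 1 v"
    using assms by (intro poly_mapping_eqI) (auto simp: tcomp_eq lookup_component tdeg_def in_keys_iff)
  moreover have "tcomul c (tcomp 1 p) = tens (tcomp 1 p) 1 + tens 1 (tcomp 1 p)" for p
  proof (induction p rule: fv_induct)
    case (basis r w)
    show ?case
    proof (cases "length w = 1")
      case True
      then obtain i where w: "w = [i]"
        by (auto simp: length_Suc_conv)
      have "tcomul c (basis_vec [i] * 1) = tens (basis_vec [i]) 1 + tens 1 (basis_vec [i])"
        by (subst tcomul_letter_mult) (simp add: tmap_tens)
      then show ?thesis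
        by (simp add: w tcomp_def fv.scale_right_distrib)
    qed (simp add: tcomp_def)
  qed (simp_all add: tcomp_def algebra_simps)
  ultimately show ?thesis
    by metis
qed

text \<open>For p primitive modulo the relations, \<open>pr (v @ w) p\<close> vanishes when both v
  and w are nonempty, and the counit of p equals its own double. Only words of length one then pair
  nontrivially with p, so p is congruent to its component of degree one.\<close>

lemma primitive_nich:
  "tcomul c p - (tens p tone + tens tone p) \<in> tens_kernel nich \<longleftrightarrow> (\<exists>v\<in>tdeg 1. p - v \<in> nich)"
proof
  assume P: "tcomul c p - (tens p tone + tens tone p) \<in> tens_kernel nich"
  have *: "pr (v @ w) p = pr v 1 * pr w p + pr v p * pr w 1" for v w
  proof -
    have "slice (pr v) (tcomul c p - (tens p tone + tens tone p)) \<in> nich"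
      by (rule slice_tens_kernel) (auto simp: P subspace_nich nichD)
    from nichD[OF this, of w] show ?thesis
      by (simp add: slice_tens pr_tcomul tone_eq mult.commute)
  qed
  have "pr u p = 0" if "length u \<noteq> 1" for u
  proof (cases u)
    case Nil
    have "tcounit p = tcounit p + tcounit p"
      using *[of "[]" "[]"] by (simp only: append_Nil pr.simps tcounit_one mult_1_left mult_1_right)
    then have "tcounit p = 0"
      by (metis add_cancel_right_right)
    then show ?thesis
      by (simp add: Nil)
  next
    case (Cons x w)
    then show ?thesis
      using *[of "[x]" w] that by (simp add: pr_one)
  qed
  then have "pr w (p - tcomp 1 p) = 0" for w
    unfolding pr_diff pr_tcomp by (cases "length w = 1") auto
  then have "p - tcomp 1 p \<in> nich"
    unfolding nich_def by blast
  then show "\<exists>v\<in>tdeg 1. p - v \<in> nich"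
    using tcomp_tdeg by blast
next
  assume "\<exists>v\<in>tdeg 1. p - v \<in> nich"
  then obtain v where v: "v \<in> tdeg 1" "p - v \<in> nich" by blast
  have "tcomul c p - (tens p tone + tens tone p) =
      tcomul c (p - v) - (tens (p - v) 1 + tens 1 (p - v))"
    using tcomul_tdeg_1[OF v(1)] by (simp add: tone_eq tens_diff_left tens_diff_right)
  also have "\<dots> \<in> tens_kernel nich"
    by (intro fv.subspace_diff[OF tens_kernel_subspace] fv.subspace_add[OF tens_kernel_subspace]
        tens_kernel_left tens_kernel_right tcomul_nich v)
  finally show "tcomul c p - (tens p tone + tens tone p) \<in> tens_kernel nich" .
qed

lemma nichols_relations_nich: "nichols_relations c nich"
  unfolding nichols_relations_def
  using braided_hopf_ideal_nich nich_tcomp nich_tdeg_0 nich_tdeg_1 primitive_nich by blast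

section \<open>Uniqueness of the ideal of relations\<close>

lemma slice_letter_tcomul: "slice (pr [i]) (tcomul c p) = der i p"
proof -
  have "pr [i] = (\<lambda>q. tcounit (der i q))"
    by (simp add: fun_eq_iff)
  then have "slice (pr [i]) P = slice tcounit (tmap (\<lambda>p. p) (der i) P)" for P :: "'i list \<times> 'i list \<Rightarrow>\<^sub>0 'k"
    by (simp add: slice_tmap functional_def)
  then show ?thesis
    by (simp only: tcomul_der tcomul_counit)
qed

text \<open>J has no part of degree one, so each \<open>pr [i]\<close> vanishes on it. Contracting
  the coproduct with \<open>pr [i]\<close> then shows that J is closed under \<open>der i\<close>,
  and coinduction applies.\<close>

lemma nichols_relations_subset:
  assumes J: "nichols_relations c J"
  shows "J \<subseteq> nich"
proof
  fix p assume p: "p \<in> J"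
  have hopf: "braided_hopf_ideal c J" and graded: "\<And>p n. p \<in> J \<Longrightarrow> tcomp n p \<in> J" and deg1: "J \<inter> tdeg 1 = {0}"
    using J by (auto simp: nichols_relations_def)
  have sub: "fv.subspace J" and counit: "\<And>p. p \<in> J \<Longrightarrow> tcounit p = 0"
    and comul: "\<And>p. p \<in> J \<Longrightarrow> tcomul c p \<in> tens_kernel J"
    using hopf by (auto simp: braided_hopf_ideal_def)
  have "pr [i] q = 0" if "q \<in> J" for q i
  proof -
    have "tcomp 1 q = 0"
      using graded[OF that] tcomp_tdeg deg1 by blast
    then show ?thesis
      using pr_tcomp[of "[i]" 1 q] by (simp del: pr.simps)
  qed
  then have "slice (pr [i]) (tcomul c p) \<in> J" if "p \<in> J" for p i
    by (intro slice_tens_kernel sub comul that functional_pr)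
  then show "p \<in> nich"
    by (intro nich_coinduct[OF p counit]) (auto simp: slice_letter_tcomul intro!: fv.span_base)
qed

lemma keys_tcomul: "(u, v) \<in> keys (tcomul c (basis_vec w)) \<Longrightarrow> length u + length v = length w"
proof (induction w arbitrary: u v)
  case Nil
  have "keys (1 :: ('i, 'k) tensor_alg) = {[]}"
    unfolding basis_vec_Nil[symmetric] by (rule keys_basis_vec)
  then show ?case
    using Nil unfolding basis_vec_Nil tcomul_one by (auto dest!: keys_tens)
next
  case (Cons x w)
  let ?Q = "tcomul c (basis_vec w)"
  have "(u, v) \<in> keys (tmap ((*) (basis_vec [x])) (\<lambda>q. q) ?Q + tmap (aut x) ((*) (basis_vec [x])) ?Q)"
    using Cons.prems unfolding basis_vec_Cons[of x w] tcomul_letter_mult .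
  from subsetD[OF keys_add this] consider "(u, v) \<in> keys (tmap ((*) (basis_vec [x])) (\<lambda>q. q) ?Q)"
    | "(u, v) \<in> keys (tmap (aut x) ((*) (basis_vec [x])) ?Q)"
    by blast
  then show ?case
  proof cases
    case 1
    from keys_tmap[OF this] obtain u' v' where *: "(u', v') \<in> keys ?Q"
      "u \<in> keys (basis_vec [x] * basis_vec u' :: ('i, 'k) tensor_alg)"
      "v \<in> keys (basis_vec v' :: ('i, 'k) tensor_alg)"
      by blast
    then have "u = x # u'" "v = v'"
      by (simp_all add: basis_vec_append[symmetric])
    then show ?thesis
      using Cons.IH[OF *(1)] by simp
  next
    case 2
    from keys_tmap[OF this] obtain u' v' where *: "(u', v') \<in> keys ?Q"
      "u \<in> keys (aut x (basis_vec u'))"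
      "v \<in> keys (basis_vec [x] * basis_vec v' :: ('i, 'k) tensor_alg)"
      by blast
    then have "v = x # v'"
      by (simp add: basis_vec_append[symmetric])
    then show ?thesis
      using Cons.IH[OF *(1)] deg_eq_length[OF keys_aut_word[OF *(2)[unfolded aut_basis]]] by simp
  qed
qed

definition proj0 :: "('i, 'k) tensor_alg \<Rightarrow> ('i, 'k) tensor_alg"
  where "proj0 p = fv_scale (tcounit p) 1"

lemma lin_proj0 [simp]: "lin proj0"
  by (rule linI) (simp_all add: proj0_def fv.scale_left_distrib)

lemma tcomul_proj0: "tmap proj0 (\<lambda>q. q) (tcomul c p) = tens 1 p" "tmap (\<lambda>q. q) proj0 (tcomul c p) = tens p 1"
proof (induction p rule: tensor_induct)
  case (letter x p)
  have [simp]: "proj0 (basis_vec [x] * q) = 0" "proj0 (aut x q) = proj0 q" for q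
    by (simp_all add: proj0_def tcounit_basis)
  have "tmap proj0 ((*) (basis_vec [x])) P = tmap (\<lambda>q. q) ((*) (basis_vec [x])) (tmap proj0 (\<lambda>q. q) P)"
    "tmap ((*) (basis_vec [x])) proj0 P = tmap ((*) (basis_vec [x])) (\<lambda>q. q) (tmap (\<lambda>q. q) proj0 P)" for P
    by (simp_all add: tmap_tmap)
  then have "tmap proj0 ((*) (basis_vec [x])) (tcomul c p) = tens 1 (basis_vec [x] * p)"
    "tmap ((*) (basis_vec [x])) proj0 (tcomul c p) = tens (basis_vec [x] * p) 1"
    by (simp_all only: letter) (simp_all add: tmap_tens)
  then show "tmap proj0 (\<lambda>q. q) (tcomul c (basis_vec [x] * p)) = tens 1 (basis_vec [x] * p)"
    "tmap (\<lambda>q. q) proj0 (tcomul c (basis_vec [x] * p)) = tens (basis_vec [x] * p) 1"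
    by (simp_all add: tcomul_letter_mult tmap_tmap tmap_zero_left tmap_zero_right)
qed (simp_all add: tmap_tens proj0_def)

text \<open>The subtracted terms are the parts of the coproduct with an empty factor. In what
  remains both factors have length below n, so truncation fixes it.\<close>

lemma tcomul_decomposition:
  assumes p: "p \<in> tdeg n" and n: "n > 0"
  defines "T \<equiv> component (\<lambda>w. length w < n)"
  shows "tcomul c p - (tens p 1 + tens 1 p) = tmap T T (tcomul c p - (tens p 1 + tens 1 p))"
proof -
  have lin_T: "lin T"
    by (simp add: T_def lin_component)
  have *: "P = tmap T T P + tmap (\<lambda>q. q) proj0 P + tmap proj0 (\<lambda>q. q) P"
    if P: "\<And>u v. (u, v) \<in> keys P \<Longrightarrow> length u + length v = n" for P
  proof -
    define F where "F P = tmap T T P + tmap (\<lambda>q. q) proj0 P + tmap proj0 (\<lambda>q. q) P" for P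
    have lin_F: "lin F"
      unfolding F_def by (intro lin_plus lin_tmap)
    have "P = lin_ext basis_vec P"
      by (rule lin_eqI[where F = "\<lambda>v. v"]) (auto intro!: lin_intros)
    then have e: "P = (\<Sum>b\<in>keys P. fv_scale (lookup P b) (basis_vec b))"
      by (simp add: lin_ext_def)
    have "F (basis_vec b) = basis_vec b" if "b \<in> keys P" for b
    proof -
      obtain u v where b: "b = (u, v)" by fastforce
      then have "length u + length v = n"
        using P that by blast
      then show ?thesis
        using n unfolding F_def b tens_basis_vec[symmetric] tmap_tens[OF lin_T lin_T]
          tmap_tens[OF lin_proj0 lin_times(3)] tmap_tens[OF lin_times(3) lin_proj0]
        by (cases "u = []"; cases "v = []") (auto simp: T_def component_def proj0_def tcounit_basis basis_vec_Nil)
    qed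
    then have "F (\<Sum>b\<in>keys P. fv_scale (lookup P b) (basis_vec b)) =
        (\<Sum>b\<in>keys P. fv_scale (lookup P b) (basis_vec b))"
      by (simp only: lin_sum[OF lin_F] lin_scale[OF lin_F] cong: sum.cong)
    then have "F P = P"
      unfolding e[symmetric] .
    then show ?thesis
      by (simp add: F_def)
  qed
  have "length u + length v = n" if uv: "(u, v) \<in> keys (tcomul c p)" for u v
  proof -
    obtain w where "w \<in> keys p" "(u, v) \<in> keys (tcomul c (basis_vec w))"
      using keys_lin_ext[OF uv[unfolded tcomul_def]] by (auto simp: tcomul_def)
    then show ?thesis
      using keys_tcomul p by (fastforce simp: tdeg_def)
  qed
  from *[of "tcomul c p", OF this] have 1: "tcomul c p - (tens p 1 + tens 1 p) = tmap T T (tcomul c p)"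
    by (simp add: tcomul_proj0 algebra_simps)
  have "T p = 0"
    using p by (intro poly_mapping_eqI) (auto simp: T_def lookup_component tdeg_def in_keys_iff)
  then have "tmap T T (tens p 1 + tens 1 p) = 0"
    by (simp add: tmap_tens[OF lin_T lin_T])
  then show ?thesis
    by (subst 1) simp
qed

lemma sum_tcomp: 
  assumes "finite A" "\<And>w. w \<in> keys p \<Longrightarrow> P w \<longleftrightarrow> length w \<in> A"
  shows "component P p = (\<Sum>k\<in>A. tcomp k p)"
  by (rule poly_mapping_eqI) (use assms in \<open>auto simp: lookup_component lookup_sum tcomp_eq in_keys_iff\<close>)

text \<open>The missing inclusion is an induction on the degree of p. The truncated coproduct
  involves only degrees in which the relations are already known to lie in J, so p is primitive
  modulo J and congruent to some v of degree one; this v lies in \<open>nich\<close> and is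
  therefore 0.\<close>

lemma nichols_relations_unique:
  assumes J: "nichols_relations c J"
  shows "J = nich"
proof (rule subset_antisym)
  show le: "J \<subseteq> nich"
    by (rule nichols_relations_subset[OF J])
  have sub: "fv.subspace J"
    using J by (auto simp: nichols_relations_def braided_hopf_ideal_def)
  have tdeg: "p \<in> nich \<Longrightarrow> p \<in> tdeg n \<Longrightarrow> p \<in> J" for n p
  proof (induction n arbitrary: p rule: less_induct)
    case (less n)
    show ?case
    proof (cases "n = 0")
      case True
      then have "p \<in> nich \<inter> tdeg 0"
        using less.prems by simp
      then have "p = 0"
        unfolding nich_tdeg_0 by simp
      then show ?thesis
        using fv.subspace_0[OF sub] by simp
    next
      case False
      let ?T = "component (\<lambda>w. length w < n)"
      have T: "?T q \<in> J" if "q \<in> nich" for q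
      proof -
        have "?T q = (\<Sum>k<n. tcomp k q)"
          by (rule sum_tcomp) auto
        also have "\<dots> \<in> J"
          by (intro fv.subspace_sum[OF sub] less.IH[OF _ nich_tcomp[OF that] tcomp_tdeg]) simp
        finally show ?thesis .
      qed
      let ?P = "tcomul c p - (tens p 1 + tens 1 p)"
      have "?P \<in> tens_kernel nich"
        by (intro fv.subspace_diff[OF tens_kernel_subspace] fv.subspace_add[OF tens_kernel_subspace]
            tens_kernel_left tens_kernel_right tcomul_nich less.prems)
      then have "tmap ?T ?T ?P \<in> tens_kernel J"
        by (rule tens_kernel_mapI[OF lin_tmap tens_kernel_subspace, rotated -1])
          (simp_all add: tmap_tens lin_component T tens_kernel_left tens_kernel_right)
      then have "tcomul c p - (tens p tone + tens tone p) \<in> tens_kernel J"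
        unfolding tone_eq using tcomul_decomposition[OF less.prems(2)] False by (metis neq0_conv)
      then obtain v where v: "v \<in> tdeg 1" "p - v \<in> J"
        using J unfolding nichols_relations_def by blast
      then have "v \<in> nich"
        using le nich_diff[OF less.prems(1), of "p - v"] by auto
      then have "v = 0"
        using v(1) nich_tdeg_1 by blast
      then show ?thesis
        using v(2) by simp
    qed
  qed
  show "nich \<subseteq> J"
  proof
    fix p assume p: "p \<in> nich"
    have "component (\<lambda>w. True) p = (\<Sum>k\<in>length ` keys p. tcomp k p)"
      by (rule sum_tcomp) auto
    moreover have "component (\<lambda>w. True) p = p"
      by (rule poly_mapping_eqI) (simp add: lookup_component)
    moreover have "(\<Sum>k\<in>length ` keys p. tcomp k p) \<in> J"
      by (intro fv.subspace_sum[OF sub] tdeg[OF nich_tcomp[OF p] tcomp_tdeg])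
    ultimately show "p \<in> J"
      by simp
  qed
qed

theorem nichols_ideal_eq: "nichols_ideal c = nich"
  unfolding nichols_ideal_def
  using nichols_relations_nich nichols_relations_unique by (rule the_equality)

end

section \<open>Congruence modulo the relations\<close>

context group_braiding
begin

definition eqv :: "('i, 'k) tensor_alg \<Rightarrow> ('i, 'k) tensor_alg \<Rightarrow> bool" (infix "\<approx>" 50)
  where "p \<approx> q \<longleftrightarrow> p - q \<in> nich"

lemma eqv_refl [simp]: "p \<approx> p"
  by (simp add: eqv_def)

lemma eqv_sym: "p \<approx> q \<Longrightarrow> q \<approx> p"
  unfolding eqv_def using nich_minus by fastforce

lemma eqv_trans [trans]: "p \<approx> q \<Longrightarrow> q \<approx> r \<Longrightarrow> p \<approx> r"
  unfolding eqv_def using nich_add by fastforce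

lemma eqv_0_iff: "p \<approx> 0 \<longleftrightarrow> p \<in> nich"
  by (simp add: eqv_def)

lemma eqv_add: "p \<approx> q \<Longrightarrow> p' \<approx> q' \<Longrightarrow> p + p' \<approx> q + q'"
  unfolding eqv_def using nich_add by (fastforce simp: algebra_simps)

lemma eqv_scale: "p \<approx> q \<Longrightarrow> fv_scale r p \<approx> fv_scale r q"
  unfolding eqv_def by (metis fv.scale_right_diff_distrib nich_scale)

lemma eqv_left: "p \<approx> q \<Longrightarrow> r * p \<approx> r * q"
  unfolding eqv_def by (metis nich_mult(2) right_diff_distrib)

lemma eqv_right: "p \<approx> q \<Longrightarrow> p * r \<approx> q * r"
  unfolding eqv_def by (metis nich_mult(1) left_diff_distrib)

lemma eqv_mult: "p \<approx> q \<Longrightarrow> p' \<approx> q' \<Longrightarrow> p * p' \<approx> q * q'"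
  by (meson eqv_left eqv_right eqv_trans)

lemma eqv_sum: "(\<And>x. x \<in> A \<Longrightarrow> h x \<approx> h' x) \<Longrightarrow> sum h A \<approx> sum h' A"
  unfolding eqv_def sum_subtractf[symmetric] by (rule nich_sum)

lemma eqv_nich: "p \<approx> q \<Longrightarrow> p \<in> nich \<longleftrightarrow> q \<in> nich"
  by (meson eqv_0_iff eqv_sym eqv_trans)

lemma eqvI_der:
  assumes "tcounit p = tcounit q" "\<And>i. der i p \<approx> der i q"
  shows "p \<approx> q"
  unfolding eqv_def
proof (rule nichI)
  show "der i (p - q) \<in> nich" for i
    using assms(2)[of i] by (simp add: eqv_def)
qed (simp add: assms(1))

end

section \<open>Relations in the Nichols algebra of the braided vector space\<close>

fun gL :: "'k::field \<Rightarrow> 'k \<Rightarrow> 'k \<Rightarrow> idx \<Rightarrow> idx \<Rightarrow> (idx \<Rightarrow>\<^sub>0 'k)"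
  where
    "gL wp q a X3 X1 = fv_scale (inverse wp) (basis_vec X1)"
  | "gL wp q a X3 X2 = fv_scale (inverse wp) (basis_vec X2 + fv_scale a (basis_vec X1))"
  | "gL wp q a X3 X3 = fv_scale q (basis_vec X3)"
  | "gL wp q a i X1 = basis_vec X1"
  | "gL wp q a i X2 = basis_vec X2 + basis_vec X1"
  | "gL wp q a i X3 = fv_scale wp (basis_vec X3)"

fun gL' :: "'k::field \<Rightarrow> 'k \<Rightarrow> 'k \<Rightarrow> idx \<Rightarrow> idx \<Rightarrow> (idx \<Rightarrow>\<^sub>0 'k)"
  where
    "gL' wp q a X3 X1 = fv_scale wp (basis_vec X1)"
  | "gL' wp q a X3 X2 = fv_scale wp (basis_vec X2 - fv_scale a (basis_vec X1))"
  | "gL' wp q a X3 X3 = fv_scale (inverse q) (basis_vec X3)"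
  | "gL' wp q a i X1 = basis_vec X1"
  | "gL' wp q a i X2 = basis_vec X2 - basis_vec X1"
  | "gL' wp q a i X3 = fv_scale (inverse wp) (basis_vec X3)"

text \<open>The diagonal braiding of the elements \<open>(ad x2)^i x3\<close>.\<close>

definition dg :: "'k::field \<Rightarrow> 'k \<Rightarrow> nat \<Rightarrow> nat \<Rightarrow> (nat \<Rightarrow>\<^sub>0 'k)"
  where "dg wp q i j = fv_scale (q * wp ^ i * inverse wp ^ j) (basis_vec j)"

lemma UNIV_idx: "(UNIV :: idx set) = {X1, X2, X3}"
  using idx.exhaust by blast

lemma finite_idx [simp]: "finite (A :: idx set)"
  by (metis UNIV_idx finite.emptyI finite.insertI finite_subset subset_UNIV)

lemma gL_degree: "l \<in> keys (gL wp q a i j) \<Longrightarrow> gL wp q a l = gL wp q a j"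
  and gL'_degree: "l \<in> keys (gL' wp q a i j) \<Longrightarrow> gL wp q a l = gL wp q a j"
proof -
  have 12: "gL wp q a X1 = gL wp q a X2"
  proof
    fix j show "gL wp q a X1 j = gL wp q a X2 j"
      by (cases j) auto
  qed
  show "l \<in> keys (gL wp q a i j) \<Longrightarrow> gL wp q a l = gL wp q a j"
    by (cases i; cases j; cases l) (auto simp: in_keys_iff lookup_add lookup_basis_vec 12)
  show "l \<in> keys (gL' wp q a i j) \<Longrightarrow> gL wp q a l = gL wp q a j"
    by (cases i; cases j; cases l) (auto simp: in_keys_iff lookup_minus lookup_basis_vec 12)
qed

locale laistrygon =
  fixes wp q a :: "'k::field"
  assumes char2: "(1::'k) + 1 = 0" and wp: "wp \<noteq> 0" and q: "q \<noteq> 0" and a: "a \<noteq> 0"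

sublocale laistrygon \<subseteq> L: group_braided "gL wp q a" "gL' wp q a" "frakL wp q a"
proof
  fix i j l :: idx
  show "lin_ext (gL wp q a i) (gL wp q a j l) = lin_ext (gL wp q a j) (gL wp q a i l)"
    by (cases i; cases j; cases l) (auto simp: fv.scale_right_distrib algebra_simps)
  show "lin_ext (gL wp q a i) (gL' wp q a i j) = basis_vec j"
    by (cases i; cases j) (auto simp: fv.scale_right_distrib fv.scale_right_diff_distrib wp q)
  show "lin_ext (gL' wp q a i) (gL wp q a i j) = basis_vec j"
    by (cases i; cases j) (auto simp: fv.scale_right_distrib fv.scale_right_diff_distrib wp q)
  show "l \<in> keys (gL wp q a i j) \<Longrightarrow> gL wp q a l = gL wp q a j"
    by (rule gL_degree)
  show "l \<in> keys (gL' wp q a i j) \<Longrightarrow> gL wp q a l = gL wp q a j"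
    by (rule gL'_degree)
  show "frakL wp q a (i, j) = tens (gL wp q a i j) (basis_vec i)"
    by (cases i; cases j) (auto simp: fv.scale_right_distrib)
qed simp_all

text \<open>The alphabet is all of \<open>nat\<close>, so that moving \<open>x2\<close> past a
  letter, which raises its index, stays within the alphabet (\<open>x2_psi\<close>). Letters with
  \<open>mu n = 0\<close> are eliminated later by \<open>z_nich\<close>.\<close>

sublocale laistrygon \<subseteq> D: group_braiding "dg wp q" "\<lambda>i j. fv_scale (inverse (q * wp ^ i * inverse wp ^ j)) (basis_vec j)"
proof
  have keys: "keys (fv_scale r (basis_vec j) :: nat \<Rightarrow>\<^sub>0 'k) \<subseteq> {j}" for r j
    by (auto simp: in_keys_iff lookup_basis_vec split: if_splits)
  fix i j l :: nat
  show "finite {l. i \<in> keys (dg wp q j l)}"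
    by (rule finite_subset[of _ "{i}"]) (use keys in \<open>auto simp: dg_def\<close>)
  show "finite {l. i \<in> keys (fv_scale (inverse (q * wp ^ j * inverse wp ^ l)) (basis_vec l) :: nat \<Rightarrow>\<^sub>0 'k)}"
    by (rule finite_subset[of _ "{i}"]) (use keys in blast)+
  show "l \<in> keys (dg wp q i j) \<Longrightarrow> dg wp q l = dg wp q j"
    using keys by (auto simp: dg_def)
  show "l \<in> keys (fv_scale (inverse (q * wp ^ i * inverse wp ^ j)) (basis_vec j) :: nat \<Rightarrow>\<^sub>0 'k) \<Longrightarrow> dg wp q l = dg wp q j"
    using keys by blast
qed (auto simp: dg_def wp q field_simps)

context laistrygon
begin

abbreviation eqvL (infix "\<approx>" 50) where "eqvL \<equiv> L.eqv"
abbreviation "x1 \<equiv> basis_vec [X1] :: (idx, 'k) tensor_alg"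
abbreviation "x2 \<equiv> basis_vec [X2] :: (idx, 'k) tensor_alg"
abbreviation "x3 \<equiv> basis_vec [X3] :: (idx, 'k) tensor_alg"

lemma double: "p + p = (0 :: 'b \<Rightarrow>\<^sub>0 'k)"
proof -
  have "p + p = fv_scale (1 + 1) p"
    by (simp only: fv.scale_left_distrib fv.scale_one)
  then show ?thesis
    by (simp only: char2 fv.scale_zero_left)
qed

lemma double_left: "p + (p + r) = (r :: 'b \<Rightarrow>\<^sub>0 'k)"
  by (simp add: double flip: add.assoc)

lemma uminus_eq: "- p = (p :: 'b \<Rightarrow>\<^sub>0 'k)"
  using double[of p] by (simp add: minus_unique)

lemma minus_eq: "p - r = (p + r :: 'b \<Rightarrow>\<^sub>0 'k)"
  using uminus_eq[of r] by (metis diff_conv_add_uminus)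

lemmas char2_simps = double double_left uminus_eq minus_eq

lemma autL [simp]:
  "L.aut X1 x1 = x1" "L.aut X1 x2 = x2 + x1" "L.aut X1 x3 = fv_scale wp x3"
  "L.aut X3 x1 = fv_scale (inverse wp) x1" "L.aut X3 x2 = fv_scale (inverse wp) (x2 + fv_scale a x1)"
  "L.aut X3 x3 = fv_scale q x3"
  by (simp_all add: L.aut_letter)

lemma autL2 [simp]: "L.aut X2 = L.aut X1"
  by (rule L.aut_cong) (use gL_degree[of X1 wp q a X1 X2] in \<open>auto simp: in_keys_iff lookup_add lookup_basis_vec\<close>)

lemmas L_simps = L.der_letter algebra_simps char2_simps fv.scale_right_distrib mult.assoc

section \<open>The subalgebra generated by x1 and x2\<close>

lemma x1_x1: "x1 * x1 \<approx> 0"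
proof (rule L.eqvI_der)
  fix i show "L.der i (x1 * x1) \<approx> L.der i 0"
    by (cases i) (simp_all add: L_simps)
qed (simp add: tcounit_basis)

definition x21 :: "(idx, 'k) tensor_alg"
  where "x21 = x2 * x1 + x1 * x2"

lemma x21_simps [simp]: "L.der X1 x21 = x1" "L.der X2 x21 = 0" "L.der X3 x21 = 0"
  "L.aut X1 x21 = x21" "L.aut X3 x21 = fv_scale (inverse wp * inverse wp) x21" "tcounit x21 = 0"
  by (simp_all add: x21_def L_simps tcounit_basis)

lemma x1_x21: "x1 * x21 \<approx> x21 * x1"
proof -
  have "x1 * x21 = x21 * x1 + (x1 * x1 * x2 + x2 * (x1 * x1))"
    by (simp add: x21_def L_simps)
  also have "\<dots> \<approx> x21 * x1 + (0 * x2 + x2 * 0)"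
    by (intro L.eqv_add L.eqv_refl L.eqv_left L.eqv_right x1_x1)
  finally show ?thesis by simp
qed

lemma x21_x2: "x21 * x2 \<approx> x2 * x21 + x21 * x1"
proof (rule L.eqvI_der)
  fix i show "L.der i (x21 * x2) \<approx> L.der i (x2 * x21 + x21 * x1)"
    by (cases i) (simp_all add: L_simps, simp_all add: x21_def L_simps)
qed (simp add: tcounit_basis)

lemma x21_x21: "x21 * x21 \<approx> 0"
proof (rule L.eqvI_der)
  fix i show "L.der i (x21 * x21) \<approx> L.der i 0"
  proof (cases i)
    case X1
    have "L.der X1 (x21 * x21) = x1 * x21 + x21 * x1"
      by (simp add: L_simps)
    also have "\<dots> \<approx> x21 * x1 + x21 * x1"
      by (intro L.eqv_add x1_x21 L.eqv_refl)
    finally show ?thesis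
      by (simp add: X1 char2_simps)
  qed (simp_all add: L_simps)
qed simp

lemma x2_x2_x2_x2: "x2 * x2 * (x2 * x2) \<approx> 0"
proof (rule L.eqvI_der)
  fix i show "L.der i (x2 * x2 * (x2 * x2)) \<approx> L.der i 0"
  proof (cases i)
    case X2
    have "L.der X2 (x2 * x2) = x1"
      by (simp add: L_simps)
    moreover have "L.aut X1 (x2 * x2) = x2 * x2 + x21 + x1 * x1"
      by (simp add: x21_def L_simps)
    ultimately have "L.der X2 (x2 * x2 * (x2 * x2)) = x2 * x2 * x1 + x1 * (x2 * x2 + x21 + x1 * x1)"
      by (simp only: L.der_mult autL2)
    also have "\<dots> = x21 * x2 + x2 * x21 + x1 * x21 + x1 * x1 * x1"
      by (simp add: x21_def L_simps)
    also have "\<dots> \<approx> (x2 * x21 + x21 * x1) + x2 * x21 + x21 * x1 + 0 * x1"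
      by (intro L.eqv_add L.eqv_refl L.eqv_right x1_x1 x21_x2 x1_x21)
    also have "\<dots> = 0"
      by (simp add: algebra_simps char2_simps)
    finally show ?thesis
      by (simp add: X2)
  qed (simp_all add: L.der_letter)
qed (simp add: tcounit_basis)

text \<open>The value 0 from 4 on encodes the end of the chain, so rules that mention
  \<open>f (Suc n)\<close> need no exception at \<open>n = 3\<close>.\<close>

definition f :: "nat \<Rightarrow> (idx, 'k) tensor_alg"
  where "f n = (if n = 0 then 1 else if n = 1 then x1 else if n = 2 then x21 else if n = 3 then x21 * x1 else 0)"

lemma f_simps [simp]: "f 0 = 1" "f (Suc 0) = x1" "f 2 = x21" "f 3 = x21 * x1" "n \<ge> 4 \<Longrightarrow> f n = 0"
  by (simp_all add: f_def)

lemma nat_cases4: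
  obtains "n = 0" | "n = Suc 0" | "n = 2" | "n = 3" | "(n::nat) \<ge> 4"
  by linarith

lemma f_x1: "f n * x1 \<approx> (if even n then f (Suc n) else 0)"
proof (cases n rule: nat_cases4)
  case 4
  have "f n * x1 = x21 * (x1 * x1)"
    by (simp add: 4 mult.assoc)
  also have "\<dots> \<approx> x21 * 0"
    by (intro L.eqv_left x1_x1)
  finally show ?thesis
    by (simp add: 4)
qed (auto simp: x1_x1 numeral_3_eq_3[symmetric] simp flip: numeral_2_eq_2)

lemma x1_f: "x1 * f n \<approx> f n * x1"
proof (cases n rule: nat_cases4)
  case 4
  have "x1 * f n = x1 * x21 * x1"
    by (simp add: 4 mult.assoc)
  also have "\<dots> \<approx> x21 * x1 * x1"
    by (intro L.eqv_right x1_x21)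
  finally show ?thesis
    by (simp add: 4)
qed (auto simp: x1_x21)

text \<open>Commuting with \<open>x2\<close> raises the index. The case n = 0 is excluded because
  \<open>f 0 = 1\<close> commutes with \<open>x2\<close> without producing
  \<open>x1\<close>.\<close>

lemma f_x2: "n > 0 \<Longrightarrow> f n * x2 \<approx> x2 * f n + f (Suc n)"
proof (cases n rule: nat_cases4)
  case 2
  then show ?thesis
    by (simp add: numeral_2_eq_2[symmetric]) (simp add: x21_def L_simps)
next
  case 3
  then show ?thesis
    using x21_x2 by (simp add: numeral_3_eq_3[symmetric])
next
  case 4
  have "f n * x2 = x21 * x2 * x1 + x21 * x21"
    by (simp add: 4 x21_def L_simps)
  also have "\<dots> \<approx> (x2 * x21 + x21 * x1) * x1 + 0"
    by (intro L.eqv_add L.eqv_right x21_x2 x21_x21)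
  also have "\<dots> = x2 * f n + x21 * (x1 * x1)"
    by (simp add: 4 algebra_simps)
  also have "\<dots> \<approx> x2 * f n + x21 * 0"
    by (intro L.eqv_add L.eqv_left L.eqv_refl x1_x1)
  finally show ?thesis
    by (simp add: 4)
qed auto

text \<open>The \<open>f n\<close> behave like divided powers for \<open>der X1\<close>, which later
  makes them independent over the elements killed by \<open>der X1\<close>.\<close>

lemma der_f: "L.der X1 (f n) \<approx> (if n = 0 \<or> n \<ge> 4 then 0 else f (n - 1))" "L.der X2 (f n) \<approx> 0" "L.der X3 (f n) \<approx> 0"
proof -
  have "x21 + x1 * x1 \<approx> x21 + 0"
    by (intro L.eqv_add L.eqv_refl x1_x1)
  then show "L.der X1 (f n) \<approx> (if n = 0 \<or> n \<ge> 4 then 0 else f (n - 1))"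
    by (cases n rule: nat_cases4) (auto simp: L_simps f_def)
  show "L.der X2 (f n) \<approx> 0" "L.der X3 (f n) \<approx> 0"
    by (cases n rule: nat_cases4; simp add: L_simps)+
qed

text \<open>The element \<open>z n\<close> is \<open>(ad x2)^n x3\<close>, written with a plus sign in characteristic 2; its derivative is \<open>mu n\<close> times \<open>f n\<close>.\<close>

definition mu :: "nat \<Rightarrow> 'k"
  where "mu n = (if n = 0 then 1 else if n = 1 \<or> n = 2 then a else if n = 3 then a * (1 + a) else 0)"

fun z :: "nat \<Rightarrow> (idx, 'k) tensor_alg"
  where
    "z 0 = x3"
  | "z (Suc n) = x2 * z n + fv_scale wp (z n * x2)"

lemma tcounit_z [simp]: "tcounit (z n) = 0"
  by (cases n) (simp_all add: tcounit_basis)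

text \<open>The origin of \<open>mu\<close>. For n = 0 the two copies of \<open>x2\<close> cancel
  and leave \<open>a\<close> times \<open>x1\<close>; for n = 2 the term \<open>f 2 * x1\<close> is
  again \<open>f 3\<close> and contributes the factor \<open>1 + a\<close>; for n = 1 and n = 3 the
  product with \<open>x1\<close> vanishes.\<close>

lemma der3_step:
  "x2 * fv_scale (mu n) (f n) + fv_scale (mu n) (f n) * (x2 + fv_scale a x1) \<approx> fv_scale (mu (Suc n)) (f (Suc n))"
proof -
  have step: "x2 * fv_scale (mu n) (f n) + fv_scale (mu n) (f n) * (x2 + fv_scale a x1) \<approx>
      fv_scale (mu n) (f (Suc n) + fv_scale a r)" if "n > 0" "f n * x1 \<approx> r" for r
  proof -
    have "x2 * fv_scale (mu n) (f n) + fv_scale (mu n) (f n) * (x2 + fv_scale a x1) =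
        fv_scale (mu n) (x2 * f n + f n * x2 + fv_scale a (f n * x1))"
      by (simp add: L_simps mult.commute)
    also have "\<dots> \<approx> fv_scale (mu n) (x2 * f n + (x2 * f n + f (Suc n)) + fv_scale a r)"
      by (intro L.eqv_add L.eqv_refl L.eqv_scale f_x2 that)
    finally show ?thesis
      by (simp add: double_left add.assoc)
  qed
  show ?thesis
  proof (cases n rule: nat_cases4)
    case 1
    then show ?thesis
      by (simp add: mu_def L_simps)
  next
    case 5
    then show ?thesis
      by (simp add: mu_def)
  next
    case 2
    have "fv_scale (mu n) (f (Suc n) + fv_scale a 0) = fv_scale (mu (Suc n)) (f (Suc n))"
      by (simp add: 2 mu_def)
    moreover have "f n * x1 \<approx> 0"
      using f_x1[of n] 2 by simp
    ultimately show ?thesis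
      using step[of 0] 2 by (metis zero_less_Suc zero_less_numeral)
  next
    case 3
    have "fv_scale (mu n) (f (Suc n) + fv_scale a (f (Suc n))) = fv_scale (mu (Suc n)) (f (Suc n))"
      by (simp add: 3 mu_def fv.scale_left_distrib fv.scale_right_distrib distrib_left)
    moreover have "f n * x1 \<approx> f (Suc n)"
      using f_x1[of n] 3 by simp
    ultimately show ?thesis
      using step[of "f (Suc n)"] 3 by (metis zero_less_Suc zero_less_numeral)
  next
    case 4
    have "fv_scale (mu n) (f (Suc n) + fv_scale a 0) = fv_scale (mu (Suc n)) (f (Suc n))"
      by (simp add: 4 mu_def)
    moreover have "f n * x1 \<approx> 0"
      using f_x1[of n] 4 by simp
    ultimately show ?thesis
      using step[of 0] 4 by (metis zero_less_Suc zero_less_numeral)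
  qed
qed

text \<open>The claims depend on each other. The automorphisms of \<open>z (Suc n)\<close> are
  diagonal only because \<open>x1\<close> commutes with \<open>z n\<close> up to \<open>wp\<close>;
  that relation is in turn checked by derivations, which need the derivatives and the automorphism
  of the same \<open>z n\<close>.\<close>

lemma z_properties:
  "L.aut X1 (z n) \<approx> fv_scale wp (z n) \<and> L.aut X3 (z n) \<approx> fv_scale (q * inverse wp ^ n) (z n) \<and>
   L.der X1 (z n) \<approx> 0 \<and> L.der X2 (z n) \<approx> 0 \<and> L.der X3 (z n) \<approx> fv_scale (mu n) (f n) \<and>
   x1 * z n \<approx> fv_scale wp (z n * x1)"
proof -
  have comm: "x1 * z n \<approx> fv_scale wp (z n * x1)"
    if g: "L.aut X1 (z n) \<approx> fv_scale wp (z n)"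
      and d: "L.der X1 (z n) \<approx> 0" "L.der X2 (z n) \<approx> 0" "L.der X3 (z n) \<approx> fv_scale (mu n) (f n)" for n
  proof (rule L.eqvI_der)
    fix i show "L.der i (x1 * z n) \<approx> L.der i (fv_scale wp (z n * x1))"
    proof (cases i)
      case X1
      have "L.der i (x1 * z n) = x1 * L.der X1 (z n) + L.aut X1 (z n)"
        by (simp add: X1 L.der_letter)
      also have "\<dots> \<approx> x1 * 0 + fv_scale wp (z n)"
        by (intro L.eqv_add L.eqv_left g d)
      also have "\<dots> = fv_scale wp (z n + 0 * x1)"
        by simp
      also have "\<dots> \<approx> fv_scale wp (z n + L.der X1 (z n) * x1)"
        by (intro L.eqv_scale L.eqv_add L.eqv_right L.eqv_refl L.eqv_sym[OF d(1)])
      finally show ?thesis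
        by (simp add: X1 L.der_letter)
    next
      case X2
      have "L.der i (x1 * z n) = x1 * L.der X2 (z n)"
        by (simp add: X2 L.der_letter)
      also have "\<dots> \<approx> x1 * 0"
        by (intro L.eqv_left d)
      also have "\<dots> = fv_scale wp (0 * x1)"
        by simp
      also have "\<dots> \<approx> fv_scale wp (L.der X2 (z n) * x1)"
        by (intro L.eqv_scale L.eqv_right L.eqv_sym[OF d(2)])
      finally show ?thesis
        by (simp add: X2 L.der_letter)
    next
      case X3
      have "L.der i (x1 * z n) = x1 * L.der X3 (z n)"
        by (simp add: X3 L.der_letter)
      also have "\<dots> \<approx> x1 * fv_scale (mu n) (f n)"
        by (intro L.eqv_left d)
      also have "\<dots> = fv_scale (mu n) (x1 * f n)"
        by simp
      also have "\<dots> \<approx> fv_scale (mu n) (f n * x1)"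
        by (intro L.eqv_scale x1_f)
      also have "\<dots> = fv_scale (mu n) (f n) * x1"
        by simp
      also have "\<dots> \<approx> L.der X3 (z n) * x1"
        by (intro L.eqv_right L.eqv_sym[OF d(3)])
      finally show ?thesis
        by (simp add: X3 L.der_letter wp)
    qed
  qed (simp add: tcounit_basis)
  show ?thesis
  proof (induction n)
    case 0
    have 0: "L.aut X1 (z 0) \<approx> fv_scale wp (z 0)" "L.aut X3 (z 0) \<approx> fv_scale (q * inverse wp ^ 0) (z 0)"
      "L.der X1 (z 0) \<approx> 0" "L.der X2 (z 0) \<approx> 0" "L.der X3 (z 0) \<approx> fv_scale (mu 0) (f 0)"
      by (simp_all add: L.der_letter mu_def)
    show ?case
      using 0 comm[OF 0(1,3,4,5)] by blast
  next
    case (Suc n)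
    then have g1: "L.aut X1 (z n) \<approx> fv_scale wp (z n)" 
      and g3: "L.aut X3 (z n) \<approx> fv_scale (q * inverse wp ^ n) (z n)"
      and d: "L.der X1 (z n) \<approx> 0" "L.der X2 (z n) \<approx> 0" "L.der X3 (z n) \<approx> fv_scale (mu n) (f n)"
      and c: "x1 * z n \<approx> fv_scale wp (z n * x1)"
      by auto
    have "L.aut X1 (z (Suc n)) = (x2 + x1) * L.aut X1 (z n) + fv_scale wp (L.aut X1 (z n) * (x2 + x1))"
      by simp
    also have "\<dots> \<approx> (x2 + x1) * fv_scale wp (z n) + fv_scale wp (fv_scale wp (z n) * (x2 + x1))"
      by (intro L.eqv_add L.eqv_left L.eqv_scale L.eqv_right g1)
    also have "\<dots> = fv_scale wp (z (Suc n)) + fv_scale wp (x1 * z n) + fv_scale wp (fv_scale wp (z n * x1))"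
      by (simp add: algebra_simps fv.scale_right_distrib)
    also have "\<dots> \<approx> fv_scale wp (z (Suc n)) + fv_scale wp (fv_scale wp (z n * x1)) + fv_scale wp (fv_scale wp (z n * x1))"
      by (intro L.eqv_add L.eqv_scale L.eqv_refl c)
    also have "\<dots> = fv_scale wp (z (Suc n))"
      by (simp only: add.assoc double add_0_right)
    finally have G1: "L.aut X1 (z (Suc n)) \<approx> fv_scale wp (z (Suc n))" .
    let ?r = "q * inverse wp ^ n"
    have "L.aut X3 (z (Suc n)) = fv_scale (inverse wp) ((x2 + fv_scale a x1) * L.aut X3 (z n)) + L.aut X3 (z n) * (x2 + fv_scale a x1)"
      by (simp add: wp)
    also have "\<dots> \<approx> fv_scale (inverse wp) ((x2 + fv_scale a x1) * fv_scale ?r (z n)) + fv_scale ?r (z n) * (x2 + fv_scale a x1)"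
      by (intro L.eqv_add L.eqv_left L.eqv_scale L.eqv_right g3)
    also have "\<dots> = fv_scale (q * inverse wp ^ Suc n) (z (Suc n)) + fv_scale (inverse wp * ?r * a) (x1 * z n) + fv_scale (?r * a) (z n * x1)"
      by (simp add: algebra_simps fv.scale_right_distrib wp)
    also have "\<dots> \<approx> fv_scale (q * inverse wp ^ Suc n) (z (Suc n)) + fv_scale (inverse wp * ?r * a) (fv_scale wp (z n * x1)) + fv_scale (?r * a) (z n * x1)"
      by (intro L.eqv_add L.eqv_scale L.eqv_refl c)
    also have "\<dots> = fv_scale (q * inverse wp ^ Suc n) (z (Suc n)) + (fv_scale (?r * a) (z n * x1) + fv_scale (?r * a) (z n * x1))"
      by (simp add: wp add.assoc mult.assoc mult.left_commute[of _ wp] mult.commute[of _ wp])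
    also have "\<dots> = fv_scale (q * inverse wp ^ Suc n) (z (Suc n))"
      by (simp only: double add_0_right)
    finally have G3: "L.aut X3 (z (Suc n)) \<approx> fv_scale (q * inverse wp ^ Suc n) (z (Suc n))" .
    have "L.der X1 (z (Suc n)) = x2 * L.der X1 (z n) + fv_scale wp (L.der X1 (z n) * (x2 + x1))"
      by (simp add: L.der_letter)
    also have "\<dots> \<approx> x2 * 0 + fv_scale wp (0 * (x2 + x1))"
      by (intro L.eqv_add L.eqv_left L.eqv_scale L.eqv_right d)
    finally have D1: "L.der X1 (z (Suc n)) \<approx> 0" by simp
    have "L.der X2 (z (Suc n)) = x2 * L.der X2 (z n) + L.aut X1 (z n) + fv_scale wp (z n + L.der X2 (z n) * (x2 + x1))"
      by (simp add: L.der_letter algebra_simps)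
    also have "\<dots> \<approx> x2 * 0 + fv_scale wp (z n) + fv_scale wp (z n + 0 * (x2 + x1))"
      by (intro L.eqv_add L.eqv_left L.eqv_scale L.eqv_right d g1 L.eqv_refl)
    finally have D2: "L.der X2 (z (Suc n)) \<approx> 0" by (simp add: double)
    have "L.der X3 (z (Suc n)) = x2 * L.der X3 (z n) + L.der X3 (z n) * (x2 + fv_scale a x1)"
      by (simp add: L.der_letter wp)
    also have "\<dots> \<approx> x2 * fv_scale (mu n) (f n) + fv_scale (mu n) (f n) * (x2 + fv_scale a x1)"
      by (intro L.eqv_add L.eqv_left L.eqv_right d)
    also have "\<dots> \<approx> fv_scale (mu (Suc n)) (f (Suc n))"
      by (rule der3_step)
    finally have D3: "L.der X3 (z (Suc n)) \<approx> fv_scale (mu (Suc n)) (f (Suc n))" .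
    show ?case
      using G1 G3 D1 D2 D3 comm[OF G1 D1 D2 D3] by blast
  qed
qed

lemmas aut1_z = z_properties[THEN conjunct1]
  and aut3_z = z_properties[THEN conjunct2, THEN conjunct1]
  and der1_z = z_properties[THEN conjunct2, THEN conjunct2, THEN conjunct1]
  and der2_z = z_properties[THEN conjunct2, THEN conjunct2, THEN conjunct2, THEN conjunct1]
  and der3_z = z_properties[THEN conjunct2, THEN conjunct2, THEN conjunct2, THEN conjunct2, THEN conjunct1]
  and x1_z = z_properties[THEN conjunct2, THEN conjunct2, THEN conjunct2, THEN conjunct2, THEN conjunct2]

lemma x2_z: "x2 * z n = fv_scale wp (z n * x2) + z (Suc n)"
  by (simp add: algebra_simps char2_simps)

lemma x21_z: "x21 * z n \<approx> fv_scale (wp ^ 2) (z n * x21)"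
proof -
  have "x21 * z n = x2 * (x1 * z n) + x1 * (x2 * z n)"
    by (simp add: x21_def algebra_simps)
  also have "\<dots> \<approx> x2 * fv_scale wp (z n * x1) + x1 * (x2 * z n)"
    by (intro L.eqv_add L.eqv_left x1_z L.eqv_refl)
  also have "\<dots> = fv_scale wp ((x2 * z n) * x1) + x1 * (x2 * z n)"
    by (simp add: mult.assoc)
  also have "\<dots> = fv_scale wp (fv_scale wp (z n * x2 * x1) + z (Suc n) * x1) + (fv_scale wp (x1 * z n * x2) + x1 * z (Suc n))"
    unfolding x2_z by (simp add: algebra_simps)
  also have "\<dots> \<approx> fv_scale wp (fv_scale wp (z n * x2 * x1) + z (Suc n) * x1) +
      (fv_scale wp (fv_scale wp (z n * x1) * x2) + fv_scale wp (z (Suc n) * x1))"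
    by (intro L.eqv_add L.eqv_refl L.eqv_scale L.eqv_right x1_z)
  also have "\<dots> = fv_scale (wp ^ 2) (z n * x21)"
    by (simp add: x21_def algebra_simps char2_simps fv.scale_right_distrib power2_eq_square del: z.simps)
  finally show ?thesis .
qed

lemma f_z: "f j * z n \<approx> fv_scale (wp ^ j) (z n * f j)"
proof (cases j rule: nat_cases4)
  case 4
  have "f j * z n = x21 * (x1 * z n)"
    by (simp add: 4 mult.assoc)
  also have "\<dots> \<approx> x21 * fv_scale wp (z n * x1)"
    by (intro L.eqv_left x1_z)
  also have "\<dots> = fv_scale wp (x21 * z n * x1)"
    by (simp add: mult.assoc)
  also have "\<dots> \<approx> fv_scale wp (fv_scale (wp ^ 2) (z n * x21) * x1)"
    by (intro L.eqv_scale L.eqv_right x21_z)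
  finally show ?thesis
    by (simp add: 4 mult.assoc power3_eq_cube power2_eq_square)
qed (use x1_z x21_z in auto)

section \<open>Substitution of the elements z n for the letters of the diagonal braiding\<close>

fun psi_word :: "nat list \<Rightarrow> (idx, 'k) tensor_alg"
  where
    "psi_word [] = 1"
  | "psi_word (i # w) = z i * psi_word w"

definition psi :: "(nat, 'k) tensor_alg \<Rightarrow> (idx, 'k) tensor_alg"
  where "psi = lin_ext psi_word"

lemma lin_psi [simp]: "lin psi"
  by (simp add: psi_def linear_lin_ext)

lemmas psi_lin [simp] = lin_add[OF lin_psi] lin_scale[OF lin_psi] lin_0[OF lin_psi] lin_diff[OF lin_psi]
  lin_sum[OF lin_psi]

lemma psi_one [simp]: "psi 1 = 1"
  by (simp add: psi_def flip: basis_vec_Nil)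

lemma psi_basis [simp]: "psi (basis_vec w) = psi_word w"
  by (simp add: psi_def)

lemma psi_letter_mult [simp]: "psi (basis_vec [i] * p) = z i * psi p"
  by (rule lin_eqI[where F = "\<lambda>p. psi (_ * p)"])
    (auto intro!: lin_comp[OF lin_psi] lin_intros lin_psi simp flip: basis_vec_append)

lemma tcounit_psi [simp]: "tcounit (psi p) = tcounit p"
proof (induction p rule: fv_induct)
  case (basis r w)
  show ?case
    by (cases w) (simp_all add: tcounit_basis)
qed simp_all

definition weight :: "nat list \<Rightarrow> 'k"
  where "weight w = q ^ length w * inverse wp ^ sum_list w"

lemma aut3_psi: "L.aut X3 (psi_word w) \<approx> fv_scale (weight w) (psi_word w)"
proof (induction w)
  case (Cons i w)
  have "L.aut X3 (psi_word (i # w)) \<approx> fv_scale (q * inverse wp ^ i) (z i) * fv_scale (weight w) (psi_word w)"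
    unfolding psi_word.simps L.aut_mult by (intro L.eqv_mult aut3_z Cons)
  then show ?case
    by (simp add: weight_def power_add mult_ac)
qed (simp add: weight_def)

lemma f_psi: "f j * psi_word w \<approx> fv_scale ((wp ^ j) ^ length w) (psi_word w * f j)"
proof (induction w)
  case (Cons i w)
  have "f j * psi_word (i # w) = f j * z i * psi_word w"
    by (simp add: mult.assoc)
  also have "\<dots> \<approx> fv_scale (wp ^ j) (z i * f j) * psi_word w"
    by (intro L.eqv_right f_z)
  also have "\<dots> = fv_scale (wp ^ j) (z i * (f j * psi_word w))"
    by (simp add: mult.assoc)
  also have "\<dots> \<approx> fv_scale (wp ^ j) (z i * fv_scale ((wp ^ j) ^ length w) (psi_word w * f j))"
    by (intro L.eqv_scale L.eqv_left Cons)
  finally show ?case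
    by (simp add: mult.assoc)
qed simp

lemma D_aut_word: "D.aut_word j w = fv_scale ((q * wp ^ j) ^ length w * inverse wp ^ sum_list w) (basis_vec w)"
proof (induction w)
  case (Cons i w)
  have "vemb (dg wp q j i) = fv_scale (q * wp ^ j * inverse wp ^ i) (basis_vec [i])"
    by (simp add: dg_def lin_scale[OF lin_vemb] vemb_def)
  then show ?case
    unfolding D.aut_word.simps Cons basis_vec_Cons[of i w] by (simp add: power_add mult_ac)
qed (simp add: basis_vec_Nil)

lemma der12_psi: "L.der X1 (psi p) \<approx> 0" "L.der X2 (psi p) \<approx> 0"
proof -
  have "i \<noteq> X3 \<Longrightarrow> L.der i (psi_word w) \<approx> 0" for i w
  proof (induction w)
    case (Cons j w)
    have "L.der i (psi_word (j # w)) = z j * L.der i (psi_word w) + L.der i (z j) * L.aut i (psi_word w)"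
      by simp
    also have "\<dots> \<approx> z j * 0 + 0 * L.aut i (psi_word w)"
      using Cons der1_z der2_z by (intro L.eqv_add L.eqv_left L.eqv_right) (cases i; simp)+
    finally show ?case by simp
  qed simp
  then have *: "i \<noteq> X3 \<Longrightarrow> L.der i (psi p) \<approx> 0" for i
  proof (induction p rule: fv_induct)
    case (basis r b)
    then show ?case
      using L.eqv_scale[of "L.der i (psi_word b)" 0 r] by simp
  next
    case (add p q)
    then show ?case
      using L.eqv_add[of "L.der i (psi p)" 0 "L.der i (psi q)" 0] by simp
  qed simp
  show "L.der X1 (psi p) \<approx> 0" "L.der X2 (psi p) \<approx> 0"
    by (simp_all add: *)
qed

text \<open>Hence the subalgebra generated by the \<open>z i\<close> is the Nichols algebra of the diagonal braiding \<^const>\<open>dg\<close>.\<close>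

lemma der3_psi: "L.der X3 (psi p) \<approx> (\<Sum>j<4. fv_scale (mu j) (psi (D.der j p) * f j))"
proof -
  have *: "L.der X3 (psi_word w) \<approx> (\<Sum>j<4. fv_scale (mu j) (psi (D.der j (basis_vec w)) * f j))" for w
  proof (induction w)
    case (Cons i w)
    \<comment> \<open>The scalar of \<open>D.aut_word i w\<close>: it is \<open>weight w\<close>,
      from \<open>aut X3\<close>, times the factor from moving \<open>f i\<close> past the
      word.\<close>
    let ?c = "(q * wp ^ i) ^ length w * inverse wp ^ sum_list w"
    have mu0: "mu i = 0" if "\<not> i < 4"
      using that by (simp add: mu_def)
    have "L.der X3 (psi_word (i # w)) = z i * L.der X3 (psi_word w) + L.der X3 (z i) * L.aut X3 (psi_word w)"
      by simp
    also have "\<dots> \<approx> z i * (\<Sum>j<4. fv_scale (mu j) (psi (D.der j (basis_vec w)) * f j)) +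
        fv_scale (mu i) (f i) * fv_scale (weight w) (psi_word w)"
      by (intro L.eqv_add L.eqv_left L.eqv_mult Cons der3_z aut3_psi)
    also have "fv_scale (mu i) (f i) * fv_scale (weight w) (psi_word w) = fv_scale (mu i * weight w) (f i * psi_word w)"
      by (simp add: mult.commute)
    also have "z i * (\<Sum>j<4. fv_scale (mu j) (psi (D.der j (basis_vec w)) * f j)) + \<dots> \<approx>
      z i * (\<Sum>j<4. fv_scale (mu j) (psi (D.der j (basis_vec w)) * f j)) +
      fv_scale (mu i * weight w) (fv_scale ((wp ^ i) ^ length w) (psi_word w * f i))"
      by (intro L.eqv_add L.eqv_refl L.eqv_scale f_psi)
    also have "fv_scale (mu i * weight w) (fv_scale ((wp ^ i) ^ length w) (psi_word w * f i)) =
        (\<Sum>j<4. if i = j then fv_scale (mu j) (psi (fv_scale ?c (basis_vec w)) * f j) else 0)"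
      using mu0 by (auto simp: sum.delta weight_def power_mult_distrib mult_ac)
    also have "z i * (\<Sum>j<4. fv_scale (mu j) (psi (D.der j (basis_vec w)) * f j)) + \<dots> =
        (\<Sum>j<4. fv_scale (mu j) (psi (D.der j (basis_vec (i # w))) * f j))"
      unfolding sum_distrib_left sum.distrib[symmetric]
    proof (rule sum.cong[OF refl])
      fix j :: nat
      have "D.der j (basis_vec (i # w)) = basis_vec [i] * D.der j (basis_vec w) + (if j = i then D.aut j (basis_vec w) else 0)"
        unfolding basis_vec_Cons[of i w] by (rule D.der_letter_mult)
      then show "z i * fv_scale (mu j) (psi (D.der j (basis_vec w)) * f j) +
          (if i = j then fv_scale (mu j) (psi (fv_scale ?c (basis_vec w)) * f j) else 0) =
          fv_scale (mu j) (psi (D.der j (basis_vec (i # w))) * f j)"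
        by (auto simp: D.aut_basis D_aut_word distrib_right fv.scale_right_distrib mult.assoc)
    qed
    finally show ?case .
  qed (simp add: basis_vec_Nil)
  show ?thesis
  proof (induction p rule: fv_induct)
    case (basis r b)
    show ?case
      using L.eqv_scale[OF *[of b], of r] by (simp add: fv.scale_sum_right mult.commute)
  next
    case (add p q)
    show ?case
      using L.eqv_add[OF add] by (simp add: distrib_right fv.scale_right_distrib sum.distrib)
  qed simp
qed

text \<open>By \<open>der3_psi\<close> a derivative of \<open>psi p\<close> carries a factor
  \<open>f j\<close> on the right. The induction is therefore over products \<open>psi p * b\<close>
  with b arbitrary.\<close>

lemma psi_nich: 
  assumes "p \<in> D.nich"
  shows "psi p \<in> L.nich"
proof -
  have "p \<in> D.nich \<Longrightarrow> L.pr w (psi p * b) = 0" for w p b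
  proof (induction w arbitrary: p b)
    case Nil
    then show ?case
      by (simp add: D.nich_tcounit)
  next
    case (Cons i w)
    have pr0: "r \<approx> s \<Longrightarrow> L.pr w r = L.pr w s" for r s
      unfolding L.eqv_def using L.nichD[of "r - s" w] by simp
    have "L.pr (i # w) (psi p * b) = L.pr w (psi p * L.der i b) + L.pr w (L.der i (psi p) * L.aut i b)"
      by simp
    also have "L.pr w (psi p * L.der i b) = 0"
      by (rule Cons.IH[OF Cons.prems])
    also have "L.pr w (L.der i (psi p) * L.aut i b) = 0"
    proof (cases "i = X3")
      case True
      have "L.pr w (L.der i (psi p) * L.aut i b) =
          L.pr w ((\<Sum>j<4. fv_scale (mu j) (psi (D.der j p) * f j)) * L.aut i b)"
        unfolding True by (intro pr0 L.eqv_right der3_psi)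
      also have "\<dots> = L.pr w (\<Sum>j<4. fv_scale (mu j) (psi (D.der j p) * (f j * L.aut i b)))"
        by (simp add: sum_distrib_right mult.assoc)
      also have "\<dots> = (\<Sum>j<4. mu j * L.pr w (psi (D.der j p) * (f j * L.aut i b)))"
        using functional_simps(4)[OF L.functional_pr(1), of w "\<lambda>j. fv_scale (mu j) (psi (D.der j p) * (f j * L.aut i b))"]
        by simp
      also have "\<dots> = 0"
        using Cons.IH[OF D.nich_der[OF Cons.prems]] by simp
      finally show ?thesis .
    next
      case False
      then have "L.der i (psi p) \<approx> 0"
        using der12_psi by (cases i) auto
      from L.eqv_right[OF this, of "L.aut i b"] show ?thesis
        using pr0[of _ 0] by simp
    qed
    finally show ?case by simp
  qed
  from this[OF assms, of _ 1] show ?thesis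
    by (simp add: L.nich_def)
qed

text \<open>\<open>der X1\<close> treats the \<open>y n\<close> as constants and lowers the index of
  \<open>f n\<close>. Three applications isolate \<open>y 3\<close>, and the others follow by
  removing the terms already known to lie in \<open>nich\<close>.\<close>

lemma f_independent:
  assumes y: "\<And>n. n < 4 \<Longrightarrow> L.der X1 (y n) \<approx> 0" and s: "(\<Sum>n<4. y n * f n) \<in> L.nich"
  shows "n < 4 \<Longrightarrow> y n \<in> L.nich"
proof -
  have d: "L.der X1 (y n * f m) \<approx> y n * (if m = 0 \<or> m \<ge> 4 then 0 else f (m - 1))" if "n < 4" for n m
  proof -
    have "L.der X1 (y n * f m) = y n * L.der X1 (f m) + L.der X1 (y n) * L.aut X1 (f m)"
      by simp
    also have "\<dots> \<approx> y n * (if m = 0 \<or> m \<ge> 4 then 0 else f (m - 1)) + 0 * L.aut X1 (f m)"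
      by (intro L.eqv_add L.eqv_left L.eqv_right der_f y that)
    finally show ?thesis by simp
  qed
  have *: "r \<in> L.nich" if "p \<in> L.nich" "L.der X1 p \<approx> r" for p r
    using that L.nich_der L.eqv_nich by blast
  have s0: "y 0 + y 1 * x1 + y 2 * x21 + y 3 * (x21 * x1) \<in> L.nich" (is "?p \<in> _")
  proof -
    have "{..<4::nat} = {0, 1, 2, 3}" by auto
    then show ?thesis
      using s by (simp add: add.assoc)
  qed
  have s1: "y 1 + y 2 * x1 + y 3 * x21 \<in> L.nich"
  proof (rule *[OF s0])
    have "L.der X1 (y 0 * f 0 + y 1 * f 1 + y 2 * f 2 + y 3 * f 3) \<approx> y 0 * 0 + y 1 * f 0 + y 2 * f 1 + y 3 * f 2"
      unfolding L.der_lin(1) using d[of 0 0] d[of 1 1] d[of 2 2] d[of 3 3] by (intro L.eqv_add) simp_all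
    then show "L.der X1 ?p \<approx> y 1 + y 2 * x1 + y 3 * x21"
      by simp
  qed
  have s2: "y 2 + y 3 * x1 \<in> L.nich"
  proof (rule *[OF s1])
    have "L.der X1 (y 1 * f 0 + y 2 * f 1 + y 3 * f 2) \<approx> y 1 * 0 + y 2 * f 0 + y 3 * f 1"
      unfolding L.der_lin(1) using d[of 1 0] d[of 2 1] d[of 3 2] by (intro L.eqv_add) simp_all
    then show "L.der X1 (y 1 + y 2 * x1 + y 3 * x21) \<approx> y 2 + y 3 * x1"
      by simp
  qed
  have s3: "y 3 \<in> L.nich"
  proof (rule *[OF s2])
    have "L.der X1 (y 2 * f 0 + y 3 * f 1) \<approx> y 2 * 0 + y 3 * f 0"
      unfolding L.der_lin(1) using d[of 2 0] d[of 3 1] by (intro L.eqv_add) simp_all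
    then show "L.der X1 (y 2 + y 3 * x1) \<approx> y 3"
      by simp
  qed
  have y2: "y 2 \<in> L.nich"
    using L.nich_diff[OF s2 L.nich_mult(1)[OF s3, of x1]] by simp
  have "y 1 + y 2 * x1 \<in> L.nich"
    using L.nich_diff[OF s1 L.nich_mult(1)[OF s3, of x21]] by simp
  from L.nich_diff[OF this L.nich_mult(1)[OF y2, of x1]] have y1: "y 1 \<in> L.nich" by simp
  have "y 0 + y 1 * x1 + y 2 * x21 \<in> L.nich"
    using L.nich_diff[OF s0 L.nich_mult(1)[OF s3, of "x21 * x1"]] by simp
  from L.nich_diff[OF this L.nich_mult(1)[OF y2, of x21]] have "y 0 + y 1 * x1 \<in> L.nich" by simp
  from L.nich_diff[OF this L.nich_mult(1)[OF y1, of x1]] have y0: "y 0 \<in> L.nich" by simp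
  show "n < 4 \<Longrightarrow> y n \<in> L.nich"
  proof -
    assume "n < 4"
    then consider "n = 0" | "n = 1" | "n = 2" | "n = 3" by linarith
    then show ?thesis
      using s3 y2 y1 y0 by cases auto
  qed
qed

text \<open>A partial converse to \<open>psi_nich\<close>: independence of the \<open>f j\<close>
  separates the summands of \<open>der3_psi\<close>, and dividing by \<open>mu j\<close> recovers
  \<open>psi (D.der j p)\<close>, one letter at a time.\<close>

lemma pr_psi_nich:
  assumes "psi p \<in> L.nich" "w \<in> lists {j. mu j \<noteq> 0}"
  shows "D.pr w p = 0"
  using assms
proof (induction w arbitrary: p)
  case Nil
  then show ?case
    using L.nich_tcounit by fastforce
next
  case (Cons j w)
  have j: "mu j \<noteq> 0" "j < 4"
    using Cons.prems by (auto simp: mu_def split: if_splits)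
  let ?y = "\<lambda>j. fv_scale (mu j) (psi (D.der j p))"
  have "(\<Sum>j<4. ?y j * f j) \<in> L.nich"
    using L.eqv_nich[OF der3_psi[of p]] L.nich_der[OF Cons.prems(1)] by simp
  then have "?y j \<in> L.nich"
  proof (rule f_independent[rotated])
    show "L.der X1 (?y n) \<approx> 0" for n
      using L.eqv_scale[OF der12_psi(1)[of "D.der n p"], of "mu n"] by simp
  qed (rule j)
  from L.nich_scale[OF this, of "inverse (mu j)"] have "psi (D.der j p) \<in> L.nich"
    using j by simp
  then show ?case
    using Cons by simp
qed

section \<open>Infinite dimension for \<open>q \<noteq> 1\<close>\<close>

abbreviation "P \<equiv> basis_vec [0] :: (nat, 'k) tensor_alg"
abbreviation "R \<equiv> basis_vec [1] :: (nat, 'k) tensor_alg"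
abbreviation "S \<equiv> basis_vec [2] :: (nat, 'k) tensor_alg"

text \<open>This says that y braids like a word of length l whose letters have sum s.\<close>

definition hom :: "nat \<Rightarrow> nat \<Rightarrow> (nat, 'k) tensor_alg \<Rightarrow> bool"
  where "hom l s y \<longleftrightarrow> (\<forall>j. D.aut j y = fv_scale (q ^ l * wp ^ (j * l) * inverse wp ^ s) y)"

lemma hom_letter: "hom 1 i (basis_vec [i])"
  by (simp add: hom_def D.aut_basis D_aut_word)

lemma hom_mult: "hom l s y \<Longrightarrow> hom l' s' y' \<Longrightarrow> hom (l + l') (s + s') (y * y')"
  by (simp add: hom_def power_add distrib_left mult_ac)

lemma hom_add: "hom l s y \<Longrightarrow> hom l s y' \<Longrightarrow> hom l s (y + y')"
  by (simp add: hom_def fv.scale_right_distrib)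

lemma hom_scale: "hom l s y \<Longrightarrow> hom l s (fv_scale r y)"
  by (simp add: hom_def mult.commute)

lemma hom_aut: "hom l s y \<Longrightarrow> D.aut j y = fv_scale (q ^ l * wp ^ (j * l) * inverse wp ^ s) y"
  by (simp add: hom_def)

definition qnum :: "nat \<Rightarrow> 'k" where "qnum n = (\<Sum>i<n. q ^ i)"

definition qfact :: "nat \<Rightarrow> 'k" where "qfact n = (\<Prod>i<n. qnum (Suc i))"

lemma qnum_Suc: "qnum (Suc n) = 1 + q * qnum n"
  unfolding qnum_def sum.lessThan_Suc_shift by (simp add: sum_distrib_left)

lemma aut_self: "D.aut i (basis_vec [i]) = fv_scale q (basis_vec [i])"
  using wp by (simp add: D.aut_basis D_aut_word mult.assoc flip: power_mult_distrib)

lemma der_letter_power: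
  "D.der i (basis_vec [i] ^ n) = fv_scale (qnum n) (basis_vec [i] ^ (n - 1))"
proof (induction n)
  case (Suc n)
  have "D.der i (basis_vec [i] ^ Suc n) = basis_vec [i] ^ n + fv_scale (q * qnum n) (basis_vec [i] ^ (n - 1) * basis_vec [i])"
    by (simp add: power_Suc2 D.der_letter Suc aut_self mult.commute del: power_Suc)
  also have "\<dots> = fv_scale (1 + q * qnum n) (basis_vec [i] ^ n)"
    by (cases n) (simp_all add: fv.scale_left_distrib power_Suc2 qnum_def del: power_Suc)
  finally show ?case
    by (simp add: qnum_Suc)
qed (simp add: qnum_def)

lemma ders_letter_power:
  "(D.der i ^^ k) (basis_vec [i] ^ k) = fv_scale (qfact k) 1"
proof (induction k)
  case (Suc k)
  have scale: "(D.der i ^^ k) (fv_scale r p) = fv_scale r ((D.der i ^^ k) p)" for r p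
    by (induction k) simp_all
  show ?case
    unfolding funpow_Suc_right comp_def der_letter_power scale by (simp add: Suc qfact_def mult.commute)
qed (simp add: qfact_def)

lemma pr_append: "D.pr (u @ v) p = D.pr v (fold D.der u p)"
  by (induction u arbitrary: p) simp_all

text \<open>The functionals \<open>D.pr (w k)\<close> are dual to the \<open>x n\<close> up to
  nonzero scalars. Their words use only letters with \<open>mu j \<noteq> 0\<close>, so by
  \<open>pr_psi_nich\<close> they still separate the images modulo the relations.\<close>

lemma infinite_of_functionals:
  fixes x :: "nat \<Rightarrow> (nat, 'k) tensor_alg"
  assumes w: "\<And>k. w k \<in> lists {j. mu j \<noteq> 0}" 
    and x: "\<And>k n. D.pr (w k) (x n) = (if n = k then c k else 0)" "\<And>k. c k \<noteq> 0"
  shows "nichols_dim (frakL wp q a) = \<infinity>"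
  unfolding nichols_dim_def L.nichols_ideal_eq
proof (rule quotient_dim_infinite[OF L.subspace_nich])
  fix m
  show "indep_mod L.nich (\<lambda>n. psi (x n)) {..<m}"
    unfolding indep_mod_def
  proof (intro allI impI ballI)
    fix b k assume *: "(\<Sum>n<m. fv_scale (b n) (psi (x n))) \<in> L.nich" "k \<in> {..<m}"
    then have "psi (\<Sum>n<m. fv_scale (b n) (x n)) \<in> L.nich"
      by simp
    then have "0 = D.pr (w k) (\<Sum>n<m. fv_scale (b n) (x n))"
      using pr_psi_nich w by metis
    also have "\<dots> = (\<Sum>n<m. b n * (if n = k then c k else 0))"
      by (simp only: functional_simps(4)[OF D.functional_pr(1)] D.pr_scale x)
    also have "\<dots> = b k * c k"
      using *(2) by (simp add: if_distrib[of "(*) _"] cong: if_cong)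
    finally show "b k = 0"
      using x(2) by simp
  qed
qed

lemma geometric: "qnum n * (1 + q) = 1 + q ^ n"
proof (induction n)
  case (Suc n)
  have "qnum (Suc n) * (1 + q) = 1 + q + q * (qnum n * (1 + q))"
    by (simp add: qnum_Suc algebra_simps)
  also have "\<dots> = 1 + (q + q) + q * q ^ n"
    unfolding Suc by (simp add: algebra_simps)
  also have "q + q = q * (1 + 1)"
    by (simp only: distrib_left mult_1_right)
  finally show ?case
    by (simp only: char2 mult_zero_right add_0_right power_Suc)
qed (simp only: qnum_def lessThan_0 sum.empty mult_zero_left power_0 char2)

lemma char2_add_eq_0: "(1::'k) + x = 0 \<longleftrightarrow> x = 1"
  using char2 by (metis add_left_cancel)

text \<open>No q-number vanishes, so applying \<open>der 0\<close> repeatedly detects every power of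
  P.\<close>

lemma infinite_dim_not_root:
  assumes "\<And>n. n > 0 \<Longrightarrow> q ^ n \<noteq> 1"
  shows "nichols_dim (frakL wp q a) = \<infinity>"
proof (rule infinite_of_functionals)
  have mu0: "mu 0 \<noteq> 0"
    by (simp add: mu_def)
  show "replicate k 0 \<in> lists {j. mu j \<noteq> 0}" for k
    using mu0 by auto
  have fold: "fold D.der (replicate k i) p = (D.der i ^^ k) p" for k i p
    by (induction k arbitrary: p) (simp_all add: funpow_swap1)
  show "D.pr (replicate k 0) (P ^ n) = (if n = k then qfact k else 0)" for k n
  proof (cases "n = k")
    case True
    then show ?thesis
      using pr_append[of "replicate k 0" "[]" "P ^ n"] by (simp add: fold ders_letter_power)
  next
    case False
    have pow: "P ^ n = basis_vec (replicate n 0)"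
      by (induction n) (simp_all add: basis_vec_Nil basis_vec_Cons[of 0 "replicate _ 0"])
    show ?thesis
      using D.pr_basis_degree[of "replicate k 0" "replicate n 0"] D.deg_eq_length[of "replicate k 0" "replicate n 0"] False
      unfolding pow by auto
  qed
  show "qfact k \<noteq> 0" for k
    unfolding qfact_def prod_zero_iff[OF finite_lessThan]
    using geometric assms char2_add_eq_0 by (metis mult_zero_left zero_less_Suc)
qed

text \<open>
  If \<open>q\<close> has finite order \<open>N = k + 2\<close>, let \<open>e\<close> be the iterated braided commutator of \<open>P\<close> with
  \<open>k\<close> copies of \<open>R\<close> and \<open>S\<close>. Its degree \<open>\<delta>\<close> has length \<open>N\<close> and so braids trivially with
  everything, up to inverse scalars. Commuting repeatedly with \<open>e\<close> moves along a
  string \<open>\<alpha> + n \<delta>\<close> of real roots, and a composite \<open>DD\<close> of derivations of degree \<open>\<delta>\<close> moves back.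
\<close>

fun Y :: "nat \<Rightarrow> (nat, 'k) tensor_alg"
  where
    "Y 0 = S"
  | "Y (Suc m) = R * Y m + fv_scale (q ^ Suc m * inverse wp) (Y m * R)"

lemma hom_Y: "hom (Suc m) (m + 2) (Y m)"
proof (induction m)
  case 0
  show ?case
    using hom_letter[of 2] by (simp add: numeral_2_eq_2)
next
  case (Suc m)
  have "hom (Suc (Suc m)) (Suc m + 2) (R * Y m)"
    using hom_mult[OF hom_letter[of 1] Suc] by simp
  moreover have "hom (Suc (Suc m)) (Suc m + 2) (Y m * R)"
    using hom_mult[OF Suc hom_letter[of 1]] by simp
  ultimately show ?case
    unfolding Y.simps by (intro hom_add hom_scale)
qed

lemma aut1_Y: "D.aut 1 (Y m) = fv_scale (q ^ Suc m * inverse wp) (Y m)"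
  using hom_aut[OF hom_Y, of 1 m] wp by (simp add: mult.assoc flip: power_mult_distrib) (simp add: field_simps)

text \<open>The scalar in \<open>Y (Suc m)\<close> is that of \<open>aut 1\<close> on
  \<open>Y m\<close>, which makes the two terms of \<open>der 1\<close> equal; they cancel in
  characteristic 2.\<close>

lemma der01_Y: "D.der 0 (Y m) = 0" "D.der 1 (Y m) = 0"
proof -
  show "D.der 0 (Y m) = 0"
    by (induction m) (simp_all add: D.der_letter)
  show "D.der 1 (Y m) = 0"
  proof (induction m)
    case (Suc m)
    then show ?case
      using aut1_Y[of m] by (simp add: D.der_letter double)
  qed (simp add: D.der_letter)
qed

text \<open>If q has order k + 2, the product is nonzero up to m = k and vanishes for m = k + 1. So
  k is the largest number of commutators with R that can be used.\<close>

lemma der2_Y: "D.der 2 (Y m) = fv_scale (\<Prod>i<m. 1 + q ^ (i + 2)) (R ^ m)"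
proof (induction m)
  case (Suc m)
  have "D.aut 2 R = fv_scale (q * wp) R"
    using hom_aut[OF hom_letter[of 1], of 2] wp by (simp add: power2_eq_square)
  then have "D.der 2 (Y (Suc m)) = R * D.der 2 (Y m) + fv_scale (q ^ (m + 2)) (D.der 2 (Y m) * R)"
    using wp by (simp add: D.der_letter power2_eq_square mult_ac)
  also have "\<dots> = fv_scale ((\<Prod>i<m. 1 + q ^ (i + 2)) * (1 + q ^ (m + 2))) (R ^ Suc m)"
    unfolding Suc by (simp add: power_commutes fv.scale_left_distrib distrib_left distrib_right mult.commute)
  finally show ?case
    by (simp add: mult.commute)
qed (simp add: D.der_letter)

lemma ders_scale: "(D.der i ^^ k) (fv_scale r p) = fv_scale r ((D.der i ^^ k) p)"
  and ders_add: "(D.der i ^^ k) (p + p') = (D.der i ^^ k) p + (D.der i ^^ k) p'"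
  and ders_zero: "(D.der i ^^ k) 0 = 0"
  by (induction k) simp_all

lemma ders_mult_left: "D.der i p = 0 \<Longrightarrow> (D.der i ^^ k) (p * r) = p * (D.der i ^^ k) r"
  by (induction k) simp_all

lemma ders_mult_right:
  assumes "D.der i p = 0" "D.aut i p = fv_scale c p"
  shows "(D.der i ^^ k) (r * p) = fv_scale (c ^ k) ((D.der i ^^ k) r * p)"
  by (induction k) (simp_all add: assms mult.commute)

lemma fold_der_replicate: "fold D.der (replicate k i) p = (D.der i ^^ k) p"
  by (induction k arbitrary: p) (simp_all add: funpow_swap1)

lemma infinite_dim_root:
  assumes N: "q ^ (k + 2) = 1" "k > 0" "\<And>n. 0 < n \<Longrightarrow> n < k + 2 \<Longrightarrow> q ^ n \<noteq> 1"
  shows "nichols_dim (frakL wp q a) = \<infinity>"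
proof -
  define m where "m = (\<Prod>i<k. 1 + q ^ (i + 2))"
  define \<eta> where "\<eta> = qfact k * (1 + q ^ k)"
  \<comment> \<open>The scalar of \<open>aut 0\<close> on \<open>e\<close>. With it the two terms of
    \<open>der 0 (x 1)\<close> cancel.\<close>
  define \<chi> where "\<chi> = inverse wp ^ (k + 2)"
  \<comment> \<open>Up to the factor m this is \<open>der 2 e\<close>.\<close>
  define h where "h = P * R ^ k + fv_scale (inverse wp ^ k) (R ^ k * P)"
  \<comment> \<open>The scalar is that of \<open>aut 0\<close> on \<open>Y k\<close>, so the braided
    commutator satisfies \<open>der 0 e = 0\<close>.\<close>
  define e where "e = P * Y k + fv_scale (q ^ Suc k * inverse wp ^ (k + 2)) (Y k * P)"
  define x where "x n = ((\<lambda>y. y * e + fv_scale \<chi> (e * y)) ^^ n) P" for n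
  define DD where "DD y = D.der 0 ((D.der 1 ^^ k) (D.der 2 y))" for y
  \<comment> \<open>Here m comes from \<open>der 2\<close> on \<open>Y k\<close> and \<eta> from the
    k derivations \<open>der 1\<close> on \<open>h\<close>. The factor \<open>1 + q\<close> comes
    from \<open>der 0 (P * P)\<close>, and the last one from adding the two terms of
    \<open>x 1\<close>.\<close>
  define lam where "lam = m * \<eta> * ((1 + q) * (1 + q ^ Suc k))"
  have x_Suc: "x (Suc n) = x n * e + fv_scale \<chi> (e * x n)" and x_0: "x 0 = P" for n
    by (simp_all add: x_def)
  have qk: "q ^ k * (q * q) = 1"
    using N(1) by (simp add: power_add power2_eq_square mult_ac)
  have hom_e: "hom (k + 2) (k + 2) e"
    unfolding e_def using hom_mult[OF hom_letter[of 0] hom_Y[of k]] hom_mult[OF hom_Y[of k] hom_letter[of 0]]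
    by (intro hom_add hom_scale) simp_all
  have aut0_e: "D.aut 0 e = fv_scale \<chi> e"
    using hom_aut[OF hom_e, of 0] N(1) by (simp add: \<chi>_def)
  have aut1_e: "D.aut 1 e = e"
    using hom_aut[OF hom_e, of 1] N(1) wp by (simp only: mult_1_left flip: power_mult_distrib) simp
  have aut2_e: "D.aut 2 e = fv_scale (wp ^ (k + 2)) e"
  proof -
    have "wp ^ (2 * (k + 2)) * inverse wp ^ (k + 2) = wp ^ (k + 2) * (wp * inverse wp) ^ (k + 2)"
      by (simp only: mult_2 power_add power_mult_distrib mult_ac)
    then show ?thesis
      using hom_aut[OF hom_e, of 2] N(1) wp by simp
  qed
  have hom_x: "hom (1 + n * (k + 2)) (n * (k + 2)) (x n)" for n
  proof (induction n)
    case 0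
    show ?case
      using hom_letter[of 0] by (simp add: x_0)
  next
    case (Suc n)
    show ?case
      unfolding x_Suc using hom_mult[OF Suc hom_e] hom_mult[OF hom_e Suc]
      by (intro hom_add hom_scale) (simp_all add: algebra_simps)
  qed
  have der0_e: "D.der 0 e = 0"
  proof -
    have "D.aut 0 (Y k) = fv_scale (q ^ Suc k * inverse wp ^ (k + 2)) (Y k)"
      using hom_aut[OF hom_Y[of k], of 0] by simp
    then show ?thesis
      by (simp add: e_def D.der_letter der01_Y double del: power_Suc)
  qed
  have der1_e: "D.der 1 e = 0"
    by (simp add: e_def D.der_letter der01_Y[simplified])
  have der2_e: "D.der 2 e = fv_scale m h"
  proof -
    have aut2_P: "D.aut 2 P = fv_scale (q * wp ^ 2) P"
      using hom_aut[OF hom_letter[of 0], of 2] by simp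
    let ?c = "q ^ Suc k * inverse wp ^ (k + 2)"
    have "?c * (q * wp ^ 2) = q ^ (k + 2) * inverse wp ^ k * (inverse wp * wp) ^ 2"
      by (simp only: power_add power_mult_distrib power2_eq_square power_Suc mult_ac)
    also have "\<dots> = inverse wp ^ k"
      using N(1) wp by simp
    finally have c: "?c * (q * wp ^ 2) = inverse wp ^ k" .
    have "D.der 2 e = P * D.der 2 (Y k) + fv_scale ?c (D.der 2 (Y k) * D.aut 2 P)"
      by (simp add: e_def D.der_letter del: power_Suc)
    also have "\<dots> = fv_scale m (P * R ^ k) + fv_scale (?c * (q * wp ^ 2)) (fv_scale m (R ^ k * P))"
      unfolding aut2_P der2_Y m_def[symmetric] by (simp only: mult_scale_left mult_scale_right fv.scale_scale mult_ac)
    also have "\<dots> = fv_scale m h"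
      unfolding c by (simp add: h_def fv.scale_right_distrib mult.commute)
    finally show ?thesis .
  qed
  have aut1_P: "D.aut 1 P = fv_scale (q * wp) P"
    using hom_aut[OF hom_letter[of 0], of 1] by simp
  have ders_h: "(D.der 1 ^^ k) h = fv_scale \<eta> P"
  proof -
    have 0: "D.der 1 P = 0"
      by (simp add: D.der_letter)
    have "inverse wp ^ k * ((q * wp) ^ k * qfact k) = qfact k * q ^ k"
      using wp by (simp add: power_mult_distrib field_simps)
    then show ?thesis
      unfolding h_def ders_add ders_scale ders_mult_left[OF 0] ders_mult_right[OF 0 aut1_P] ders_letter_power
      by (simp add: \<eta>_def fv.scale_left_distrib distrib_left mult_ac)
  qed
  have der1_x: "D.der 1 (x n) = 0" for n
  proof (induction n)
    case (Suc n)
    then show ?case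
      unfolding x_Suc by (simp add: der1_e[simplified])
  qed (simp add: x_0 D.der_letter)
  have der0_x: "D.der 0 (x (Suc n)) = 0" for n
  proof (induction n)
    case 0
    show ?case
      unfolding x_Suc by (simp add: x_0 D.der_letter aut0_e der0_e double)
  next
    case (Suc n)
    show ?case
      unfolding x_Suc[of "Suc n"] by (simp add: Suc der0_e)
  qed
  \<comment> \<open>Since \<open>der 1 y = 0\<close>, there are two contributions:
    \<open>der 2\<close> followed by all k copies of \<open>der 1\<close> falls on \<open>e\<close>
    and turns it into a multiple of P, or these derivations fall on y.\<close>
  have DD_mult_e: "DD (y * e) = D.der 0 (fv_scale (m * \<eta>) (y * P)) + DD y * e"
    if y: "D.der 1 y = 0" for y
  proof -
    have "(D.der 1 ^^ k) (r * e) = (D.der 1 ^^ k) r * e" for r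
      using ders_mult_right[OF der1_e, of 1 k r] aut1_e by simp
    then have "(D.der 1 ^^ k) (D.der 2 (y * e)) =
        fv_scale (m * \<eta>) (y * P) + fv_scale (wp ^ (k + 2)) ((D.der 1 ^^ k) (D.der 2 y) * e)"
      by (simp add: der2_e aut2_e ders_add ders_scale ders_mult_left[OF y[simplified]] ders_h[simplified])
    moreover have "wp ^ (k + 2) * \<chi> = 1"
      unfolding \<chi>_def power_mult_distrib[symmetric] using wp by simp
    ultimately show ?thesis
      by (simp add: DD_def der0_e aut0_e)
  qed
  have DD_e_mult: "DD (e * y) = e * DD y + fv_scale (m * \<eta> * c2 * c1 ^ k) (D.der 0 (P * y))"
    if y: "D.der 1 y = 0" "D.aut 1 y = fv_scale c1 y" "D.aut 2 y = fv_scale c2 y" for y c1 c2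
    by (simp add: DD_def der2_e ders_add ders_scale ders_mult_left[OF der1_e[simplified]]
        ders_mult_right[OF y(1,2)[simplified]] ders_h[simplified] y(3) der0_e mult_ac)
  have DD_x: "DD (x (Suc n)) = fv_scale lam (x n)" for n
  proof (induction n)
    case 0
    have 1: "D.der 1 P = 0" and 2: "DD P = 0"
      by (simp_all add: D.der_letter DD_def ders_zero)
    have 3: "D.aut 2 P = fv_scale (q * wp ^ 2) P"
      using hom_aut[OF hom_letter[of 0], of 2] by simp
    have 4: "D.der 0 (P * P) = fv_scale (1 + q) P"
      by (simp add: D.der_letter aut_self fv.scale_left_distrib)
    have "DD (x (Suc 0)) = fv_scale (m * \<eta> * (1 + q)) P +
        fv_scale (\<chi> * (m * \<eta> * (q * wp ^ 2) * (q * wp) ^ k) * (1 + q)) P"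
    proof -
      have "DD (x (Suc 0)) = DD (P * e) + fv_scale \<chi> (DD (e * P))"
        by (simp add: x_Suc x_0 DD_def ders_add ders_scale)
      then show ?thesis
        unfolding DD_mult_e[OF 1] DD_e_mult[OF 1 aut1_P 3] by (simp add: 2 4 del: D.der_mult)
    qed
    also have "\<chi> * (m * \<eta> * (q * wp ^ 2) * (q * wp) ^ k) * (1 + q) = m * \<eta> * (1 + q) * q ^ Suc k * (inverse wp * wp) ^ (k + 2)"
      by (simp add: \<chi>_def power_mult_distrib power_add power2_eq_square mult_ac)
    also have "fv_scale (m * \<eta> * (1 + q)) P + fv_scale (m * \<eta> * (1 + q) * q ^ Suc k * (inverse wp * wp) ^ (k + 2)) P = fv_scale lam P"
      using wp by (simp add: lam_def distrib_left mult.assoc flip: fv.scale_left_distrib del: power_Suc)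
    finally show ?case
      by (simp add: x_0)
  next
    case (Suc n)
    \<comment> \<open>Unlike P, the element \<open>x (Suc n)\<close> is killed by
      \<open>der 0\<close>, so its two products with P contribute plain multiples of
      \<open>x (Suc n)\<close>. These cancel, and the factor \<open>lam\<close> is passed on
      unchanged.\<close>
    let ?l = "1 + Suc n * (k + 2)" and ?s = "Suc n * (k + 2)"
    have ql: "q ^ ?l = q"
      using N(1) by (simp only: power_add power_mult mult.commute[of "Suc n"]) simp
    define c where "c j = q ^ ?l * wp ^ (j * ?l) * inverse wp ^ ?s" for j
    have aut: "D.aut j (x (Suc n)) = fv_scale (c j) (x (Suc n))" for j
      unfolding c_def by (rule hom_aut[OF hom_x])
    have c0: "c 0 = q * inverse wp ^ ?s" and c1: "c 1 = q * wp" and c2: "c 2 = q * wp * wp * wp ^ ?s"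
    proof -
      have w: "wp ^ ?s * inverse wp ^ ?s = 1"
        unfolding power_mult_distrib[symmetric] using wp by simp
      show "c 0 = q * inverse wp ^ ?s"
        unfolding c_def ql by simp
      have "c 1 = q * wp ^ ?l * inverse wp ^ ?s"
        unfolding c_def ql by (simp only: mult_1_left)
      also have "\<dots> = q * wp * (wp ^ ?s * inverse wp ^ ?s)"
        by (simp only: power_add power_one_right mult_ac)
      finally show "c 1 = q * wp"
        unfolding w by simp
      have "c 2 = q * wp ^ (2 * ?l) * inverse wp ^ ?s"
        unfolding c_def ql ..
      also have "\<dots> = q * wp * wp * wp ^ ?s * (wp ^ ?s * inverse wp ^ ?s)"
        by (simp only: mult_2 power_add power_one_right mult_ac)
      finally show "c 2 = q * wp * wp * wp ^ ?s"
        unfolding w by simp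
    qed
    \<comment> \<open>Braiding \<open>e\<close> past \<open>x (Suc n)\<close> and back gives the
      scalar 1: the powers of \<open>wp\<close> cancel, and the length of \<open>e\<close> is the
      order of q.\<close>
    have "\<chi> * (c 2 * c 1 ^ k * c 0) = (q ^ k * (q * q)) * (inverse wp * wp) ^ (k + 2) * (wp * inverse wp) ^ ?s"
      unfolding c0 c1 c2 \<chi>_def by (simp only: power_mult_distrib power_add power2_eq_square mult_ac)
    also have "\<dots> = 1"
      using qk wp by simp
    finally have one: "\<chi> * (c 2 * c 1 ^ k * c 0) = 1" .
    have "DD (x (Suc (Suc n))) = DD (x (Suc n) * e) + fv_scale \<chi> (DD (e * x (Suc n)))"
      unfolding x_Suc[of "Suc n"] by (simp add: DD_def ders_add ders_scale del: D.der_mult)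
    also have "DD (x (Suc n) * e) = fv_scale (m * \<eta>) (x (Suc n)) + fv_scale lam (x n * e)"
      unfolding DD_mult_e[OF der1_x] Suc by (simp add: der0_x D.der_letter)
    also have "DD (e * x (Suc n)) = fv_scale lam (e * x n) + fv_scale (m * \<eta> * c 2 * c 1 ^ k) (fv_scale (c 0) (x (Suc n)))"
      unfolding DD_e_mult[OF der1_x aut aut] Suc by (simp add: der0_x D.der_letter aut)
    also have "fv_scale \<chi> (fv_scale lam (e * x n) + fv_scale (m * \<eta> * c 2 * c 1 ^ k) (fv_scale (c 0) (x (Suc n)))) =
        fv_scale \<chi> (fv_scale lam (e * x n)) + fv_scale (m * \<eta> * (\<chi> * (c 2 * c 1 ^ k * c 0))) (x (Suc n))"
      by (simp add: fv.scale_right_distrib mult_ac)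
    finally have "DD (x (Suc (Suc n))) = fv_scale (m * \<eta>) (x (Suc n)) + fv_scale lam (x n * e) +
        (fv_scale \<chi> (fv_scale lam (e * x n)) + fv_scale (m * \<eta>) (x (Suc n)))"
      unfolding one mult_1_right .
    also have "\<dots> = fv_scale lam (x n * e + fv_scale \<chi> (e * x n)) + (fv_scale (m * \<eta>) (x (Suc n)) + fv_scale (m * \<eta>) (x (Suc n)))"
      by (simp add: fv.scale_right_distrib mult.commute algebra_simps)
    finally show ?case
      by (simp only: double add_0_right x_Suc[of n])
  qed
  define W where "W = [2] @ replicate k 1 @ [0::nat]"
  have fold_W: "fold D.der W y = DD y" for y
    by (simp add: W_def DD_def fold_der_replicate)
  have DD_lin: "DD (fv_scale r y) = fv_scale r (DD y)" for r y
    by (simp add: DD_def ders_scale)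
  \<comment> \<open>Each block W applies \<open>DD\<close> once, and the final letter 0 recognizes
    \<open>x 0 = P\<close>, since \<open>der 0\<close> kills every later \<open>x n\<close>.\<close>
  define w where "w j = concat (replicate j W) @ [0]" for j
  have pr_w: "D.pr (w j) (fv_scale r (x n)) = (if n = j then r * lam ^ j else 0)" for j n r
  proof (induction j arbitrary: n r)
    case 0
    show ?case
      by (cases n) (simp_all add: w_def x_0 D.der_letter der0_x)
  next
    case (Suc j)
    have "w (Suc j) = W @ w j"
      by (simp add: w_def)
    then have "D.pr (w (Suc j)) (fv_scale r (x n)) = D.pr (w j) (DD (fv_scale r (x n)))"
      by (simp only: pr_append fold_W)
    also have "\<dots> = (if n = Suc j then r * lam ^ Suc j else 0)"
    proof (cases n)
      case 0
      have "DD (x 0) = 0"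
        by (simp add: x_0 DD_def D.der_letter ders_zero)
      then show ?thesis
        by (simp add: 0 DD_lin)
    next
      case (Suc n')
      then show ?thesis
        using Suc.IH[of "r * lam" n'] by (simp add: DD_lin DD_x mult_ac)
    qed
    finally show ?case .
  qed
  show ?thesis
  proof (rule infinite_of_functionals)
    have "set (w j) \<subseteq> {0, 1, 2}" for j
      by (auto simp: w_def W_def)
    then show "w j \<in> lists {j. mu j \<noteq> 0}" for j
      using a by (fastforce simp: mu_def)
    show "D.pr (w j) (x n) = (if n = j then lam ^ j else 0)" for j n
      using pr_w[of j 1 n] by simp
    have nz: "1 + q ^ n \<noteq> 0" if "0 < n" "n < k + 2" for n
      using N(3)[OF that] char2_add_eq_0 by blast
    have "m \<noteq> 0"
      unfolding m_def prod_zero_iff[OF finite_lessThan] using nz[of "_ + 2"] by force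
    moreover have "qfact k \<noteq> 0"
      unfolding qfact_def prod_zero_iff[OF finite_lessThan]
    proof (rule notI, elim bexE)
      fix i assume i: "i \<in> {..<k}" "qnum (Suc i) = 0"
      then show False
        using geometric[of "Suc i"] nz[of "Suc i"] by simp
    qed
    ultimately show "lam ^ j \<noteq> 0" for j
      using nz[of k] nz[of "Suc k"] nz[of 1] N(2) by (simp add: lam_def \<eta>_def)
  qed
qed

theorem infinite_dim:
  assumes "q \<noteq> 1"
  shows "nichols_dim (frakL wp q a) = \<infinity>"
proof (cases "\<exists>n>0. q ^ n = 1")
  case True
  define N where "N = (LEAST n. n > 0 \<and> q ^ n = 1)"
  have N: "N > 0 \<and> q ^ N = 1"
    unfolding N_def by (rule LeastI_ex) (use True in blast)
  have less: "q ^ n \<noteq> 1" if "0 < n" "n < N" for n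
    using not_less_Least[of n "\<lambda>n. n > 0 \<and> q ^ n = 1"] that by (auto simp: N_def)
  have "N \<noteq> 1"
    using N assms by auto
  \<comment> \<open>This gives k > 0, without which the factor \<open>1 + q ^ k\<close> of \<eta>
    would vanish. In characteristic 2 the square of \<open>1 + q\<close> is
    \<open>1 + q ^ 2\<close>.\<close>
  moreover have "N \<noteq> 2"
  proof
    assume "N = 2"
    then have "(1 + q) * (1 + q) = 1 + 1 + (q + q)"
      using N by (simp add: algebra_simps power2_eq_square)
    also have "q + q = q * (1 + 1)"
      by (simp only: distrib_left mult_1_right)
    finally have "1 + q = 0"
      by (simp only: char2 mult_zero_right add_0_right mult_eq_0_iff disj_absorb)
    then show False
      using char2_add_eq_0 assms by blast
  qed
  ultimately obtain k where "N = k + 2" "k > 0"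
    using N by (metis One_nat_def Suc_1 add.commute add_2_eq_Suc bot_nat_0.not_eq_extremum not0_implies_Suc)
  then show ?thesis
    using infinite_dim_root[of k] N less by blast
next
  case False
  then show ?thesis
    using infinite_dim_not_root by blast
qed

end

section \<open>Finite dimension for \<open>q = 1\<close>\<close>

context group_braiding
begin

definition spanmod :: "('i, 'k) tensor_alg set \<Rightarrow> ('i, 'k) tensor_alg set"
  where "spanmod V = {p. \<exists>s\<in>fv.span V. p \<approx> s}"

lemma spanmod_base: "p \<in> V \<Longrightarrow> p \<in> spanmod V"
  unfolding spanmod_def using fv.span_base eqv_refl by blast

lemma spanmod_eqv: "p \<approx> r \<Longrightarrow> r \<in> spanmod V \<Longrightarrow> p \<in> spanmod V"
  unfolding spanmod_def using eqv_trans by blast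

lemma subspace_spanmod: "fv.subspace (spanmod V)"
proof (rule fv.subspaceI)
  show "0 \<in> spanmod V"
    unfolding spanmod_def using fv.span_zero eqv_refl by blast
  show "p + r \<in> spanmod V" if "p \<in> spanmod V" "r \<in> spanmod V" for p r
    using that unfolding spanmod_def by (blast intro: fv.span_add eqv_add)
  show "fv_scale c p \<in> spanmod V" if "p \<in> spanmod V" for c p
    using that unfolding spanmod_def by (blast intro: fv.span_scale eqv_scale)
qed

lemma spanmod_lin:
  assumes F: "lin F" "\<And>p. p \<in> nich \<Longrightarrow> F p \<in> nich" and W: "\<And>p. p \<in> V \<Longrightarrow> F p \<in> spanmod W"
    and p: "p \<in> spanmod V"
  shows "F p \<in> spanmod W"
proof -
  obtain s where s: "s \<in> fv.span V" "p \<approx> s"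
    using p by (auto simp: spanmod_def)
  have "F p \<approx> F s"
    using F(2) s(2) unfolding eqv_def by (metis lin_diff[OF F(1)])
  moreover have "F s \<in> spanmod W"
    using s(1)
  proof (induction rule: fv.span_induct_alt)
    case base
    then show ?case
      by (simp add: lin_0[OF F(1)] fv.subspace_0[OF subspace_spanmod])
  next
    case (step c x y)
    then show ?case
      unfolding lin_add[OF F(1)] lin_scale[OF F(1)]
      by (intro fv.subspace_add[OF subspace_spanmod] fv.subspace_scale[OF subspace_spanmod] W step)
  qed
  ultimately show ?thesis
    by (rule spanmod_eqv)
qed

lemma spanmod_nich: "p \<in> nich \<Longrightarrow> p \<in> spanmod V"
  using spanmod_eqv[of p 0] eqv_0_iff fv.subspace_0[OF subspace_spanmod] by blast

end

context laistrygon
begin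

text \<open>The derivative \<open>der X2\<close> of \<open>x2 * x2\<close> is \<open>x1\<close>,
  which \<open>der X1\<close> but not \<open>der X2\<close> removes. Applying \<open>der X2\<close>,
  \<open>der X1\<close>, \<open>der X2\<close> in turn therefore isolates the top
  coefficient.\<close>

lemma x2_independent:
  assumes y: "\<And>n. L.der X1 (y n) \<approx> 0" "\<And>n. L.der X2 (y n) \<approx> 0" and s: "(\<Sum>n<4. y n * x2 ^ n) \<in> L.nich"
  shows "n < 4 \<Longrightarrow> y n \<in> L.nich"
proof -
  have d: "L.der i (y n * r) \<approx> y n * L.der i r" if "i \<noteq> X3" for i n r
  proof -
    have "L.der i (y n * r) = y n * L.der i r + L.der i (y n) * L.aut i r"
      by simp
    also have "\<dots> \<approx> y n * L.der i r + 0 * L.aut i r"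
      using y that by (intro L.eqv_add L.eqv_refl L.eqv_right) (cases i; simp)
    finally show ?thesis by simp
  qed
  have *: "r \<in> L.nich" if "p \<in> L.nich" "L.der i p \<approx> r" for p r i
    using that L.nich_der L.eqv_nich by blast
  let ?q = "x2 * x2 + x1 * x2 + x1 * x1"
  have s0: "y 0 * 1 + y 1 * x2 + y 2 * (x2 * x2) + y 3 * (x2 * (x2 * x2)) \<in> L.nich" (is "?p \<in> _")
  proof -
    have "{..<4::nat} = {0, 1, 2, 3}" by auto
    then show ?thesis
      using s by (simp add: add.assoc power2_eq_square power3_eq_cube mult.assoc)
  qed
  have s1: "y 1 * 1 + y 2 * x1 + y 3 * ?q \<in> L.nich"
  proof (rule *[OF s0])
    have "L.der X2 ?p \<approx> y 0 * L.der X2 1 + y 1 * L.der X2 x2 + y 2 * L.der X2 (x2 * x2) + y 3 * L.der X2 (x2 * (x2 * x2))"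
      unfolding L.der_lin(1) by (intro L.eqv_add d) simp_all
    also have "\<dots> = y 1 * 1 + y 2 * x1 + y 3 * ?q"
      by (simp add: L_simps)
    finally show "L.der X2 ?p \<approx> y 1 * 1 + y 2 * x1 + y 3 * ?q" .
  qed
  have s2: "y 2 * 1 + y 3 * (x2 + x1) \<in> L.nich"
  proof (rule *[OF s1])
    have "L.der X1 (y 1 * 1 + y 2 * x1 + y 3 * ?q) \<approx> y 1 * L.der X1 1 + y 2 * L.der X1 x1 + y 3 * L.der X1 ?q"
      unfolding L.der_lin(1)[of _ _ "y 3 * ?q"] L.der_lin(1)[of _ "y 1 * 1"] by (intro L.eqv_add d) simp_all
    also have "\<dots> = y 2 * 1 + y 3 * (x2 + x1)"
      by (simp add: L_simps)
    finally show "L.der X1 (y 1 * 1 + y 2 * x1 + y 3 * ?q) \<approx> y 2 * 1 + y 3 * (x2 + x1)" .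
  qed
  have s3: "y 3 \<in> L.nich"
  proof (rule *[OF s2])
    have "L.der X2 (y 2 * 1 + y 3 * (x2 + x1)) \<approx> y 2 * L.der X2 1 + y 3 * L.der X2 (x2 + x1)"
      unfolding L.der_lin(1)[of _ "y 2 * 1"] by (intro L.eqv_add d) simp_all
    then show "L.der X2 (y 2 * 1 + y 3 * (x2 + x1)) \<approx> y 3"
      by (simp add: L.der_letter)
  qed
  from L.nich_diff[OF s2 L.nich_mult(1)[OF s3, of "x2 + x1"]] have y2: "y 2 \<in> L.nich" by simp
  from L.nich_diff[OF s1 L.nich_mult(1)[OF s3, of ?q]] have "y 1 + y 2 * x1 \<in> L.nich" by simp
  from L.nich_diff[OF this L.nich_mult(1)[OF y2, of x1]] have y1: "y 1 \<in> L.nich" by simp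
  from L.nich_diff[OF s0 L.nich_mult(1)[OF s3, of "x2 * (x2 * x2)"]]
  have "y 0 + y 1 * x2 + y 2 * (x2 * x2) \<in> L.nich" by simp
  from L.nich_diff[OF this L.nich_mult(1)[OF y2, of "x2 * x2"]] have "y 0 + y 1 * x2 \<in> L.nich" by simp
  from L.nich_diff[OF this L.nich_mult(1)[OF y1, of x2]] have y0: "y 0 \<in> L.nich" by simp
  assume "n < 4"
  then consider "n = 0" | "n = 1" | "n = 2" | "n = 3" by linarith
  then show "y n \<in> L.nich"
    using s3 y2 y1 y0 by cases auto
qed

definition B :: "(idx, 'k) tensor_alg set"
  where "B = {x2 ^ c * f n | c n. True}"

lemma x2_B: "p \<in> L.spanmod B \<Longrightarrow> x2 * p \<in> L.spanmod B"
proof (rule L.spanmod_lin[of "(*) x2"])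
  fix p assume "p \<in> B"
  then obtain c n where "p = x2 ^ c * f n"
    by (auto simp: B_def)
  then have "x2 * p = x2 ^ Suc c * f n"
    by (simp add: mult.assoc)
  then show "x2 * p \<in> L.spanmod B"
    unfolding B_def by (metis (mono_tags, lifting) L.spanmod_base mem_Collect_eq)
qed (auto simp: L.nich_mult)

lemma f_B: "f n \<in> L.spanmod B"
proof (rule L.spanmod_base)
  show "f n \<in> B"
    unfolding B_def by (metis (mono_tags, lifting) mem_Collect_eq mult_1_left power_0)
qed

text \<open>Vanishing products are represented by \<open>f 4 = 0\<close>, so every product is
  congruent to a single \<open>f k\<close>.\<close>

lemma f_f: "\<exists>k. f j * f n \<approx> f k"
proof -
  have f4: "f 4 = 0"
    by simp
  have x1: "\<exists>k. f n * x1 \<approx> f k" for n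
    using f_x1[of n] f4 by (metis (full_types))
  have x21: "\<exists>k. x21 * f n \<approx> f k" for n
  proof (cases n rule: nat_cases4)
    case 3
    then show ?thesis
      using x21_x21 by (intro exI[of _ 4]) simp
  next
    case 4
    have "x21 * f n = x21 * x21 * x1"
      by (simp add: 4 mult.assoc)
    also have "\<dots> \<approx> 0 * x1"
      by (intro L.eqv_right x21_x21)
    finally show ?thesis
      by (intro exI[of _ 4]) simp
  next
    case 5
    then show ?thesis
      by (intro exI[of _ 4]) simp
  next
    case 1
    then have "x21 * f n = f 2" by simp
    then show ?thesis by (metis L.eqv_refl)
  next
    case 2
    then have "x21 * f n = f 3" by simp
    then show ?thesis by (metis L.eqv_refl)
  qed
  show ?thesis
  proof (cases j rule: nat_cases4)
    case 1
    then show ?thesis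
      by (intro exI[of _ n]) simp
  next
    case 2
    then show ?thesis
      using x1_f[of n] x1[of n] L.eqv_trans by auto
  next
    case 3
    then show ?thesis
      using x21 by simp
  next
    case 4
    have "f j * f n = x21 * (x1 * f n)"
      by (simp add: 4 mult.assoc)
    also have "\<dots> \<approx> x21 * (f n * x1)"
      by (intro L.eqv_left x1_f)
    finally have *: "f j * f n \<approx> x21 * (f n * x1)" .
    obtain k where "f n * x1 \<approx> f k"
      using x1 by blast
    from L.eqv_trans[OF * L.eqv_left[OF this]] show ?thesis
      using x21[of k] L.eqv_trans by blast
  next
    case 5
    then show ?thesis
      by (intro exI[of _ 4]) simp
  qed
qed

lemma f_x2_f_B: "f j * (x2 ^ c * f n) \<in> L.spanmod B"
proof (induction c arbitrary: j)
  case 0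
  obtain k where "f j * f n \<approx> f k"
    using f_f by blast
  then show ?case
    using L.spanmod_eqv f_B by simp
next
  case (Suc c)
  have "x2 * (f j * (x2 ^ c * f n)) + f (Suc j) * (x2 ^ c * f n) \<in> L.spanmod B"
    by (intro fv.subspace_add[OF L.subspace_spanmod] x2_B Suc)
  moreover have "f j * (x2 ^ Suc c * f n) \<approx> x2 * (f j * (x2 ^ c * f n)) + f (Suc j) * (x2 ^ c * f n)" if "j > 0"
  proof -
    have "f j * (x2 ^ Suc c * f n) = f j * x2 * (x2 ^ c * f n)"
      by (simp add: mult.assoc)
    also have "\<dots> \<approx> (x2 * f j + f (Suc j)) * (x2 ^ c * f n)"
      by (intro L.eqv_right f_x2 that)
    finally show ?thesis
      by (simp add: distrib_right mult.assoc)
  qed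
  moreover have "f 0 * (x2 ^ Suc c * f n) \<in> L.spanmod B"
    using x2_B[OF Suc[of 0]] by (simp add: mult.assoc)
  ultimately show ?case
    using L.spanmod_eqv by (cases "j > 0") auto
qed

lemma x1_B: "p \<in> L.spanmod B \<Longrightarrow> x1 * p \<in> L.spanmod B"
proof (rule L.spanmod_lin[of "(*) x1"])
  fix p assume "p \<in> B"
  then show "x1 * p \<in> L.spanmod B"
    using f_x2_f_B[of "Suc 0"] by (auto simp: B_def)
qed (auto simp: L.nich_mult)

text \<open>Passing one \<open>z i\<close> leaves a correction with \<open>z (Suc i)\<close> in its
  place. The corrections are thus again combinations of words in the z's, and the identity holds
  exactly, not only modulo the relations.\<close>

lemma x2_psi: "\<exists>p. x2 * psi_word w = fv_scale (wp ^ length w) (psi_word w * x2) + psi p"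
proof (induction w)
  case Nil
  have "x2 * psi_word [] = fv_scale (wp ^ length []) (psi_word [] * x2) + psi 0"
    by simp
  then show ?case by blast
next
  case (Cons i w)
  then obtain p where p: "x2 * psi_word w = fv_scale (wp ^ length w) (psi_word w * x2) + psi p"
    by blast
  have "x2 * psi_word (i # w) = x2 * z i * psi_word w"
    by (simp add: mult.assoc)
  also have "\<dots> = fv_scale wp (z i * (x2 * psi_word w)) + z (Suc i) * psi_word w"
    unfolding x2_z by (simp add: distrib_right mult.assoc)
  also have "\<dots> = fv_scale (wp ^ length (i # w)) (psi_word (i # w) * x2) + psi (fv_scale wp (basis_vec [i] * p) + basis_vec [Suc i] * basis_vec w)"
    unfolding p by (simp add: distrib_left fv.scale_right_distrib mult.assoc add.assoc del: z.simps)
  finally show ?case by blast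
qed

definition good :: "nat set" where "good = {j. mu j \<noteq> 0}"

lemma z_nich: "j \<notin> good \<Longrightarrow> z j \<in> L.nich"
proof (rule L.nichI)
  fix i assume "j \<notin> good"
  then show "L.der i (z j) \<in> L.nich"
    using der1_z[of j] der2_z[of j] der3_z[of j] by (cases i) (auto simp: good_def L.eqv_0_iff)
qed simp

lemma psi_word_nich: "j \<in> set w \<Longrightarrow> j \<notin> good \<Longrightarrow> psi_word w \<in> L.nich"
  by (induction w) (auto simp: z_nich L.nich_mult simp del: z.simps)

lemma finite_good: "finite good"
  by (rule finite_subset[of _ "{..3}"]) (auto simp: good_def mu_def split: if_splits)

definition mon :: "nat set \<times> nat \<times> nat \<Rightarrow> (idx, 'k) tensor_alg"
  where "mon = (\<lambda>(A, c, n). psi_word (sorted_list_of_set A) * (x2 ^ c * f n))"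

definition mon_idx :: "(nat set \<times> nat \<times> nat) set"
  where "mon_idx = Pow good \<times> {..<4} \<times> {..<4}"

lemma der_distinct:
  "distinct w \<Longrightarrow> \<exists>c\<noteq>0. D.der i (basis_vec w) = (if i \<in> set w then fv_scale c (basis_vec (remove1 i w)) else 0)"
proof (induction w)
  case (Cons j w)
  then obtain c where c: "c \<noteq> 0" "D.der i (basis_vec w) = (if i \<in> set w then fv_scale c (basis_vec (remove1 i w)) else 0)"
    by auto
  have d: "D.der i (basis_vec (j # w)) = basis_vec [j] * D.der i (basis_vec w) + (if i = j then D.aut i (basis_vec w) else 0)"
    unfolding basis_vec_Cons[of j w] by (rule D.der_letter_mult)
  show ?case
  proof (cases "i = j")
    case True
    then show ?thesis
      using Cons.prems wp q unfolding d c(2) D.aut_basis D_aut_word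
      by (intro exI[of _ "(q * wp ^ i) ^ length w * inverse wp ^ sum_list w"]) auto
  next
    case False
    then show ?thesis
      using c(1) unfolding d c(2) by (auto simp: basis_vec_append[symmetric])
  qed
qed (auto simp: basis_vec_Nil intro: exI[of _ 1])

text \<open>Each letter occurs once, so every derivation deletes it up to a nonzero scalar. Sorted
  words therefore have a diagonal pairing matrix.\<close>

lemma pr_distinct: "distinct v \<Longrightarrow> distinct w \<Longrightarrow> D.pr v (basis_vec w) \<noteq> 0 \<longleftrightarrow> set v = set w"
proof (induction v arbitrary: w)
  case (Cons i v)
  obtain c where c: "c \<noteq> 0" "D.der i (basis_vec w) = (if i \<in> set w then fv_scale c (basis_vec (remove1 i w)) else 0)"
    using der_distinct[OF Cons.prems(2)] by blast
  show ?case
  proof (cases "i \<in> set w")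
    case True
    then have "D.pr (i # v) (basis_vec w) \<noteq> 0 \<longleftrightarrow> set v = set (remove1 i w)"
      using Cons c by simp
    also have "\<dots> \<longleftrightarrow> set (i # v) = set w"
      using Cons.prems True by auto
    finally show ?thesis .
  next
    case False
    then show ?thesis
      using c(2) by auto
  qed
qed (simp add: tcounit_basis)

text \<open>The coefficients are reached in three layers: \<open>f_independent\<close> separates the
  \<open>f n\<close>, \<open>x2_independent\<close> the powers of \<open>x2\<close>, and the pairing
  of sorted words the products of z's. The argument is uniform in q; only the spanning part uses q =
  1.\<close>

lemma indep_mon: "indep_mod L.nich mon mon_idx"
  unfolding indep_mod_def
proof (intro allI impI)
  fix b assume b: "(\<Sum>x\<in>mon_idx. fv_scale (b x) (mon x)) \<in> L.nich"
  define p where "p c n = (\<Sum>A\<in>Pow good. fv_scale (b (A, c, n)) (basis_vec (sorted_list_of_set A)))" for c n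
  define y where "y n = (\<Sum>c<4. psi (p c n) * x2 ^ c)" for n
  have "(\<Sum>x\<in>mon_idx. fv_scale (b x) (mon x)) =
    (\<Sum>A\<in>Pow good. \<Sum>c<4. \<Sum>n<4. fv_scale (b (A, c, n)) (psi_word (sorted_list_of_set A) * (x2 ^ c * f n)))"
    by (simp add: mon_idx_def mon_def sum.cartesian_product case_prod_unfold)
  also have "\<dots> = (\<Sum>n<4. \<Sum>c<4. \<Sum>A\<in>Pow good. fv_scale (b (A, c, n)) (psi_word (sorted_list_of_set A) * (x2 ^ c * f n)))"
    by (subst (1) sum.swap, subst (2) sum.swap, subst (1) sum.swap) simp
  also have "\<dots> = (\<Sum>n<4. y n * f n)"
    by (simp add: y_def p_def sum_distrib_right mult.assoc)
  finally have "(\<Sum>n<4. y n * f n) \<in> L.nich"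
    using b by simp
  moreover have "L.der X1 (y n) \<approx> 0" for n
  proof -
    have "L.der X1 (x2 ^ c) = 0" for c
      by (induction c) (simp_all add: L.der_letter)
    then have "L.der X1 (y n) = (\<Sum>c<4. L.der X1 (psi (p c n)) * L.aut X1 (x2 ^ c))"
      by (simp add: y_def)
    also have "\<dots> \<approx> (\<Sum>c<4. 0 * L.aut X1 (x2 ^ c))"
      by (intro L.eqv_sum L.eqv_right der12_psi)
    finally show ?thesis by simp
  qed
  ultimately have "y n \<in> L.nich" if "n < 4" for n
    using f_independent that by blast
  then have psi: "psi (p c n) \<in> L.nich" if "n < 4" "c < 4" for c n
    using x2_independent[of "\<lambda>c. psi (p c n)" c] der12_psi that by (simp add: y_def)
  show "\<forall>x\<in>mon_idx. b x = 0"
  proof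
    fix x assume "x \<in> mon_idx"
    then obtain A c n where x: "x = (A, c, n)" "A \<subseteq> good" "c < 4" "n < 4"
      by (auto simp: mon_idx_def)
    let ?s = "sorted_list_of_set :: nat set \<Rightarrow> nat list"
    have fin: "finite C" if "C \<subseteq> good" for C
      using that finite_good finite_subset by blast
    have "0 = D.pr (?s A) (p c n)"
      using pr_psi_nich[OF psi[OF x(4,3)], of "?s A"] fin[OF x(2)] x(2) by (auto simp: good_def lists_eq_set)
    also have "\<dots> = (\<Sum>C\<in>Pow good. b (C, c, n) * D.pr (?s A) (basis_vec (?s C)))"
      by (simp only: p_def functional_simps(4)[OF D.functional_pr(1)] D.pr_scale)
    also have "\<dots> = (\<Sum>C\<in>Pow good. if C = A then b (A, c, n) * D.pr (?s A) (basis_vec (?s A)) else 0)"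
      by (rule sum.cong[OF refl]) (use fin x(2) pr_distinct[of "?s A" "?s _"] in auto)
    also have "\<dots> = b (A, c, n) * D.pr (?s A) (basis_vec (?s A))"
      using x(2) finite_good by simp
    finally show "b x = 0"
      using pr_distinct[of "?s A" "?s A"] by (simp add: x(1))
  qed
qed

section \<open>Sorting words of the diagonal braiding when q = 1\<close>

lemma D_commute:
  assumes "q = 1" "i \<noteq> j"
  shows "D.eqv (basis_vec [i] * basis_vec [j]) (fv_scale (wp ^ i * inverse wp ^ j) (basis_vec [j] * basis_vec [i]))"
proof (rule D.eqvI_der)
  have aut: "D.aut i (basis_vec [j]) = fv_scale (wp ^ i * inverse wp ^ j) (basis_vec [j])" for i j
  proof -
    have "D.aut i (basis_vec [j]) = fv_scale (q * (wp ^ i * inverse wp ^ j)) (basis_vec [j])"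
      by (simp add: D.aut_basis D_aut_word mult.assoc)
    moreover have "q * r = r" for r
      using assms(1) by (metis mult_1_left)
    ultimately show ?thesis
      by (simp only:)
  qed
  have "wp ^ i * inverse wp ^ j * (wp ^ j * inverse wp ^ i) = (wp * inverse wp) ^ i * (wp * inverse wp) ^ j"
    by (simp only: power_mult_distrib mult_ac)
  then have "wp ^ i * inverse wp ^ j * (wp ^ j * inverse wp ^ i) = 1"
    using wp by simp
  then show "D.eqv (D.der l (basis_vec [i] * basis_vec [j])) (D.der l (fv_scale (wp ^ i * inverse wp ^ j) (basis_vec [j] * basis_vec [i])))" for l
    using assms(2) by (simp add: D.der_letter aut)
qed (simp add: tcounit_basis)

lemma D_square:
  assumes "q = 1"
  shows "D.eqv (basis_vec [i] * basis_vec [i]) 0"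
proof (rule D.eqvI_der)
  have "fv_scale q p = p" for p :: "(nat, 'k) tensor_alg"
    using assms by (metis fv.scale_one)
  then show "D.eqv (D.der l (basis_vec [i] * basis_vec [i])) (D.der l 0)" for l
    by (simp add: D.der_letter aut_self double)
qed (simp add: tcounit_basis)

text \<open>When i already occurs in w, it can be moved next to its twin, where the square vanishes.
  The scalar is then 0 and the word on the right is a placeholder.\<close>

lemma D_insert:
  assumes q1: "q = 1"
  shows "\<exists>c. D.eqv (basis_vec [i] * basis_vec w) (fv_scale c (basis_vec (if i \<in> set w then w else insort i w)))"
proof -
  have "i \<in> set w \<Longrightarrow> D.eqv (basis_vec [i] * basis_vec w) 0" for w
  proof (induction w)
    case (Cons j w)
    have e: "basis_vec [i] * basis_vec (j # w) = basis_vec [i] * basis_vec [j] * (basis_vec w :: (nat, 'k) tensor_alg)"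
      unfolding basis_vec_Cons[of j w] by (simp add: mult.assoc)
    show ?case
    proof (cases "i = j")
      case True
      show ?thesis
        unfolding e using D.eqv_right[OF D_square[OF q1, of i], of "basis_vec w"] True by simp
    next
      case False
      let ?c = "wp ^ i * inverse wp ^ j"
      have "D.eqv (basis_vec [i] * basis_vec (j # w)) (fv_scale ?c (basis_vec [j] * basis_vec [i]) * basis_vec w)"
        unfolding e by (intro D.eqv_right D_commute q1 False)
      also have "fv_scale ?c (basis_vec [j] * basis_vec [i]) * basis_vec w = fv_scale ?c (basis_vec [j] * (basis_vec [i] * basis_vec w))"
        by (simp add: mult.assoc)
      also have "D.eqv \<dots> (fv_scale ?c (basis_vec [j] * 0))"
        using Cons False by (intro D.eqv_scale D.eqv_left) auto
      finally show ?thesis by simp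
    qed
  qed simp
  moreover have "i \<notin> set w \<Longrightarrow> \<exists>c. D.eqv (basis_vec [i] * basis_vec w) (fv_scale c (basis_vec (insort i w)))" for w
  proof (induction w)
    case Nil
    have "basis_vec [i] * basis_vec [] = fv_scale 1 (basis_vec (insort i []) :: (nat, 'k) tensor_alg)"
      by (simp add: basis_vec_Nil)
    then show ?case
      by (metis D.eqv_refl)
  next
    case (Cons j w)
    have e: "basis_vec [i] * basis_vec (j # w) = basis_vec [i] * basis_vec [j] * (basis_vec w :: (nat, 'k) tensor_alg)"
      unfolding basis_vec_Cons[of j w] by (simp add: mult.assoc)
    show ?case
    proof (cases "i \<le> j")
      case True
      then have "basis_vec [i] * basis_vec (j # w) = fv_scale 1 (basis_vec (insort i (j # w)) :: (nat, 'k) tensor_alg)"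
        by (simp add: basis_vec_append[symmetric])
      then show ?thesis
        by (metis D.eqv_refl)
    next
      case False
      then obtain d where d: "D.eqv (basis_vec [i] * basis_vec w) (fv_scale d (basis_vec (insort i w)))"
        using Cons by auto
      let ?c = "wp ^ i * inverse wp ^ j"
      have "D.eqv (basis_vec [i] * basis_vec (j # w)) (fv_scale ?c (basis_vec [j] * basis_vec [i]) * basis_vec w)"
        unfolding e using False by (intro D.eqv_right D_commute q1) auto
      also have "fv_scale ?c (basis_vec [j] * basis_vec [i]) * basis_vec w = fv_scale ?c (basis_vec [j] * (basis_vec [i] * basis_vec w))"
        by (simp add: mult.assoc)
      also have "D.eqv \<dots> (fv_scale ?c (basis_vec [j] * fv_scale d (basis_vec (insort i w))))"
        by (intro D.eqv_scale D.eqv_left d)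
      also have "\<dots> = fv_scale (?c * d) (basis_vec (insort i (j # w)))"
        using False by (simp add: basis_vec_append[symmetric])
      finally show ?thesis by blast
    qed
  qed
  ultimately show ?thesis
    by (cases "i \<in> set w") (auto intro: exI[of _ 0])
qed

lemma D_sort:
  assumes q1: "q = 1"
  shows "\<exists>c A. finite A \<and> D.eqv (basis_vec w) (fv_scale c (basis_vec (sorted_list_of_set A)))"
proof (induction w)
  case Nil
  have "basis_vec [] = fv_scale 1 (basis_vec (sorted_list_of_set {}) :: (nat, 'k) tensor_alg)"
    by simp
  then show ?case
    by (metis D.eqv_refl finite.emptyI)
next
  case (Cons i w)
  then obtain c A where A: "finite A" "D.eqv (basis_vec w) (fv_scale c (basis_vec (sorted_list_of_set A)))"
    by blast
  obtain d where d: "D.eqv (basis_vec [i] * basis_vec (sorted_list_of_set A))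
      (fv_scale d (basis_vec (if i \<in> A then sorted_list_of_set A else insort i (sorted_list_of_set A))))"
    using D_insert[OF q1, of i "sorted_list_of_set A"] A(1) by auto
  have s: "(if i \<in> A then sorted_list_of_set A else insort i (sorted_list_of_set A)) = sorted_list_of_set (insert i A)"
    using A(1) by (auto simp: insert_absorb simp del: sorted_list_of_set_insert_remove)
  have "D.eqv (basis_vec (i # w)) (basis_vec [i] * fv_scale c (basis_vec (sorted_list_of_set A)))"
    unfolding basis_vec_Cons[of i w] by (intro D.eqv_left A)
  also have "\<dots> = fv_scale c (basis_vec [i] * basis_vec (sorted_list_of_set A))"
    by simp
  also have "D.eqv \<dots> (fv_scale c (fv_scale d (basis_vec (sorted_list_of_set (insert i A)))))"
    using d unfolding s by (rule D.eqv_scale)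
  finally have "D.eqv (basis_vec (i # w)) (fv_scale (c * d) (basis_vec (sorted_list_of_set (insert i A))))"
    by simp
  then show ?case
    using A(1) by blast
qed

lemma x2_power_nich: "c \<ge> 4 \<Longrightarrow> x2 ^ c \<in> L.nich"
proof -
  assume "c \<ge> 4"
  then have "x2 ^ c = x2 ^ 4 * x2 ^ (c - 4)"
    by (simp flip: power_add)
  also have "x2 ^ 4 = x2 * x2 * (x2 * x2)"
    by (simp add: power4_eq_xxxx mult.assoc)
  finally show ?thesis
    using x2_x2_x2_x2 L.nich_mult(1) by (simp add: L.eqv_0_iff)
qed

lemma psi_B:
  assumes q1: "q = 1" and b: "b \<in> L.spanmod B"
  shows "psi p * b \<in> L.spanmod (mon ` mon_idx)"
proof -
  have 1: "psi_word w * (x2 ^ c * f n) \<in> L.spanmod (mon ` mon_idx)" for w c n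
  proof (cases "c < 4 \<and> n < 4")
    case True
    obtain d A where A: "finite A" "D.eqv (basis_vec w) (fv_scale d (basis_vec (sorted_list_of_set A)))"
      using D_sort[OF q1] by blast
    \<comment> \<open>\<open>psi_nich\<close> carries the sorting congruence over from the diagonal
      algebra.\<close>
    then have "psi_word w \<approx> fv_scale d (psi_word (sorted_list_of_set A))"
      using psi_nich unfolding D.eqv_def L.eqv_def by fastforce
    then have *: "psi_word w * (x2 ^ c * f n) \<approx> fv_scale d (mon (A, c, n))"
      using L.eqv_right by (fastforce simp: mon_def)
    show ?thesis
    proof (cases "A \<subseteq> good")
      case True
      then have "mon (A, c, n) \<in> L.spanmod (mon ` mon_idx)"
        using \<open>c < 4 \<and> n < 4\<close> by (intro L.spanmod_base) (auto simp: mon_idx_def)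
      then show ?thesis
        using * L.spanmod_eqv fv.subspace_scale[OF L.subspace_spanmod] by blast
    next
      case False
      then obtain j where "j \<in> A" "j \<notin> good" by blast
      then have "mon (A, c, n) \<in> L.nich"
        using psi_word_nich[of j "sorted_list_of_set A"] A(1) by (simp add: mon_def L.nich_mult)
      then show ?thesis
        using * L.spanmod_eqv L.spanmod_nich L.nich_scale by blast
    qed
  next
    case False
    then have "psi_word w * (x2 ^ c * f n) \<in> L.nich"
      using x2_power_nich[of c] by (cases "c < 4") (auto simp: L.nich_mult)
    then show ?thesis
      by (rule L.spanmod_nich)
  qed
  have 2: "psi p * (x2 ^ c * f n) \<in> L.spanmod (mon ` mon_idx)" for p c n
    by (induction p rule: fv_induct)
      (simp_all add: 1 distrib_right fv.subspace_0[OF L.subspace_spanmod]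
        fv.subspace_scale[OF L.subspace_spanmod] fv.subspace_add[OF L.subspace_spanmod])
  show ?thesis
    by (rule L.spanmod_lin[OF _ _ _ b, of "(*) (psi p)"]) (auto simp: B_def L.nich_mult 2)
qed

text \<open>The span contains 1 and is stable under left multiplication by each letter:
  \<open>x1\<close> and \<open>x2\<close> pass through the z-word into the factor b, which stays in
  the span of B, and \<open>x3 = z 0\<close> lengthens the z-word.\<close>

lemma spanmod_mon:
  assumes q1: "q = 1"
  shows "p \<in> L.spanmod (mon ` mon_idx)"
proof -
  let ?M = "L.spanmod (mon ` mon_idx)"
  have gen: "basis_vec [i] * (psi_word w * b) \<in> ?M" if b: "b \<in> L.spanmod B" for i w b
  proof (cases i)
    case X1
    have "x1 * psi_word w * b \<approx> fv_scale (wp ^ length w) (psi_word w * x1) * b"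
      using f_psi[of "Suc 0" w] by (intro L.eqv_right) simp
    also have "\<dots> = fv_scale (wp ^ length w) (psi (basis_vec w) * (x1 * b))"
      by (simp add: mult.assoc)
    finally have *: "x1 * psi_word w * b \<approx> fv_scale (wp ^ length w) (psi (basis_vec w) * (x1 * b))" .
    have "fv_scale (wp ^ length w) (psi (basis_vec w) * (x1 * b)) \<in> ?M"
      by (intro fv.subspace_scale[OF L.subspace_spanmod] psi_B q1 x1_B b)
    from L.spanmod_eqv[OF * this] show ?thesis
      by (simp add: X1 mult.assoc)
  next
    case X2
    obtain p where p: "x2 * psi_word w = fv_scale (wp ^ length w) (psi_word w * x2) + psi p"
      using x2_psi by blast
    have "x2 * (psi_word w * b) = fv_scale (wp ^ length w) (psi (basis_vec w) * (x2 * b)) + psi p * b"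
      unfolding mult.assoc[symmetric] p by (simp add: distrib_right mult.assoc)
    also have "\<dots> \<in> ?M"
      by (intro fv.subspace_add[OF L.subspace_spanmod] fv.subspace_scale[OF L.subspace_spanmod] psi_B q1 x2_B b)
    finally show ?thesis
      by (simp add: X2)
  next
    case X3
    have "x3 * (psi_word w * b) = psi (basis_vec (0 # w)) * b"
      by (simp add: mult.assoc)
    then show ?thesis
      using psi_B[OF q1 b, of "basis_vec (0 # w)"] by (simp add: X3)
  qed
  show ?thesis
  proof (induction p rule: tensor_induct)
    case one
    show ?case
      using psi_B[OF q1 f_B[of 0], of 1] by simp
  next
    case (letter i p)
    show ?case
    proof (rule L.spanmod_lin[OF _ _ _ letter, of "(*) (basis_vec [i])"])
      fix p assume "p \<in> mon ` mon_idx"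
      then obtain A c n where "p = psi_word (sorted_list_of_set A) * (x2 ^ c * f n)"
        by (auto simp: mon_def)
      moreover have "x2 ^ c * f n \<in> L.spanmod B"
        by (rule L.spanmod_base) (auto simp: B_def)
      ultimately show "basis_vec [i] * p \<in> ?M"
        using gen by simp
    qed (auto simp: L.nich_mult)
  qed (simp_all add: fv.subspace_0[OF L.subspace_spanmod]
        fv.subspace_scale[OF L.subspace_spanmod] fv.subspace_add[OF L.subspace_spanmod])
qed

lemma good_eq: "good = (if a = 1 then {0, 1, 2} else {0, 1, 2, 3})"
  using a char2_add_eq_0[of a] char2 by (auto simp: good_def mu_def)

theorem finite_dim:
  assumes q1: "q = 1"
  shows "nichols_dim (frakL wp q a) = enat (if a = 1 then 2 ^ 7 else 2 ^ 8)"
proof -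
  have fin: "finite mon_idx"
    by (simp add: mon_idx_def finite_good)
  have "\<exists>b\<in>fv.span (mon ` mon_idx). p - b \<in> L.nich" for p
    using spanmod_mon[OF q1, of p] by (auto simp: L.spanmod_def L.eqv_def)
  then have "nichols_dim (frakL wp q a) = enat (card mon_idx)"
    unfolding nichols_dim_def L.nichols_ideal_eq
    by (rule quotient_dim_eqI[OF L.subspace_nich fin indep_mon])
  moreover have "card mon_idx = (if a = 1 then 2 ^ 7 else 2 ^ 8)"
    by (simp add: mon_idx_def card_cartesian_product card_Pow finite_good good_eq)
  ultimately show ?thesis
    by simp
qed

end

theorem theorem3p1:
  fixes wp q22 a :: "'k::alg_closed_field"
  assumes "CHAR('k) = 2"
    and "wp \<noteq> 0" and "q22 \<noteq> 0" and "a \<noteq> 0"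
  shows "(nichols_dim (frakL wp q22 a) < \<infinity> \<longleftrightarrow> q22 = 1) \<and>
         nichols_dim (frakL wp 1 a) = (if a = 1 then 2 ^ 7 else 2 ^ 8)"
proof
  have "of_nat CHAR('k) = (0 :: 'k)"
    by (rule of_nat_CHAR)
  then have char2: "(1::'k) + 1 = 0"
    using assms(1) by simp
  have pow: "(2 :: enat) ^ n = enat (2 ^ n)" for n
    by (induction n) (simp_all add: one_enat_def numeral_eq_enat)
  interpret one: laistrygon wp 1 a
    by unfold_locales (use char2 assms in auto)
  interpret q: laistrygon wp q22 a
    by unfold_locales (use char2 assms in auto)
  show "nichols_dim (frakL wp 1 a) = (if a = 1 then 2 ^ 7 else 2 ^ 8)"
    unfolding pow using one.finite_dim by simp
  show "nichols_dim (frakL wp q22 a) < \<infinity> \<longleftrightarrow> q22 = 1"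
  proof (cases "q22 = 1")
    case True
    then show ?thesis
      using one.finite_dim by simp
  qed (simp add: q.infinite_dim)
qed

end
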